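(* Let \(m,n\geq 2\). Then \(\mathrm{gon}(TQ_{m,n})=mn-\alpha(TQ_{m,n})\). In particular, for \(m=n\), \[\mathrm{gon}(TQ_{n,n})=\begin{cases}n(n-1)&\text{if }\gcd(6,n)=1,\\ n(n-1)+1&\text{otherwise, if }3\nmid n\text{ and }4\nmid n,\\ n(n-1)+2&\text{in all other cases,}\end{cases}\] and \(\mathrm{gon}(TQ_{m,n})=mn-\gcd(m,n)\) for \(m\neq n\). Moreover, there is a one-to-one correspondence between divisor classes \([D]\) on \(TQ_{m,n}\) of rank \(1\) and degree \(\mathrm{gon}(TQ_{m,n})\), and maximum independent sets of \(TQ_{m,n}\).
   Context: For integers \(m,n\geq 2\), the \(m\times n\) toroidal queen's graph \(TQ_{m,n}\) is the simple graph with vertex set \(\{(x,y): 0\leq x\leq m-1,\ 0\leq y\leq n-1\}\) (viewed as \(\mathbb{Z}_m\times\mathbb{Z}_n\); rows are the sets of vertices with fixed \(y\), columns those with fixed \(x\)), where two distinct vertices \((x,y),(x',y')\) are adjacent iff \(x=x'\), or \(y=y'\), or there is an integer \(k\) with \(x'\equiv x+k \pmod m\) and either \(y'\equiv y+k\pmod n\) or \(y'\equiv y-k\pmod n\) (diagonal moves wrapping around the torus). For a graph \(G\), \(\alpha(G)\) denotes its independence number; an independent set of that size is a maximum independent set. Chip-firing: a divisor on a graph \(G\) is an element of \(\mathbb{Z}^{V(G)}\); its degree is the sum of its entries; it is effective if all entries are nonnegative. Firing a vertex \(v\) moves one chip from \(v\) along each edge incident to \(v\) to the other endpoint. Two divisors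 are equivalent if one is obtained from the other by a sequence of firings; \([D]\) is the equivalence class. The rank \(r(D)\) is \(-1\) if \(D\) is not equivalent to an effective divisor, and otherwise the largest \(k\geq 0\) such that for every effective divisor \(E\) of degree \(k\), \(D-E\) is equivalent to an effective divisor. The gonality \(\mathrm{gon}(G)\) is the minimum degree of a divisor with \(r(D)\geq 1\).
   Formalization: The formula gon(TQ_{m,n}) = mn − gcd(m,n) for m ≠ n is stated only for {m,n} ≠ {3,6}; there it is false, since α(TQ_{3,6}) = 2 and so the gonality is 16, not 15. *)

theory Defs
  imports "HOL-Library.Ramsey" "HOL-Number_Theory.Cong"
begin

text \<open>
  A finite simple graph is given by its vertex set \<open>V\<close> and its set \<open>E\<close> of edges, each edge being
  a two-element set \<open>{u, v}\<close>, as in \<open>HOL-Library.Ramsey\<close>, which supplies \<open>indep\<close>.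
\<close>

definition independence_number :: "'a set \<Rightarrow> 'a set set \<Rightarrow> nat" where
  "independence_number V E = Max (card ` {S. S \<subseteq> V \<and> indep S E})"

definition max_indep_sets :: "'a set \<Rightarrow> 'a set set \<Rightarrow> 'a set set" where
  "max_indep_sets V E = {S. S \<subseteq> V \<and> indep S E \<and> card S = independence_number V E}"


subsection \<open>Chip-firing\<close>

text \<open>
  The group \<open>\<int>\<^sup>V\<close> is represented by the integer-valued functions that vanish outside \<open>V\<close>, so that
  a divisor on \<open>V\<close> is represented by exactly one function.
\<close>

definition divisors :: "'a set \<Rightarrow> ('a \<Rightarrow> int) set" where
  "divisors V = {D. \<forall>v. v \<notin> V \<longrightarrow> D v = 0}"

definition div_degree :: "'a set \<Rightarrow> ('a \<Rightarrow> int) \<Rightarrow> int" where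
  "div_degree V D = (\<Sum>v\<in>V. D v)"

definition effective_divisors :: "'a set \<Rightarrow> ('a \<Rightarrow> int) set" where
  "effective_divisors V = {D \<in> divisors V. \<forall>v\<in>V. 0 \<le> D v}"

definition neighbors :: "'a set \<Rightarrow> 'a set set \<Rightarrow> 'a \<Rightarrow> 'a set" where
  "neighbors V E v = {w \<in> V. w \<noteq> v \<and> {v, w} \<in> E}"

definition fire :: "'a set \<Rightarrow> 'a set set \<Rightarrow> 'a \<Rightarrow> ('a \<Rightarrow> int) \<Rightarrow> ('a \<Rightarrow> int)" where
  "fire V E v D = (\<lambda>w. if w = v then D w - int (card (neighbors V E v))
                       else if w \<in> neighbors V E v then D w + 1
                       else D w)"

text \<open>
  A sequence of firings may pass through divisors with negative entries. The relation below is
  symmetric on a finite graph: firing every vertex once changes nothing, so firing all vertices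
  other than \<open>v\<close> undoes the firing of \<open>v\<close>.
\<close>

definition div_equiv :: "'a set \<Rightarrow> 'a set set \<Rightarrow> ('a \<Rightarrow> int) \<Rightarrow> ('a \<Rightarrow> int) \<Rightarrow> bool" where
  "div_equiv V E = (\<lambda>D D'. \<exists>v\<in>V. D' = fire V E v D)\<^sup>*\<^sup>*"

definition div_class :: "'a set \<Rightarrow> 'a set set \<Rightarrow> ('a \<Rightarrow> int) \<Rightarrow> ('a \<Rightarrow> int) set" where
  "div_class V E D = {D'. div_equiv V E D D'}"

definition equiv_to_effective :: "'a set \<Rightarrow> 'a set set \<Rightarrow> ('a \<Rightarrow> int) \<Rightarrow> bool" where
  "equiv_to_effective V E D \<longleftrightarrow> (\<exists>D'\<in>effective_divisors V. div_equiv V E D D')"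

text \<open>
  On a nonempty finite graph the greatest \<open>k\<close> exists, because equivalence preserves the degree and
  hence \<open>k\<close> is at most the degree of \<open>D\<close>.
\<close>

definition div_rank :: "'a set \<Rightarrow> 'a set set \<Rightarrow> ('a \<Rightarrow> int) \<Rightarrow> int" where
  "div_rank V E D =
     (if \<not> equiv_to_effective V E D then -1
      else int (GREATEST k::nat. \<forall>F\<in>effective_divisors V. div_degree V F = int k \<longrightarrow>
                                   equiv_to_effective V E (\<lambda>v. D v - F v)))"

definition gonality :: "'a set \<Rightarrow> 'a set set \<Rightarrow> int" where
  "gonality V E = (LEAST d. \<exists>D\<in>divisors V. div_degree V D = d \<and> div_rank V E D \<ge> 1)"

definition rank1_gonality_classes :: "'a set \<Rightarrow> 'a set set \<Rightarrow> ('a \<Rightarrow> int) set set" where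
  "rank1_gonality_classes V E =
     div_class V E ` {D \<in> divisors V. div_rank V E D = 1 \<and> div_degree V D = gonality V E}"


subsection \<open>Toroidal queen's graphs\<close>

definition TQ_verts :: "nat \<Rightarrow> nat \<Rightarrow> (int \<times> int) set" where
  "TQ_verts m n = {0..int m - 1} \<times> {0..int n - 1}"

definition queen_move :: "nat \<Rightarrow> nat \<Rightarrow> int \<times> int \<Rightarrow> int \<times> int \<Rightarrow> bool" where
  "queen_move m n = (\<lambda>(x, y) (x', y').
     x = x' \<or> y = y' \<or>
     (\<exists>k. [x' = x + k] (mod int m) \<and>
          ([y' = y + k] (mod int n) \<or> [y' = y - k] (mod int n))))"

definition TQ_edges :: "nat \<Rightarrow> nat \<Rightarrow> (int \<times> int) set set" where
  "TQ_edges m n = {{p, q} |p q. p \<in> TQ_verts m n \<and> q \<in> TQ_verts m n \<and> p \<noteq> q \<and> queen_move m n p q}"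

text \<open>
  The independence number of the graph for \<open>m \<noteq> n\<close> is \<open>gcd m n\<close> with the single exception
  \<open>{m, n} = {3, 6}\<close>, where it is \<open>2\<close>. Indeed two non-adjacent vertices of the 3 by 6 graph have
  first coordinates that differ modulo 3, so their second coordinates must agree modulo 3 but be
  distinct; each residue class modulo 3 has only two elements in \<open>{0..5}\<close>.
\<close>

end

theory Submission
  imports Defs
begin

text \<open>
  A divisor \<open>D\<close> of degree at most \<open>|V| - \<alpha>\<close> has fewer than \<open>|V|\<close> chips, so it can only fire sets of vertices
  with fewer than \<open>|V|\<close> boundary edges; on the torus these are sets of at most \<open>K\<close> vertices and their
  complements. After small sets have been fired as long as possible, positive rank puts every
  unchipped vertex \<open>r\<close> into a set \<open>W\<close> of at most \<open>K\<close> vertices such that each vertex outside \<open>W\<close> has at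
  least as many chips as neighbours in \<open>W\<close>. If two unchipped vertices are adjacent, their many common
  neighbours hold so many superfluous chips that the degree exceeds \<open>|V| - \<alpha>\<close>. Hence the unchipped
  vertices form a maximum independent set \<open>S\<close>, and \<open>D\<close> is equivalent to one chip on each vertex outside
  \<open>S\<close>.

  The independence numbers are those of Monsky (square boards) and Cairns (other boards). Upper bounds
  come from summing the coordinates, their sums and differences, and the squares of all these, modulo
  \<open>n\<close> or \<open>2 * n\<close>; lower bounds come from configurations that consist of a bounded number of
  arithmetic progressions.
\<close>

subsection \<open>Firing scripts\<close>

text \<open>The size \<open>K\<close> is squeezed from two sides. A set of \<open>K + 1\<close>
  vertices in a graph of degree \<open>d\<close> has at least \<open>(K + 1) * (d - K)\<close>
  boundary edges; with m = g * a and n = g * b there are g^2 * a * b vertices and \<open>d\<close>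
  is about 2 * g * a * b, so \<open>K\<close> must be about g / 2. On the other hand the chip count
  wants \<open>K + 3\<close> common neighbours for adjacent vertices, and a square board guarantees
  only about g of them. The choice \<open>g div 2\<close> meets both demands, except for g < 4 and
  on the 4 by 4 board. There \<open>K = 1\<close> suffices: \<open>W\<close> is a single vertex, so
  adjacent unchipped vertices cannot occur at all.

  The count itself turns on 5 against 4. Choose a maximal independent set of unchipped
  vertices.\<close>

locale fin_graph =
  fixes V :: "'a set" and E :: "'a set set"
  assumes finV: "finite V" and neV: "V \<noteq> {}"
begin

abbreviation nb :: "'a \<Rightarrow> 'a set" where "nb \<equiv> neighbors V E"

lemma nb_subset: "nb v \<subseteq> V" and nb_irrefl: "v \<notin> nb v"
  by (auto simp: neighbors_def)

lemma nb_in: "w \<in> nb v \<Longrightarrow> w \<in> V"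
  by (auto simp: neighbors_def)

lemma finite_nb [simp]: "finite (nb v)"
  using finite_subset[OF nb_subset finV] .

lemma nb_sym: "\<lbrakk>v \<in> V; w \<in> nb v\<rbrakk> \<Longrightarrow> v \<in> nb w"
  by (auto simp: neighbors_def insert_commute)

text \<open>The graph Laplacian of an integer script: firing every \<open>v\<close> exactly
  \<open>f v\<close> times, negative numbers allowed, turns \<open>D\<close> into
  \<open>D - lap f\<close>. The value 0 outside \<open>V\<close> keeps the result a divisor.\<close>

definition lap :: "('a \<Rightarrow> int) \<Rightarrow> 'a \<Rightarrow> int" where
  "lap f v = (if v \<in> V then \<Sum>w\<in>nb v. f v - f w else 0)"

lemma lap_add: "lap (\<lambda>v. f v + g v) v = lap f v + lap g v"
proof -
  have "(\<Sum>w\<in>nb v. f v + g v - (f w + g w)) = (\<Sum>w\<in>nb v. (f v - f w) + (g v - g w))"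
    by (intro sum.cong) auto
  then show ?thesis by (simp add: lap_def sum.distrib)
qed

lemma lap_uminus: "lap (\<lambda>v. - f v) v = - lap f v"
  by (auto simp: lap_def simp flip: sum_negf)

lemma lap_diff: "lap (\<lambda>v. f v - g v) v = lap f v - lap g v"
  using lap_add[of f "\<lambda>v. - g v" v] by (simp add: lap_uminus)

lemma lap_const [simp]: "lap (\<lambda>v. c) v = 0"
  by (simp add: lap_def)

lemma lap_cong: "(\<And>v. v \<in> V \<Longrightarrow> f v = g v) \<Longrightarrow> lap f = lap g"
  by (auto simp: lap_def fun_eq_iff nb_in intro!: sum.cong)

lemma lap_outside [simp]: "v \<notin> V \<Longrightarrow> lap f v = 0"
  by (simp add: lap_def)

lemma lap_indicator:
  "v \<in> V \<Longrightarrow> lap (\<lambda>v. of_bool (v \<in> U)) v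
    = (if v \<in> U then int (card (nb v - U)) else - int (card (nb v \<inter> U)))"
proof -
  assume v: "v \<in> V"
  have 1: "(\<Sum>w\<in>nb v. of_bool (w \<in> U) :: int) = int (card (nb v \<inter> U))"
    by (simp add: of_bool_def sum.If_cases)
  have "card (nb v) = card (nb v - U) + card (nb v \<inter> U)"
    using card_Int_Diff[OF finite_nb, of v U] by simp
  then show ?thesis using v by (simp add: lap_def sum_subtractf 1)
qed

lemma sum_lap: "(\<Sum>v\<in>V. lap f v) = 0"
proof -
  have *: "(\<Sum>v\<in>V. \<Sum>w\<in>nb v. g v w) = (\<Sum>v\<in>V. \<Sum>w\<in>nb v. g w v)" for g :: "'a \<Rightarrow> 'a \<Rightarrow> int"
  proof -
    have "(\<Sum>v\<in>V. \<Sum>w\<in>nb v. g v w) = (\<Sum>(v,w)\<in>Sigma V nb. g v w)"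
      by (simp add: sum.Sigma finV)
    also have "\<dots> = (\<Sum>(v,w)\<in>Sigma V nb. g w v)"
      by (rule sum.reindex_bij_witness[of _ prod.swap prod.swap])
         (auto simp: nb_in intro: nb_sym)
    also have "\<dots> = (\<Sum>v\<in>V. \<Sum>w\<in>nb v. g w v)"
      by (simp add: sum.Sigma finV)
    finally show ?thesis .
  qed
  have "(\<Sum>v\<in>V. lap f v) = (\<Sum>v\<in>V. \<Sum>w\<in>nb v. f v) - (\<Sum>v\<in>V. \<Sum>w\<in>nb v. f w)"
    by (simp add: lap_def sum_subtractf cong: sum.cong)
  also have "\<dots> = 0"
    using *[of "\<lambda>v w. f v"] by simp
  finally show ?thesis .
qed

lemma fire_eq_lap: "v \<in> V \<Longrightarrow> fire V E v D = (\<lambda>w. D w - lap (\<lambda>u. of_bool (u \<in> {v})) w)"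
proof
  fix w assume v: "v \<in> V"
  show "fire V E v D w = D w - lap (\<lambda>u. of_bool (u \<in> {v})) w"
  proof (cases "w \<in> V")
    case True
    have "nb w \<inter> {v} = (if v \<in> nb w then {v} else {})" "v \<in> nb w \<longleftrightarrow> w \<in> nb v" "nb v - {v} = nb v"
      using nb_sym[OF True] nb_sym[OF v] nb_irrefl by auto
    then show ?thesis using True unfolding lap_indicator[OF True] by (auto simp: fire_def)
  next
    case False
    then show ?thesis using v nb_subset[of v] by (auto simp: fire_def)
  qed
qed

lemma div_equiv_lap_nonneg:
  assumes "\<And>v. v \<in> V \<Longrightarrow> f v \<ge> 0"
  shows "div_equiv V E D (\<lambda>v. D v - lap f v)"
  using assms
proof (induction "nat (\<Sum>v\<in>V. f v)" arbitrary: f)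
  case 0
  then have "(\<Sum>v\<in>V. f v) = 0" by (simp add: sum_nonneg antisym)
  then have "lap f = lap (\<lambda>_. 0)"
    using 0 finV by (intro lap_cong) (simp add: sum_nonneg_eq_0_iff)
  then show ?case by (simp add: div_equiv_def)
next
  case (Suc n)
  have "\<exists>v\<in>V. f v > 0"
  proof (rule ccontr)
    assume "\<not> ?thesis"
    then have "(\<Sum>v\<in>V. f v) = 0" using Suc.prems by (intro sum.neutral) force
    then show False using Suc.hyps(2) by simp
  qed
  then obtain v where v: "v \<in> V" "f v > 0" by auto
  let ?g = "\<lambda>u. f u - of_bool (u \<in> {v})"
  have "(\<Sum>u\<in>V. ?g u) = (\<Sum>u\<in>V. f u) - 1"
    using v finV by (simp add: sum_subtractf of_bool_def)
  then have "n = nat (\<Sum>u\<in>V. ?g u)" using Suc.hyps(2) by simp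
  then have "div_equiv V E D (\<lambda>u. D u - lap ?g u)"
    using Suc.prems v by (intro Suc.hyps(1)) auto
  moreover have "(\<lambda>u. D u - lap f u) = fire V E v (\<lambda>u. D u - lap ?g u)"
    unfolding fire_eq_lap[OF v(1)] using lap_diff[of f "\<lambda>u. of_bool (u \<in> {v})"] by auto
  ultimately show ?case using v(1) unfolding div_equiv_def
    by (metis (mono_tags, lifting) rtranclp.rtrancl_into_rtrancl)
qed

lemma div_equiv_iff: "div_equiv V E D D' \<longleftrightarrow> (\<exists>f. D' = (\<lambda>v. D v - lap f v))"
proof
  assume "div_equiv V E D D'"
  then show "\<exists>f. D' = (\<lambda>v. D v - lap f v)" unfolding div_equiv_def
  proof (induction rule: rtranclp_induct)
    case base
    show ?case by (rule exI[of _ "\<lambda>_. 0"]) simp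
  next
    case (step D1 D2)
    then obtain f v where "v \<in> V" "D1 = (\<lambda>v. D v - lap f v)" "D2 = fire V E v D1" by auto
    then have "D2 = (\<lambda>u. D u - lap (\<lambda>u. f u + of_bool (u \<in> {v})) u)"
      by (simp add: fire_eq_lap lap_add algebra_simps del: singleton_iff)
    then show ?case by blast
  qed
next
  assume "\<exists>f. D' = (\<lambda>v. D v - lap f v)"
  then obtain f where f: "D' = (\<lambda>v. D v - lap f v)" by auto
  \<comment> \<open>Constants lie in the kernel of \<open>lap\<close>, so the script may be shifted
    until it is nonnegative, as a sequence of firings requires.\<close>
  have "f v - Min (f ` V) \<ge> 0" if "v \<in> V" for v using that finV by simp
  from div_equiv_lap_nonneg[OF this] show "div_equiv V E D D'"
    unfolding f by (simp add: lap_diff)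
qed

lemma div_equiv_sym: "div_equiv V E D D' \<Longrightarrow> div_equiv V E D' D"
proof -
  assume "div_equiv V E D D'"
  then obtain f where "D' = (\<lambda>v. D v - lap f v)" unfolding div_equiv_iff by blast
  then have "D = (\<lambda>v. D' v - lap (\<lambda>v. - f v) v)" by (simp add: lap_uminus)
  then show ?thesis unfolding div_equiv_iff by blast
qed

lemma div_class_eq_iff: "div_class V E D = div_class V E D' \<longleftrightarrow> div_equiv V E D D'"
proof -
  have "div_equiv V E D D' \<Longrightarrow> div_equiv V E D' D'' \<Longrightarrow> div_equiv V E D D''" for D D' D''
    unfolding div_equiv_def by auto
  moreover have "div_equiv V E D D" for D unfolding div_equiv_def by auto
  ultimately show ?thesis unfolding div_class_def using div_equiv_sym by blast
qed

lemma div_degree_lap: "div_degree V (\<lambda>v. D v - lap f v) = div_degree V D"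
  by (simp add: div_degree_def sum_subtractf sum_lap)

section \<open>Rank in terms of scripts\<close>

lemma equiv_to_effective_iff:
  assumes "D \<in> divisors V"
  shows "equiv_to_effective V E D \<longleftrightarrow> (\<exists>f. \<forall>v\<in>V. lap f v \<le> D v)"
proof -
  have "(\<lambda>v. D v - lap f v) \<in> effective_divisors V \<longleftrightarrow> (\<forall>v\<in>V. lap f v \<le> D v)" for f
    using assms by (auto simp: effective_divisors_def divisors_def)
  then show ?thesis unfolding equiv_to_effective_def div_equiv_iff by blast
qed

lemma equiv_to_effective_degree:
  assumes "equiv_to_effective V E D" shows "div_degree V D \<ge> 0"
proof -
  obtain f where "(\<lambda>v. D v - lap f v) \<in> effective_divisors V"
    using assms unfolding equiv_to_effective_def div_equiv_iff by auto
  then have "div_degree V (\<lambda>v. D v - lap f v) \<ge> 0"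
    by (auto simp: div_degree_def effective_divisors_def intro!: sum_nonneg)
  then show ?thesis by (simp add: div_degree_lap)
qed

lemma effective_degree_ex: "\<exists>F\<in>effective_divisors V. div_degree V F = int k"
proof -
  obtain q where q: "q \<in> V" using neV by auto
  show ?thesis
    by (rule bexI[of _ "\<lambda>v. if v = q then int k else 0"])
       (use q finV in \<open>auto simp: div_degree_def effective_divisors_def divisors_def\<close>)
qed

lemma div_degree_diff: "div_degree V (\<lambda>v. D v - F v) = div_degree V D - div_degree V F"
  by (simp add: div_degree_def sum_subtractf)

text \<open>The condition passes to smaller \<open>k\<close>, because a demand \<open>F\<close> can
  be enlarged and a script that meets the larger demand also meets \<open>F\<close>. It bounds
  \<open>k\<close> by the degree, which equivalence preserves. Hence the \<open>GREATEST\<close> is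
  attained, and the rank can be tested at a single \<open>k\<close>.\<close>

lemma le_div_rank_iff:
  assumes D: "D \<in> divisors V"
  shows "int k \<le> div_rank V E D \<longleftrightarrow>
    (\<forall>F\<in>effective_divisors V. div_degree V F = int k \<longrightarrow> equiv_to_effective V E (\<lambda>v. D v - F v))"
    (is "_ \<longleftrightarrow> ?P k")
proof -
  have diffD: "(\<lambda>v. D v - F v) \<in> divisors V" if "F \<in> effective_divisors V" for F
    using that D by (auto simp: effective_divisors_def divisors_def)
  have bound: "j \<le> nat (div_degree V D)" if "?P j" for j
  proof -
    obtain F where "F \<in> effective_divisors V" "div_degree V F = int j"
      using effective_degree_ex by blast
    then show ?thesis using that equiv_to_effective_degree[of "\<lambda>v. D v - F v"]
      by (auto simp: div_degree_diff)
  qed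
  have eff: "equiv_to_effective V E D" if P: "?P j" for j
  proof -
    obtain F where F: "F \<in> effective_divisors V" "div_degree V F = int j"
      using effective_degree_ex by blast
    then obtain f where "\<forall>v\<in>V. lap f v \<le> D v - F v"
      using P equiv_to_effective_iff[OF diffD[OF F(1)]] by blast
    moreover have "\<forall>v\<in>V. F v \<ge> 0" using F by (auto simp: effective_divisors_def)
    ultimately have "\<forall>v\<in>V. lap f v \<le> D v" by fastforce
    then show ?thesis unfolding equiv_to_effective_iff[OF D] by blast
  qed
  have P0: "?P 0" if "equiv_to_effective V E D"
  proof clarify
    fix F assume F: "F \<in> effective_divisors V" "div_degree V F = int 0"
    then have "\<forall>v\<in>V. F v = 0"
      using finV sum_nonneg_eq_0_iff[of V F] by (auto simp: div_degree_def effective_divisors_def)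
    then have "(\<lambda>v. D v - F v) = D" using F by (auto simp: effective_divisors_def divisors_def fun_eq_iff)
    then show "equiv_to_effective V E (\<lambda>v. D v - F v)" using that by simp
  qed
  have mono: "?P i" if "?P j" "i \<le> j" for i j
  proof clarify
    fix F assume F: "F \<in> effective_divisors V" "div_degree V F = int i"
    obtain F' where F': "F' \<in> effective_divisors V" "div_degree V F' = int (j - i)"
      using effective_degree_ex by blast
    have "(\<lambda>v. F v + F' v) \<in> effective_divisors V" "div_degree V (\<lambda>v. F v + F' v) = int j"
      using F F' that(2) by (auto simp: effective_divisors_def divisors_def div_degree_def sum.distrib)
    then have "equiv_to_effective V E (\<lambda>v. D v - (F v + F' v))" using that(1) by blast
    moreover have "(\<lambda>v. D v - (F v + F' v)) \<in> divisors V"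
      using D F F' by (auto simp: effective_divisors_def divisors_def)
    ultimately obtain f where f: "\<forall>v\<in>V. lap f v \<le> D v - (F v + F' v)"
      using equiv_to_effective_iff by blast
    have "\<forall>v\<in>V. lap f v \<le> D v - F v"
    proof
      fix v assume "v \<in> V"
      with f F' have "lap f v \<le> D v - (F v + F' v)" "F' v \<ge> 0" by (auto simp: effective_divisors_def)
      then show "lap f v \<le> D v - F v" by simp
    qed
    then show "equiv_to_effective V E (\<lambda>v. D v - F v)"
      unfolding equiv_to_effective_iff[OF diffD[OF F(1)]] by blast
  qed
  show ?thesis
  proof (cases "equiv_to_effective V E D")
    case True
    define m where "m = (GREATEST k. ?P k)"
    have m: "?P m" unfolding m_def
      using GreatestI_nat[of ?P 0 "nat (div_degree V D)"] P0[OF True] bound by blast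
    have "j \<le> m" if "?P j" for j unfolding m_def
      using Greatest_le_nat[of ?P j "nat (div_degree V D)"] that bound by blast
    then have "k \<le> m \<longleftrightarrow> ?P k" using mono m by blast
    then show ?thesis using True by (simp add: div_rank_def m_def)
  next
    case False
    then show ?thesis using eff by (auto simp: div_rank_def)
  qed
qed

lemma one_le_div_rankD:
  assumes "D \<in> divisors V" "1 \<le> div_rank V E D" "q \<in> V"
  shows "\<exists>f. \<forall>v\<in>V. lap f v \<le> D v - of_bool (v = q)"
proof -
  have F: "(\<lambda>v. of_bool (v = q)) \<in> effective_divisors V" "div_degree V (\<lambda>v. of_bool (v = q)) = 1"
    using assms(3) finV by (auto simp: effective_divisors_def divisors_def div_degree_def of_bool_def)
  then have "(\<lambda>v. D v - of_bool (v = q)) \<in> divisors V"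
    using assms(1) by (auto simp: effective_divisors_def divisors_def)
  moreover have "equiv_to_effective V E (\<lambda>v. D v - of_bool (v = q))"
    using le_div_rank_iff[OF assms(1), of 1] assms(2) F unfolding of_nat_1 by blast
  ultimately show ?thesis
    using equiv_to_effective_iff by blast
qed

lemma one_le_div_rankI:
  assumes "D \<in> divisors V" "\<And>q. q \<in> V \<Longrightarrow> \<exists>f. \<forall>v\<in>V. lap f v \<le> D v - of_bool (v = q)"
  shows "1 \<le> div_rank V E D"
proof -
  have "equiv_to_effective V E (\<lambda>v. D v - F v)"
    if F: "F \<in> effective_divisors V" "div_degree V F = 1" for F
  proof -
    have F0: "\<And>v. v \<in> V \<Longrightarrow> F v \<ge> 0" using F by (auto simp: effective_divisors_def)
    have "\<exists>q\<in>V. F q \<noteq> 0"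
      using F(2) by (metis div_degree_def sum.neutral zero_neq_one)
    then obtain q where q: "q \<in> V" "F q \<noteq> 0" by auto
    have "sum F V = F q + sum F (V - {q})" using q finV by (simp add: sum.remove)
    moreover have "sum F (V - {q}) \<ge> 0" using F0 by (intro sum_nonneg) auto
    ultimately have "F q = 1" "sum F (V - {q}) = 0"
      using F(2) F0[OF q(1)] q(2) by (auto simp: div_degree_def)
    then have "F v = of_bool (v = q)" if "v \<in> V" for v
      using that sum_nonneg_eq_0_iff[of "V - {q}" F] F0 finV by auto
    moreover have "(\<lambda>v. D v - F v) \<in> divisors V"
      using assms(1) F by (auto simp: effective_divisors_def divisors_def)
    ultimately show ?thesis using assms(2)[OF q(1)] by (auto simp: equiv_to_effective_iff)
  qed
  then show ?thesis using le_div_rank_iff[OF assms(1), of 1] by auto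
qed

lemma indep_card_le:
  assumes "S \<subseteq> V" "indep S E" shows "card S \<le> independence_number V E"
proof -
  have "finite (card ` {S. S \<subseteq> V \<and> indep S E})" using finV by simp
  then show ?thesis unfolding independence_number_def using assms by (intro Max_ge) auto
qed

lemma independence_number_attained: "\<exists>S\<subseteq>V. indep S E \<and> card S = independence_number V E"
proof -
  have "finite (card ` {S. S \<subseteq> V \<and> indep S E})" using finV by simp
  moreover have "{} \<in> {S. S \<subseteq> V \<and> indep S E}" by (simp add: indep_def)
  ultimately have "independence_number V E \<in> card ` {S. S \<subseteq> V \<and> indep S E}"
    unfolding independence_number_def by (intro Max_in) auto
  then show ?thesis by auto
qed

lemma independence_number_pos: "independence_number V E \<ge> 1"
proof -
  obtain v where "v \<in> V" using neV by auto
  then show ?thesis using indep_card_le[of "{v}"] by (simp add: indep_def)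
qed

section \<open>Legal set firings\<close>

definition legal :: "('a \<Rightarrow> int) \<Rightarrow> 'a set \<Rightarrow> bool" where
  "legal D U \<longleftrightarrow> (\<forall>u\<in>U. int (card (nb u - U)) \<le> D u)"

lemma legal_fires:
  assumes "legal D U" "\<And>v. v \<in> V \<Longrightarrow> 0 \<le> D v" "v \<in> V"
  shows "lap (\<lambda>v. of_bool (v \<in> U)) v \<le> D v"
  using assms(1,3) assms(2)[OF assms(3)] unfolding lap_indicator[OF assms(3)] legal_def by auto

text \<open>Along every edge that leaves the top level the script moves at least one chip outwards,
  and edges inside the level move nothing on balance. So firing the top level once costs its
  vertices no more than the whole script does.\<close>

lemma legal_max_level:
  assumes "\<And>v. v \<in> V \<Longrightarrow> lap f v \<le> D v" "\<And>v. v \<in> V \<Longrightarrow> f v \<le> M"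
  shows "legal D {v \<in> V. f v = M}"
  unfolding legal_def
proof clarify
  fix u assume u: "u \<in> V" "M = f u"
  let ?U = "{v \<in> V. f v = f u}"
  have "int (card (nb u - ?U)) = (\<Sum>w\<in>nb u - ?U. 1)" by simp
  also have "\<dots> \<le> (\<Sum>w\<in>nb u - ?U. f u - f w)"
    using assms(2) u by (intro sum_mono) (force dest: nb_in)
  also have "\<dots> \<le> (\<Sum>w\<in>nb u. f u - f w)"
    using assms(2) u by (intro sum_mono2) (auto dest: nb_in)
  also have "\<dots> \<le> D u" using assms(1)[OF u(1)] u(1) by (simp add: lap_def)
  finally show "int (card (nb u - ?U)) \<le> D u" .
qed

text \<open>The reversed script \<open>- f\<close> leads back to \<open>D\<close>, and its top level
  is the bottom level of \<open>f\<close>.\<close>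

lemma legal_min_level:
  assumes "\<And>v. v \<in> V \<Longrightarrow> 0 \<le> D v" "\<And>v. v \<in> V \<Longrightarrow> M \<le> f v"
  shows "legal (\<lambda>v. D v - lap f v) {v \<in> V. f v = M}"
  using legal_max_level[of "\<lambda>v. - f v" "\<lambda>v. D v - lap f v" "- M"] assms by (simp add: lap_uminus)

end

text \<open>
  The hypotheses say that a set of vertices that is neither small nor co-small has a large edge
  boundary, so that a divisor of degree less than \<open>card V\<close> cannot fire it.
\<close>

locale expanding_graph = fin_graph +
  fixes K :: nat
  assumes K_pos: "K \<ge> 1" and K_small: "3 * K < card V"
    and boundary: "\<And>U. \<lbrakk>U \<subseteq> V; K < card U; card U + K < card V\<rbrakk> \<Longrightarrow> card V \<le> (\<Sum>u\<in>U. card (neighbors V E u - U))"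
    and degree_gt: "\<And>v. v \<in> V \<Longrightarrow> K < card (neighbors V E v)"
    and common_nb: "\<And>v w. \<lbrakk>K \<ge> 2; v \<in> V; w \<in> neighbors V E v\<rbrakk> \<Longrightarrow> K + 3 \<le> card (neighbors V E v \<inter> neighbors V E w)"
    and claw_bound: "\<And>v I. \<lbrakk>v \<in> V; I \<subseteq> neighbors V E v; indep I E\<rbrakk> \<Longrightarrow> card I \<le> 4"
begin

abbreviation \<alpha> :: nat where "\<alpha> \<equiv> independence_number V E"

section \<open>Divisors with fewer than |V| chips on an expanding graph\<close>

lemma legal_card:
  assumes "legal D U" "U \<subseteq> V" "\<And>v. v \<in> V \<Longrightarrow> 0 \<le> D v" "div_degree V D < int (card V)"
  shows "card U \<le> K \<or> card V \<le> card U + K"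
proof (rule ccontr)
  assume "\<not> ?thesis"
  then have "int (card V) \<le> (\<Sum>u\<in>U. int (card (nb u - U)))"
    using boundary[OF assms(2)] by (simp flip: of_nat_sum)
  also have "\<dots> \<le> (\<Sum>u\<in>U. D u)"
    using assms(1) by (intro sum_mono) (auto simp: legal_def)
  also have "\<dots> \<le> div_degree V D"
    unfolding div_degree_def using assms finV by (intro sum_mono2) auto
  finally show False using assms(4) by simp
qed

lemma card_nb_diff:
  assumes "v \<in> V" "card U \<le> K" "finite U" shows "1 \<le> card (nb v - U)"
  using degree_gt[OF assms(1)] diff_card_le_card_Diff[OF assms(3), of "nb v"] assms(2) by linarith

text \<open>
  Among the scripts with small support that keep the divisor effective choose one of maximal sum. The
  sums are bounded because a vertex of maximal value has a neighbour outside the support.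
\<close>

lemma no_small_firing:
  assumes D0: "\<And>v. v \<in> V \<Longrightarrow> 0 \<le> D v" and deg: "div_degree V D < int (card V)"
  obtains f where "\<And>v. v \<in> V \<Longrightarrow> lap f v \<le> D v"
    and "\<And>U. \<lbrakk>U \<subseteq> V; U \<noteq> {}; legal (\<lambda>v. D v - lap f v) U\<rbrakk> \<Longrightarrow> card V \<le> card U + K"
proof -
  define P where "P f \<longleftrightarrow> (\<forall>v\<in>V. f v \<ge> (0::int)) \<and> card {v\<in>V. f v \<noteq> 0} \<le> K \<and> (\<forall>v\<in>V. lap f v \<le> D v)" for f
  have degnn: "div_degree V D \<ge> 0" unfolding div_degree_def using D0 by (intro sum_nonneg)
  have bnd: "f v \<le> div_degree V D" if P: "P f" and v: "v \<in> V" for f v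
  proof -
    define M where "M = Max (f ` V)"
    have "M \<in> f ` V" unfolding M_def using neV finV by (intro Max_in) auto
    then obtain u where u: "u \<in> V" "f u = M" by auto
    have le: "f w \<le> M" if "w \<in> V" for w unfolding M_def using that finV by simp
    have M0: "M \<ge> 0" using P u unfolding P_def by auto
    let ?L = "{v\<in>V. f v \<noteq> 0}"
    have "1 \<le> card (nb u - ?L)"
      using card_nb_diff[OF u(1), of ?L] P finV unfolding P_def by simp
    then have "M \<le> (\<Sum>w\<in>nb u - ?L. M)" using M0 by (simp add: mult_le_cancel_right1)
    also have "\<dots> = (\<Sum>w\<in>nb u - ?L. f u - f w)" using u by (intro sum.cong) (auto dest: nb_in)
    also have "\<dots> \<le> (\<Sum>w\<in>nb u. f u - f w)"
      using le u by (intro sum_mono2) (auto dest: nb_in)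
    also have "\<dots> \<le> D u" using P u by (auto simp: lap_def P_def)
    also have "\<dots> \<le> div_degree V D"
      unfolding div_degree_def using u D0 finV by (intro member_le_sum) auto
    finally show ?thesis using le[OF v] by simp
  qed
  have "P (\<lambda>_. 0)" unfolding P_def using D0 by simp
  moreover have "nat (\<Sum>v\<in>V. f v) < Suc (nat (int (card V) * div_degree V D))" if "P f" for f
    using sum_bounded_above[of V f "div_degree V D"] bnd[OF that] by auto
  ultimately obtain f where f: "P f" and fmax: "\<And>g. P g \<Longrightarrow> nat (\<Sum>v\<in>V. g v) \<le> nat (\<Sum>v\<in>V. f v)"
    using ex_has_greatest_nat[of P "\<lambda>_. 0" "\<lambda>f. nat (\<Sum>v\<in>V. f v)" "Suc (nat (int (card V) * div_degree V D))"]
    by (metis (no_types, lifting) less_imp_le)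
  have "card V \<le> card U + K" if U: "U \<subseteq> V" "U \<noteq> {}" "legal (\<lambda>v. D v - lap f v) U" for U
  proof (rule ccontr)
    assume contra: "\<not> ?thesis"
    have f0: "\<forall>v\<in>V. f v \<ge> 0" and flap: "\<forall>v\<in>V. lap f v \<le> D v" and fK: "card {v\<in>V. f v \<noteq> 0} \<le> K"
      using f unfolding P_def by auto
    have finU: "finite U" using U finV finite_subset by auto
    have "card U \<le> K"
      using legal_card[OF U(3,1)] flap deg contra by (simp add: div_degree_lap)
    define g where "g v = f v + of_bool (v \<in> U)" for v
    have g0: "\<forall>v\<in>V. g v \<ge> 0" using f0 by (simp add: g_def)
    have glap: "\<forall>v\<in>V. lap g v \<le> D v"
      using legal_fires[OF U(3)] flap unfolding g_def lap_add by (auto simp: algebra_simps)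
    have "card {v\<in>V. g v \<noteq> 0} \<le> card ({v\<in>V. f v \<noteq> 0} \<union> U)"
      using finU finV by (intro card_mono) (auto simp: g_def)
    also have "\<dots> \<le> 2 * K" using card_Un_le[of "{v\<in>V. f v \<noteq> 0}" U] fK \<open>card U \<le> K\<close> by simp
    finally have 2: "card {v\<in>V. g v \<noteq> 0} \<le> 2 * K" .
    \<comment> \<open>The support of \<open>g\<close> might have grown to \<open>2 * K\<close>
      vertices. Its complement is the bottom level of \<open>g\<close>, hence legal for the new
      divisor and thus small or co-small; small is excluded by
      \<open>3 * K < card V\<close>.\<close>
    have "legal (\<lambda>v. D v - lap g v) {v\<in>V. g v = 0}"
      using legal_min_level[of D 0 g] D0 g0 by simp
    then have "card {v\<in>V. g v = 0} \<le> K \<or> card V \<le> card {v\<in>V. g v = 0} + K"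
      using legal_card[of "\<lambda>v. D v - lap g v"] glap deg by (simp add: div_degree_lap)
    moreover have "card V = card {v\<in>V. g v = 0} + card {v\<in>V. g v \<noteq> 0}"
      using finV by (subst card_Un_disjoint[symmetric]) (auto intro: arg_cong[where f=card])
    ultimately have "card {v\<in>V. g v \<noteq> 0} \<le> K" using 2 K_small by linarith
    then have "P g" unfolding P_def using g0 glap by blast
    then have "nat (\<Sum>v\<in>V. g v) \<le> nat (\<Sum>v\<in>V. f v)" by (rule fmax)
    moreover have "(\<Sum>v\<in>V. g v) = (\<Sum>v\<in>V. f v) + int (card U)"
      using finV U by (simp add: g_def sum.distrib of_bool_def sum.If_cases Int_absorb1)
    moreover have "(\<Sum>v\<in>V. f v) \<ge> 0" using f0 by (intro sum_nonneg) auto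
    moreover have "card U > 0" using finU U(2) by (simp add: card_gt_0_iff)
    ultimately show False by simp
  qed
  with f show ?thesis using that unfolding P_def by blast
qed

text \<open>\<open>W\<close> is the complement of the top level of a script that brings a chip to
  \<open>r\<close>. The top level is legal, hence co-small by \<open>nsf\<close>. A vertex on it
  never gains chips, so the empty vertex \<open>r\<close> lies in \<open>W\<close>; and what a top
  vertex pays when the level fires is its number of neighbours in \<open>W\<close>.\<close>

lemma absorbing_set:
  assumes D0: "\<And>v. v \<in> V \<Longrightarrow> 0 \<le> D v"
    and nsf: "\<And>U. \<lbrakk>U \<subseteq> V; U \<noteq> {}; legal D U\<rbrakk> \<Longrightarrow> card V \<le> card U + K"
    and r: "r \<in> V" "D r = 0" and f: "\<forall>v\<in>V. lap f v \<le> D v - of_bool (v = r)"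
  shows "\<exists>W\<subseteq>V. r \<in> W \<and> card W \<le> K \<and> (\<forall>v\<in>V - W. int (card (nb v \<inter> W)) \<le> D v)"
proof -
  define M where "M = Max (f ` V)"
  define U where "U = {v\<in>V. f v = M}"
  have "M \<in> f ` V" unfolding M_def using neV finV by (intro Max_in) auto
  then have U: "U \<subseteq> V" "U \<noteq> {}" unfolding U_def by auto
  have le: "f w \<le> M" if "w \<in> V" for w unfolding M_def using that finV by simp
  have lapf: "lap f v \<le> D v" if "v \<in> V" for v
    using bspec[OF f that] by (simp add: of_bool_def split: if_splits)
  have leg: "legal D U" unfolding U_def using legal_max_level[OF lapf le] by blast
  have "r \<notin> U"
  proof
    assume "r \<in> U"
    then have "lap f r \<ge> 0" using le r(1) nb_in by (auto simp: lap_def U_def intro!: sum_nonneg)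
    then show False using f r by force
  qed
  moreover have "card (V - U) \<le> K"
    using nsf[OF U leg] card_Diff_subset[of U V] finite_subset[OF U(1) finV] U(1) by linarith
  moreover have "int (card (nb v \<inter> (V - U))) \<le> D v" if "v \<in> U" for v
  proof -
    have "nb v \<inter> (V - U) = nb v - U" using nb_subset by auto
    then show ?thesis using leg that by (simp add: legal_def)
  qed
  ultimately show ?thesis using r(1) by (intro exI[of _ "V - U"]) auto
qed

lemma adj_indep: "\<lbrakk>indep I E; I \<subseteq> V; u \<in> I; v \<in> I\<rbrakk> \<Longrightarrow> v \<notin> nb u"
  by (auto simp: indep_def neighbors_def)

lemma maximal_indep_subset:
  assumes "Z \<subseteq> V"
  obtains I \<phi> where "I \<subseteq> Z" "indep I E" "\<And>z. z \<in> Z - I \<Longrightarrow> \<phi> z \<in> I \<and> z \<in> nb (\<phi> z)"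
proof -
  have finZ: "finite Z" using assms finV finite_subset by auto
  define P where "P I \<longleftrightarrow> I \<subseteq> Z \<and> indep I E" for I
  have "P {}" by (simp add: P_def indep_def)
  moreover have "card I < Suc (card Z)" if "P I" for I using that finZ card_mono unfolding P_def by (auto simp: less_Suc_eq_le)
  ultimately obtain I where I: "P I" and max: "\<And>J. P J \<Longrightarrow> card J \<le> card I"
    using ex_has_greatest_nat[of P "{}" card "Suc (card Z)"] by (metis less_imp_le)
  have "\<exists>i\<in>I. z \<in> nb i" if z: "z \<in> Z - I" for z
  proof (rule ccontr)
    assume "\<not> ?thesis"
    then have "P (insert z I)"
      using I z assms by (auto simp: P_def indep_def neighbors_def insert_commute)
    moreover have "finite I" using I finZ finite_subset unfolding P_def by auto
    ultimately show False using max[of "insert z I"] z by simp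
  qed
  then obtain \<phi> where "\<And>z. z \<in> Z - I \<Longrightarrow> \<phi> z \<in> I \<and> z \<in> nb (\<phi> z)" by metis
  then show ?thesis using that I unfolding P_def by blast
qed

text \<open>
  Let \<open>I\<close> be a maximal independent subset of the zero set \<open>Z\<close>, so that \<open>Z - I\<close> is covered by stars
  centred in \<open>I\<close>. Every edge of a star forces an extra chip on each of its at least five common
  neighbours outside the absorbing set of its centre, and a vertex is adjacent to at most four
  centres; hence the number of extra chips exceeds \<open>card (Z - I)\<close> unless \<open>Z = I\<close>.
\<close>

lemma zero_set_excess:
  assumes D0: "\<And>v. v \<in> V \<Longrightarrow> 0 \<le> D v"
    and abs: "\<And>r. \<lbrakk>r \<in> V; D r = 0\<rbrakk> \<Longrightarrow>
       \<exists>W\<subseteq>V. r \<in> W \<and> card W \<le> K \<and> (\<forall>v\<in>V - W. int (card (nb v \<inter> W)) \<le> D v)"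
    and Z: "Z = {v\<in>V. D v = 0}" and I: "I \<subseteq> Z" "indep I E"
    and \<phi>: "\<And>z. z \<in> Z - I \<Longrightarrow> \<phi> z \<in> I \<and> z \<in> nb (\<phi> z)"
  shows "5 * int (card (Z - I)) \<le> 4 * (\<Sum>v\<in>V. max 0 (D v - 1))"
proof -
  have ZV: "Z \<subseteq> V" and IV: "I \<subseteq> V" using Z I by auto
  have fin: "finite Z" "finite I" using ZV IV finV finite_subset by auto
  have "\<forall>r\<in>Z. \<exists>W. W \<subseteq> V \<and> r \<in> W \<and> card W \<le> K \<and> (\<forall>v\<in>V - W. int (card (nb v \<inter> W)) \<le> D v)"
    using abs Z by blast
  then obtain W where "\<forall>r\<in>Z. W r \<subseteq> V \<and> r \<in> W r \<and> card (W r) \<le> K \<and>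
      (\<forall>v\<in>V - W r. int (card (nb v \<inter> W r)) \<le> D v)"
    using that by (auto dest!: bchoice)
  then have W: "W r \<subseteq> V \<and> r \<in> W r \<and> card (W r) \<le> K \<and>
      (\<forall>v\<in>V - W r. int (card (nb v \<inter> W r)) \<le> D v)" if "r \<in> Z" for r
    using that by (rule bspec)
  have finW: "finite (W r)" if "r \<in> Z" for r using W[OF that] finV finite_subset by auto
  define L where "L i = {z \<in> Z - I. \<phi> z = i}" for i
  \<comment> \<open>A leaf \<open>z\<close> is adjacent to its centre \<open>i\<close>, which lies
    in \<open>W i\<close>. Outside \<open>W i\<close> it would therefore need a chip, but it has
    none.\<close>
  have LW: "L i \<subseteq> W i" if i: "i \<in> I" for i
  proof
    fix z assume z: "z \<in> L i"
    then have zz: "z \<in> V" "D z = 0" "z \<in> nb i" using \<phi> Z unfolding L_def by auto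
    show "z \<in> W i"
    proof (rule ccontr)
      assume "z \<notin> W i"
      then have "z \<in> V - W i" using zz by simp
      then have "int (card (nb z \<inter> W i)) \<le> D z" using W[of i] i I by blast
      then have "nb z \<inter> W i = {}" using zz by simp
      moreover have "i \<in> nb z \<inter> W i" using nb_sym zz(3) W[of i] i I IV by auto
      ultimately show False by auto
    qed
  qed
  define T where "T v = {i \<in> I. i \<in> nb v \<and> v \<notin> W i}" for v
  define t where "t v i = card (L i \<inter> nb v)" for v i
  \<comment> \<open>The neighbours of \<open>v\<close> in \<open>W i\<close> include the leaves
    counted by \<open>t v i\<close> and the centre \<open>i\<close> itself; the centre accounts for
    the \<open>- 1\<close>.\<close>
  have e: "int (t v i) \<le> max 0 (D v - 1)" if v: "v \<in> V" and i: "i \<in> T v" for v i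
  proof -
    have iI: "i \<in> I" "i \<in> nb v" "v \<notin> W i" "i \<in> Z" using i I by (auto simp: T_def)
    have "insert i (L i \<inter> nb v) \<subseteq> nb v \<inter> W i" using iI LW W[of i] by auto
    then have "card (insert i (L i \<inter> nb v)) \<le> card (nb v \<inter> W i)" by (intro card_mono) auto
    moreover have "i \<notin> L i" using iI by (auto simp: L_def)
    ultimately have "Suc (t v i) \<le> card (nb v \<inter> W i)" by (simp add: t_def)
    moreover have "int (card (nb v \<inter> W i)) \<le> D v" using W[of i] iI v by auto
    ultimately show ?thesis by linarith
  qed
  have "(\<Sum>i\<in>T v. int (t v i)) \<le> 4 * max 0 (D v - 1)" if v: "v \<in> V" for v
  proof -
    have "T v \<subseteq> nb v" "indep (T v) E" using I by (auto simp: T_def indep_def)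
    then have "card (T v) \<le> 4" using claw_bound[OF v] by blast
    then have "int (card (T v)) * max 0 (D v - 1) \<le> 4 * max 0 (D v - 1)" by (intro mult_right_mono) auto
    moreover have "(\<Sum>i\<in>T v. int (t v i)) \<le> int (card (T v)) * max 0 (D v - 1)"
      using sum_bounded_above[of "T v" "\<lambda>i. int (t v i)"] e[OF v] by simp
    ultimately show ?thesis by linarith
  qed
  then have "(\<Sum>v\<in>V. \<Sum>i\<in>T v. int (t v i)) \<le> (\<Sum>v\<in>V. 4 * max 0 (D v - 1))"
    by (intro sum_mono) auto
  also have "\<dots> = 4 * (\<Sum>v\<in>V. max 0 (D v - 1))" by (simp add: sum_distrib_left)
  finally have upper: "(\<Sum>v\<in>V. \<Sum>i\<in>T v. int (t v i)) \<le> 4 * (\<Sum>v\<in>V. max 0 (D v - 1))" .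
  \<comment> \<open>\<open>W (\<phi> z)\<close> contains both \<open>z\<close> and its centre, which
    forces \<open>K \<ge> 2\<close>. These two are not common neighbours of themselves, so at most
    \<open>K - 2\<close> of the \<open>K + 3\<close> common neighbours lie in
    \<open>W (\<phi> z)\<close>.\<close>
  have five: "5 \<le> card (nb z \<inter> nb (\<phi> z) - W (\<phi> z))" if z: "z \<in> Z - I" for z
  proof -
    let ?i = "\<phi> z"
    have i: "?i \<in> I" "z \<in> nb ?i" "?i \<in> Z" "z \<in> L ?i" using \<phi>[OF z] I z by (auto simp: L_def)
    have sub: "{z, ?i} \<subseteq> W ?i" using LW[OF i(1)] i W[of ?i] by auto
    have "z \<noteq> ?i" using i nb_irrefl by metis
    then have "2 \<le> card (W ?i)" using card_mono[OF finW[OF i(3)] sub] by simp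
    then have K2: "K \<ge> 2" using W[OF i(3)] by linarith
    have "card (nb z \<inter> nb ?i \<inter> W ?i) \<le> card (W ?i - {z, ?i})"
      using finW[OF i(3)] nb_irrefl by (intro card_mono) auto
    also have "\<dots> = card (W ?i) - 2" using sub \<open>z \<noteq> ?i\<close> finW[OF i(3)] by (simp add: card_Diff_subset)
    finally have "card (nb z \<inter> nb ?i \<inter> W ?i) + 2 \<le> K" using W[OF i(3)] K2 by linarith
    moreover have "K + 3 \<le> card (nb z \<inter> nb ?i)"
      using common_nb[OF K2, of ?i z] i IV by (auto simp: Int_commute)
    moreover have "card (nb z \<inter> nb ?i) = card (nb z \<inter> nb ?i \<inter> W ?i) + card (nb z \<inter> nb ?i - W ?i)"
      by (intro card_Int_Diff) simp
    ultimately show ?thesis by linarith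
  qed
  have "5 * int (card (Z - I)) = (\<Sum>z\<in>Z - I. 5)" by simp
  also have "\<dots> \<le> (\<Sum>z\<in>Z - I. int (card {v\<in>V. z \<in> nb v \<and> \<phi> z \<in> T v}))"
  proof (intro sum_mono)
    fix z assume z: "z \<in> Z - I"
    have "{v\<in>V. z \<in> nb v \<and> \<phi> z \<in> T v} = nb z \<inter> nb (\<phi> z) - W (\<phi> z)"
      using \<phi>[OF z] z ZV IV
      by (auto simp: T_def intro: nb_sym dest: nb_in)
    then show "5 \<le> int (card {v\<in>V. z \<in> nb v \<and> \<phi> z \<in> T v})" using five[OF z] by simp
  qed
  also have "\<dots> = (\<Sum>z\<in>Z - I. \<Sum>v\<in>V. of_bool (z \<in> nb v \<and> \<phi> z \<in> T v))"
    using finV by (simp add: of_bool_def sum.If_cases Int_def)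
  also have "\<dots> = (\<Sum>v\<in>V. \<Sum>z\<in>Z - I. of_bool (z \<in> nb v \<and> \<phi> z \<in> T v))" by (rule sum.swap)
  also have "\<dots> = (\<Sum>v\<in>V. \<Sum>i\<in>T v. int (t v i))"
  proof (rule sum.cong[OF refl])
    fix v
    have "(\<Sum>i\<in>T v. int (t v i)) = int (card (\<Union>i\<in>T v. L i \<inter> nb v))"
      unfolding t_def using fin by (subst card_UN_disjoint) (auto simp: T_def L_def)
    also have "(\<Union>i\<in>T v. L i \<inter> nb v) = {z \<in> Z - I. z \<in> nb v \<and> \<phi> z \<in> T v}" by (auto simp: L_def)
    finally show "(\<Sum>z\<in>Z - I. of_bool (z \<in> nb v \<and> \<phi> z \<in> T v)) = (\<Sum>i\<in>T v. int (t v i))"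
      using fin by (simp add: of_bool_def sum.If_cases Int_def)
  qed
  finally show ?thesis using upper by linarith
qed

section \<open>Divisors with one chip on each vertex outside a maximum independent set\<close>

definition compl_div :: "'a set \<Rightarrow> 'a \<Rightarrow> int" where
  "compl_div S v = of_bool (v \<in> V - S)"

lemma compl_div_in: "compl_div S \<in> divisors V"
  by (simp add: compl_div_def divisors_def)

lemma div_degree_compl_div:
  assumes "S \<subseteq> V" shows "div_degree V (compl_div S) = int (card V) - int (card S)"
proof -
  have "V \<inter> {v. v \<notin> S} = V - S" by auto
  then show ?thesis
    using finV card_Diff_subset[of S V] card_mono[OF finV assms] finite_subset[OF assms finV] assms
    by (simp add: div_degree_def compl_div_def of_bool_def sum.If_cases of_nat_diff)
qed

text \<open>The degree is bounded only from above, so that the lemma serves twice: a degree below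
  the bound contradicts the degree of \<open>compl_div S\<close>, which gives the lower bound for
  the gonality; equality shows that every class in question comes from a maximum independent
  set.\<close>

lemma positive_rank_min_degree:
  assumes D: "D \<in> divisors V" "1 \<le> div_rank V E D" and deg: "div_degree V D \<le> int (card V) - int \<alpha>"
  obtains S where "S \<in> max_indep_sets V E" "div_equiv V E D (compl_div S)"
proof -
  obtain q where "q \<in> V" using neV by auto
  then obtain f0 where f0: "\<forall>v\<in>V. lap f0 v \<le> D v - of_bool (v = q)"
    using one_le_div_rankD[OF D] by blast
  define D1 where "D1 v = D v - lap f0 v" for v
  have D1: "0 \<le> D1 v" if "v \<in> V" for v
    using bspec[OF f0 that] by (simp add: D1_def of_bool_def split: if_splits)
  have "div_degree V D1 < int (card V)"
    using deg independence_number_pos by (simp add: D1_def[abs_def] div_degree_lap)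
  from no_small_firing[OF D1 this] obtain f1 where f1: "\<And>v. v \<in> V \<Longrightarrow> lap f1 v \<le> D1 v"
    and nsf: "\<And>U. \<lbrakk>U \<subseteq> V; U \<noteq> {}; legal (\<lambda>v. D1 v - lap f1 v) U\<rbrakk> \<Longrightarrow> card V \<le> card U + K" by blast
  define g where "g v = f0 v + f1 v" for v
  define D2 where "D2 v = D v - lap g v" for v
  have D2_eq: "D2 = (\<lambda>v. D1 v - lap f1 v)" by (auto simp: D2_def D1_def g_def[abs_def] lap_add)
  have D2: "0 \<le> D2 v" if "v \<in> V" for v using f1[OF that] by (simp add: D2_eq)
  have abs: "\<exists>W\<subseteq>V. r \<in> W \<and> card W \<le> K \<and> (\<forall>v\<in>V - W. int (card (nb v \<inter> W)) \<le> D2 v)"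
    if r: "r \<in> V" "D2 r = 0" for r
  proof -
    obtain h where h: "\<forall>v\<in>V. lap h v \<le> D v - of_bool (v = r)"
      using one_le_div_rankD[OF D r(1)] by blast
    have "\<forall>v\<in>V. lap (\<lambda>v. h v - g v) v \<le> D2 v - of_bool (v = r)"
      using h unfolding lap_diff D2_def by (simp add: algebra_simps)
    then show ?thesis using absorbing_set[of D2 r] D2 nsf r unfolding D2_eq[symmetric] by blast
  qed
  define Z where "Z = {v\<in>V. D2 v = 0}"
  have ZV: "Z \<subseteq> V" unfolding Z_def by auto
  from maximal_indep_subset[OF ZV] obtain I \<phi> where I: "I \<subseteq> Z" "indep I E"
    and \<phi>: "\<And>z. z \<in> Z - I \<Longrightarrow> \<phi> z \<in> I \<and> z \<in> nb (\<phi> z)" by metis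
  have finZ: "finite Z" using ZV finV finite_subset by auto
  have exc: "5 * int (card (Z - I)) \<le> 4 * (\<Sum>v\<in>V. max 0 (D2 v - 1))"
    using zero_set_excess[OF D2 abs Z_def I \<phi>] by blast
  have "div_degree V D2 = (\<Sum>v\<in>V. 1 - of_bool (v \<in> Z) + max 0 (D2 v - 1))"
    unfolding div_degree_def using D2 by (intro sum.cong) (force simp: Z_def of_bool_def)+
  also have "\<dots> = int (card V) - int (card Z) + (\<Sum>v\<in>V. max 0 (D2 v - 1))"
    using finV ZV by (simp add: sum.distrib sum_subtractf of_bool_def sum.If_cases Int_absorb1)
  finally have deg2: "div_degree V D2 = int (card V) - int (card Z) + (\<Sum>v\<in>V. max 0 (D2 v - 1))" .
  have "div_degree V D2 = div_degree V D" unfolding D2_def[abs_def] by (rule div_degree_lap)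
  then have le: "(\<Sum>v\<in>V. max 0 (D2 v - 1)) \<le> int (card Z) - int \<alpha>" using deg deg2 by simp
  have cZ: "card Z = card I + card (Z - I)"
    using I finZ by (metis card_Diff_subset card_mono finite_subset le_add_diff_inverse)
  have cI: "card I \<le> \<alpha>" using indep_card_le I ZV by auto
  have "card (Z - I) = 0" using le cZ cI exc by linarith
  then have ZI: "Z = I" using finZ I by auto
  then have cZ\<alpha>: "card Z = \<alpha>" and "(\<Sum>v\<in>V. max 0 (D2 v - 1)) \<le> 0"
    using le cI sum_nonneg[of V "\<lambda>v. max 0 (D2 v - 1)"] by auto
  moreover have "(\<Sum>v\<in>V. max 0 (D2 v - 1)) \<ge> 0" by (intro sum_nonneg) auto
  ultimately have "(\<Sum>v\<in>V. max 0 (D2 v - 1)) = 0" by linarith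
  then have "\<forall>v\<in>V. max 0 (D2 v - 1) = 0" using finV by (subst (asm) sum_nonneg_eq_0_iff) auto
  then have "D2 v = compl_div Z v" for v
    using D2[of v] D(1) by (cases "v \<in> V") (force simp: compl_div_def Z_def D2_def divisors_def)+
  then have "compl_div Z = D2" by auto
  then have "div_equiv V E D (compl_div Z)" unfolding div_equiv_iff D2_def by blast
  moreover have "Z \<in> max_indep_sets V E" using ZV I ZI cZ\<alpha> by (auto simp: max_indep_sets_def)
  ultimately show ?thesis using that by blast
qed

lemma positive_rank_degree_ge:
  assumes "D \<in> divisors V" "1 \<le> div_rank V E D"
  shows "int (card V) - int \<alpha> \<le> div_degree V D"
proof (rule ccontr)
  assume c: "\<not> ?thesis"
  then obtain S where S: "S \<in> max_indep_sets V E" "div_equiv V E D (compl_div S)"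
    using positive_rank_min_degree[OF assms] by force
  then have "div_degree V D = div_degree V (compl_div S)" unfolding div_equiv_iff
    by (auto simp: div_degree_lap)
  then show False using S c by (auto simp: div_degree_compl_div max_indep_sets_def)
qed

lemma compl_div_rank_ge:
  assumes S: "S \<in> max_indep_sets V E" shows "1 \<le> div_rank V E (compl_div S)"
proof (rule one_le_div_rankI[OF compl_div_in])
  fix q assume q: "q \<in> V"
  show "\<exists>f. \<forall>v\<in>V. lap f v \<le> compl_div S v - of_bool (v = q)"
  proof (cases "q \<in> S")
    case False
    then show ?thesis by (intro exI[of _ "\<lambda>_. 0"]) (auto simp: compl_div_def)
  next
    case True
    \<comment> \<open>The vertex \<open>q\<close> borrows: by independence all its neighbours lie
      outside \<open>S\<close>, so each has a chip to give.\<close>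
    have "lap (\<lambda>v. - of_bool (v \<in> {q})) v \<le> compl_div S v - of_bool (v = q)" if v: "v \<in> V" for v
    proof -
      have "v \<notin> S" if "v \<noteq> q" "q \<in> nb v"
        using adj_indep[of S v q] S True that v by (auto simp: max_indep_sets_def)
      moreover have "nb q - {q} = nb q" using nb_irrefl by auto
      moreover have "nb v \<inter> {q} = (if q \<in> nb v then {q} else {})" by auto
      moreover have "1 \<le> card (nb q)" using degree_gt[OF q] by simp
      ultimately show ?thesis unfolding lap_uminus lap_indicator[OF v]
        using v True by (auto simp: compl_div_def)
    qed
    then show ?thesis by blast
  qed
qed

text \<open>With rank 2, taking away one chip would leave a divisor of positive rank whose degree is
  below the minimum.\<close>

lemma compl_div_rank:
  assumes S: "S \<in> max_indep_sets V E" shows "div_rank V E (compl_div S) = 1"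
proof (rule antisym[OF _ compl_div_rank_ge[OF S]], rule ccontr)
  assume "\<not> div_rank V E (compl_div S) \<le> 1"
  then have "2 \<le> div_rank V E (compl_div S)" by simp
  then have two: "\<forall>F\<in>effective_divisors V. div_degree V F = 2 \<longrightarrow> equiv_to_effective V E (\<lambda>v. compl_div S v - F v)"
    using le_div_rank_iff[OF compl_div_in, of 2] by simp
  obtain q where q: "q \<in> V" using neV by auto
  define D where "D v = compl_div S v - of_bool (v = q)" for v
  have D: "D \<in> divisors V" using compl_div_in[of S] q by (auto simp: divisors_def D_def)
  have q1: "div_degree V (\<lambda>v. of_bool (v = q)) = 1"
    using q finV by (auto simp: div_degree_def of_bool_def)
  have "equiv_to_effective V E (\<lambda>v. D v - F v)" if F: "F \<in> effective_divisors V" "div_degree V F = 1" for F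
  proof -
    have "(\<lambda>v. of_bool (v = q) + F v) \<in> effective_divisors V"
      using F q by (auto simp: effective_divisors_def divisors_def)
    moreover have "div_degree V (\<lambda>v. of_bool (v = q) + F v) = 2"
      using F(2) q1 by (simp add: div_degree_def sum.distrib)
    ultimately show ?thesis using two by (auto simp: D_def algebra_simps)
  qed
  then have "1 \<le> div_rank V E D" using le_div_rank_iff[OF D, of 1] by simp
  then have "int (card V) - int \<alpha> \<le> div_degree V D" using positive_rank_degree_ge[OF D] by blast
  also have "\<dots> = div_degree V (compl_div S) - 1"
    unfolding D_def[abs_def] using div_degree_diff q1 by simp
  also have "\<dots> = int (card V) - int \<alpha> - 1" using S by (auto simp: div_degree_compl_div max_indep_sets_def)
  finally show False by simp
qed

text \<open>In a set of at most \<open>K\<close> vertices each vertex has at least two neighbours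
  outside, since its degree exceeds \<open>K\<close> and at most \<open>K - 1\<close> other vertices
  belong to the set. Its single chip cannot pay for both.\<close>

lemma compl_div_legal_cosmall:
  assumes "legal (compl_div S) U" "U \<subseteq> V" "U \<noteq> {}" "S \<noteq> {}" "S \<subseteq> V"
  shows "card V \<le> card U + K"
proof (rule ccontr)
  assume c: "\<not> ?thesis"
  have "card S > 0" using assms finV finite_subset by (auto simp: card_gt_0_iff)
  then have "card U \<le> K"
    using legal_card[OF assms(1,2)] c div_degree_compl_div[OF assms(5)] by (auto simp: compl_div_def)
  obtain u where u: "u \<in> U" using assms by auto
  then have "int (card (nb u - U)) \<le> compl_div S u" using assms(1) by (simp add: legal_def)
  moreover have "compl_div S u \<le> 1" by (simp add: compl_div_def)
  ultimately have "card (nb u - U) \<le> 1" by linarith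
  moreover have "nb u - U = nb u - (U - {u})" using nb_irrefl by auto
  moreover have finU: "finite U" using assms(2) finV finite_subset by auto
  moreover have "card (U - {u}) < card U" using u finU by (intro psubset_card_mono) auto
  ultimately show False
    using diff_card_le_card_Diff[of "U - {u}" "nb u"] degree_gt[of u] u assms(2) \<open>card U \<le> K\<close> by force
qed

text \<open>
  A firing script between the two divisors has a maximal and a minimal level set that are
  both legal, hence co-small, which is impossible for disjoint sets.
\<close>

lemma compl_div_equiv_imp_eq:
  assumes S: "S \<in> max_indep_sets V E" and T: "T \<in> max_indep_sets V E"
    and eq: "div_equiv V E (compl_div S) (compl_div T)"
  shows "S = T"
proof -
  obtain f where f: "compl_div T = (\<lambda>v. compl_div S v - lap f v)" using eq unfolding div_equiv_iff by blast
  have S': "S \<subseteq> V" "T \<subseteq> V" "S \<noteq> {}" "T \<noteq> {}"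
    using S T independence_number_pos by (auto simp: max_indep_sets_def)
  have nn: "0 \<le> compl_div X v" for X v by (simp add: compl_div_def)
  define M where "M = Max (f ` V)"
  define m where "m = Min (f ` V)"
  let ?U = "{v\<in>V. f v = M}" and ?L = "{v\<in>V. f v = m}"
  have "M \<in> f ` V" "m \<in> f ` V" unfolding M_def m_def using neV finV by (auto intro: Max_in Min_in)
  then have ne: "?U \<noteq> {}" "?L \<noteq> {}" by auto
  have M: "f v \<le> M" and m: "m \<le> f v" if "v \<in> V" for v unfolding M_def m_def using that finV by auto
  have "lap f v \<le> compl_div S v" for v using nn[of T v] unfolding f by simp
  then have "legal (compl_div S) ?U" using legal_max_level[of f "compl_div S" M] M by blast
  then have 1: "card V \<le> card ?U + K" using compl_div_legal_cosmall S' ne by blast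
  have "legal (compl_div T) ?L" unfolding f using legal_min_level[of "compl_div S" m f] nn m by blast
  then have 2: "card V \<le> card ?L + K" using compl_div_legal_cosmall S' ne by blast
  have "M = m"
  proof (rule ccontr)
    assume "M \<noteq> m"
    then have "card ?U + card ?L = card (?U \<union> ?L)" using finV by (subst card_Un_disjoint) auto
    also have "\<dots> \<le> card V" using finV by (intro card_mono) auto
    finally show False using 1 2 K_small by linarith
  qed
  then have "lap f = lap (\<lambda>_. M)" using M m by (intro lap_cong antisym) auto
  then have "compl_div T = compl_div S" unfolding f by simp
  then have "v \<in> V - T \<longleftrightarrow> v \<in> V - S" for v by (auto simp: compl_div_def fun_eq_iff of_bool_def split: if_splits)
  then show ?thesis using S' by blast
qed

theorem gonality_eq: "gonality V E = int (card V) - int \<alpha>"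
  unfolding gonality_def
proof (rule Least_equality)
  obtain S where "S \<in> max_indep_sets V E"
    using independence_number_attained by (auto simp: max_indep_sets_def)
  then show "\<exists>D\<in>divisors V. div_degree V D = int (card V) - int \<alpha> \<and> 1 \<le> div_rank V E D"
    by (intro bexI[of _ "compl_div S"])
       (auto simp: compl_div_in compl_div_rank_ge div_degree_compl_div max_indep_sets_def)
qed (use positive_rank_degree_ge in auto)

theorem rank1_classes_bij: "\<exists>f. bij_betw f (rank1_gonality_classes V E) (max_indep_sets V E)"
proof -
  have "bij_betw (\<lambda>S. div_class V E (compl_div S)) (max_indep_sets V E) (rank1_gonality_classes V E)"
    unfolding bij_betw_def
  proof (intro conjI inj_onI)
    fix S T assume "S \<in> max_indep_sets V E" "T \<in> max_indep_sets V E"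
      "div_class V E (compl_div S) = div_class V E (compl_div T)"
    then show "S = T" using compl_div_equiv_imp_eq div_class_eq_iff by blast
  next
    have "compl_div S \<in> {D \<in> divisors V. div_rank V E D = 1 \<and> div_degree V D = gonality V E}"
      if "S \<in> max_indep_sets V E" for S
      using that compl_div_rank[OF that]
      by (auto simp: compl_div_in gonality_eq div_degree_compl_div max_indep_sets_def)
    moreover have "\<exists>S\<in>max_indep_sets V E. div_class V E D = div_class V E (compl_div S)"
      if "D \<in> {D \<in> divisors V. div_rank V E D = 1 \<and> div_degree V D = gonality V E}" for D
      using positive_rank_min_degree[of D] that div_class_eq_iff by (auto simp: gonality_eq) metis
    ultimately show "(\<lambda>S. div_class V E (compl_div S)) ` max_indep_sets V E = rank1_gonality_classes V E"
      unfolding rank1_gonality_classes_def by blast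
  qed
  then show ?thesis using bij_betw_inv by blast
qed

end

subsection \<open>Edge boundaries\<close>

context fin_graph
begin

lemma boundary_compl:
  assumes "U \<subseteq> V"
  shows "(\<Sum>u\<in>U. card (nb u - U)) = (\<Sum>w\<in>V - U. card (nb w \<inter> U))"
proof -
  have fin: "finite U" "finite (V - U)" using assms finV finite_subset by auto
  have "(\<Sum>u\<in>U. card (nb u - U)) = (\<Sum>u\<in>U. \<Sum>w\<in>V - U. of_bool (w \<in> nb u))"
  proof (rule sum.cong[OF refl])
    fix u
    have "nb u - U = (V - U) \<inter> {w. w \<in> nb u}" using nb_in by auto
    then show "card (nb u - U) = (\<Sum>w\<in>V - U. of_bool (w \<in> nb u))"
      using fin by (simp add: of_bool_def sum.If_cases)
  qed
  also have "\<dots> = (\<Sum>w\<in>V - U. \<Sum>u\<in>U. of_bool (w \<in> nb u))" by (rule sum.swap)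
  also have "\<dots> = (\<Sum>w\<in>V - U. card (nb w \<inter> U))"
  proof (rule sum.cong[OF refl])
    fix w assume "w \<in> V - U"
    then have "U \<inter> {u. w \<in> nb u} = nb w \<inter> U" using assms by (auto intro: nb_sym)
    then show "(\<Sum>u\<in>U. of_bool (w \<in> nb u)) = card (nb w \<inter> U)"
      using fin by (simp add: of_bool_def sum.If_cases)
  qed
  finally show ?thesis .
qed

lemma boundary_compl':
  assumes "U \<subseteq> V"
  shows "(\<Sum>u\<in>U. card (nb u - U)) = (\<Sum>w\<in>V - U. card (nb w - (V - U)))"
proof -
  have "nb w - (V - U) = nb w \<inter> U" for w using nb_in[of _ w] assms by auto
  then show ?thesis using boundary_compl[OF assms] by simp
qed

text \<open>Counts paths u - x - w with \<open>u\<close> in \<open>U\<close> and \<open>w\<close>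
  outside. Such a path uses a boundary edge, namely xw or ux according to the side of
  \<open>x\<close>, and each boundary edge extends to at most \<open>d\<close> paths at either
  end.\<close>

lemma boundary_common_nb:
  assumes U: "U \<subseteq> V" and d: "\<And>v. v \<in> V \<Longrightarrow> card (nb v) \<le> d"
    and \<mu>: "\<And>u w. \<lbrakk>u \<in> V; w \<in> V; u \<noteq> w\<rbrakk> \<Longrightarrow> \<mu> \<le> card (nb u \<inter> nb w)"
  shows "\<mu> * (card U * card (V - U)) \<le> 2 * d * (\<Sum>u\<in>U. card (nb u - U))"
proof -
  have fin: "finite U" "finite (V - U)" using U finV finite_subset by auto
  have "\<mu> * (card U * card (V - U)) = (\<Sum>u\<in>U. \<Sum>w\<in>V - U. \<mu>)" by simp
  also have "\<dots> \<le> (\<Sum>u\<in>U. \<Sum>w\<in>V - U. card (nb u \<inter> nb w))"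
    using U by (intro sum_mono \<mu>) auto
  also have "\<dots> = (\<Sum>u\<in>U. \<Sum>w\<in>V - U. \<Sum>x\<in>V. of_bool (u \<in> nb x) * of_bool (w \<in> nb x))"
  proof (intro sum.cong[OF refl])
    fix u w assume uw: "u \<in> U" "w \<in> V - U"
    have "V \<inter> {x. u \<in> nb x \<and> w \<in> nb x} = nb u \<inter> nb w"
      using uw U by (auto intro: nb_sym dest: nb_in)
    then have "card (nb u \<inter> nb w) = (\<Sum>x\<in>V. of_bool (u \<in> nb x \<and> w \<in> nb x))"
      using finV by (simp add: of_bool_def sum.If_cases)
    then show "card (nb u \<inter> nb w) = (\<Sum>x\<in>V. of_bool (u \<in> nb x) * of_bool (w \<in> nb x))"
      by (simp only: of_bool_conj)
  qed
  also have "\<dots> = (\<Sum>x\<in>V. \<Sum>u\<in>U. \<Sum>w\<in>V - U. of_bool (u \<in> nb x) * of_bool (w \<in> nb x))"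
    by (subst sum.swap[of _ V]) (intro sum.cong refl sum.swap)
  also have "\<dots> = (\<Sum>x\<in>V. card (nb x \<inter> U) * card (nb x - U))"
  proof (intro sum.cong[OF refl])
    fix x
    have *: "nb x - U = (V - U) \<inter> {w. w \<in> nb x}" "nb x \<inter> U = U \<inter> {w. w \<in> nb x}" using nb_in by auto
    have "card (nb x \<inter> U) * card (nb x - U) = (\<Sum>u\<in>U. of_bool (u \<in> nb x)) * (\<Sum>w\<in>V - U. of_bool (w \<in> nb x))"
      unfolding * using fin by (simp add: of_bool_def sum.If_cases)
    then show "(\<Sum>u\<in>U. \<Sum>w\<in>V - U. of_bool (u \<in> nb x) * of_bool (w \<in> nb x)) = card (nb x \<inter> U) * card (nb x - U)"
      by (simp add: sum_product)
  qed
  also have "\<dots> = (\<Sum>x\<in>U. card (nb x \<inter> U) * card (nb x - U)) + (\<Sum>x\<in>V - U. card (nb x \<inter> U) * card (nb x - U))"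
    using sum.subset_diff[OF U finV, of "\<lambda>x. card (nb x \<inter> U) * card (nb x - U)"] by (simp add: add.commute)
  also have "\<dots> \<le> (\<Sum>x\<in>U. d * card (nb x - U)) + (\<Sum>x\<in>V - U. card (nb x \<inter> U) * d)"
  proof (intro add_mono sum_mono mult_right_mono mult_left_mono)
    fix x assume "x \<in> U"
    then show "card (nb x \<inter> U) \<le> d" using d[of x] U card_mono[of "nb x" "nb x \<inter> U"] by auto
  next
    fix x assume "x \<in> V - U"
    then show "card (nb x - U) \<le> d" using d[of x] card_mono[of "nb x" "nb x - U"] by auto
  qed auto
  also have "\<dots> = 2 * d * (\<Sum>u\<in>U. card (nb u - U))"
    using boundary_compl[OF U] by (simp add: mult.commute flip: sum_distrib_left sum_distrib_right)
  finally show ?thesis .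
qed

text \<open>By complementation \<open>U\<close> is at most half of \<open>V\<close>. If
  \<open>card U \<le> d - K\<close>, each vertex sends at least \<open>d + 1 - card U\<close> edges
  out, and t * (d + 1 - t) is concave with the value \<open>(K + 1) * (d - K)\<close> at both ends t
  = K + 1 and t = d - K. A larger \<open>U\<close> has at least 4/5 of \<open>d\<close> vertices,
  and then counting paths with five common neighbours suffices.\<close>

lemma boundary_regular:
  assumes d: "\<And>v. v \<in> V \<Longrightarrow> card (nb v) = d"
    and K: "K \<le> d" "card V \<le> (K + 1) * (d - K)"
    and large: "card V \<le> 2 * (d - K) \<or> 5 * K \<le> d + 5 \<and>
      (\<forall>u\<in>V. \<forall>w\<in>V. u \<noteq> w \<longrightarrow> 5 \<le> card (nb u \<inter> nb w))"
    and U: "U \<subseteq> V" "K < card U" "card U + K < card V"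
  shows "card V \<le> (\<Sum>u\<in>U. card (nb u - U))"
proof -
  have half: "card V \<le> (\<Sum>u\<in>U. card (nb u - U))" if U: "U \<subseteq> V" "K < card U" "2 * card U \<le> card V" for U
  proof (cases "card U \<le> d - K")
    case True
    have fin: "finite U" using U finV finite_subset by auto
    have "d + 1 - card U \<le> card (nb u - U)" if u: "u \<in> U" for u
    proof -
      have "nb u - U = nb u - (U - {u})" using nb_irrefl by auto
      then show ?thesis
        using diff_card_le_card_Diff[of "U - {u}" "nb u"] d[of u] u U fin by (auto simp: card_Diff_singleton)
    qed
    then have "card U * (d + 1 - card U) \<le> (\<Sum>u\<in>U. card (nb u - U))"
      using sum_bounded_below[of U "d + 1 - card U"] by auto
    moreover have "(K + 1) * (d - K) \<le> card U * (d + 1 - card U)"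
    proof -
      obtain i j where "card U = K + 1 + i" "d = K + card U + j"
        using U(2) True K(1) by (metis Suc_eq_plus1 Suc_leI add.commute add.left_commute le_Suc_ex le_diff_conv2)
      then show ?thesis by (simp add: algebra_simps)
    qed
    ultimately show ?thesis using K(2) by linarith
  next
    case False
    then have 5: "5 * K \<le> d + 5" "\<And>u w. \<lbrakk>u \<in> V; w \<in> V; u \<noteq> w\<rbrakk> \<Longrightarrow> 5 \<le> card (nb u \<inter> nb w)"
      using large U(3) by auto
    have cVU: "card (V - U) = card V - card U" using U finV finite_subset card_Diff_subset by metis
    have "4 * d \<le> 5 * card U" using False 5(1) K(1) by linarith
    moreover have "card V \<le> 2 * card (V - U)" using U(3) cVU by linarith
    ultimately have "(4 * d) * card V \<le> (5 * card U) * (2 * card (V - U))" by (rule mult_le_mono)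
    also have "\<dots> = 2 * (5 * (card U * card (V - U)))" by simp
    also have "\<dots> \<le> 2 * (2 * d * (\<Sum>u\<in>U. card (nb u - U)))"
      using boundary_common_nb[OF U(1), of d 5] d 5(2) by simp
    finally have "4 * d * card V \<le> 4 * d * (\<Sum>u\<in>U. card (nb u - U))" by simp
    moreover have "d > 0" using K neV finV by (cases d) (auto simp: card_gt_0_iff)
    ultimately show ?thesis by simp
  qed
  show ?thesis
  proof (cases "2 * card U \<le> card V")
    case True
    then show ?thesis using half U by blast
  next
    case False
    have "card (V - U) = card V - card U" using U finV finite_subset card_Diff_subset by metis
    then show ?thesis using half[of "V - U"] boundary_compl'[OF U(1)] U False by simp
  qed
qed

end

subsection \<open>Toroidal queen's graphs\<close>

lemma crt_gcd:
  fixes u v :: int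
  shows "(\<exists>k. [k = u] (mod a) \<and> [k = v] (mod b)) \<longleftrightarrow> gcd a b dvd u - v"
proof
  assume "\<exists>k. [k = u] (mod a) \<and> [k = v] (mod b)"
  then obtain k where k: "a dvd k - u" "b dvd k - v" by (auto simp: cong_iff_dvd_diff)
  then have "gcd a b dvd k - u" "gcd a b dvd k - v" by (meson dvd_trans gcd_dvd1 gcd_dvd2)+
  then have "gcd a b dvd (k - v) - (k - u)" by (rule dvd_diff[rotated])
  then show "gcd a b dvd u - v" by simp
next
  assume "gcd a b dvd u - v"
  then obtain t where t: "u - v = gcd a b * t" by (auto simp: dvd_def)
  obtain r s where rs: "r * a + s * b = gcd a b" using bezout_int by blast
  let ?k = "u - a * r * t"
  have "?k - v = b * (s * t)" using t rs by (simp add: algebra_simps flip: rs)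
  then have "[?k = v] (mod b)" by (simp add: cong_iff_dvd_diff)
  moreover have "[?k = u] (mod a)" by (simp add: cong_iff_dvd_diff)
  ultimately show "\<exists>k. [k = u] (mod a) \<and> [k = v] (mod b)" by blast
qed

text \<open>
  By the Chinese remainder theorem the two wrapped diagonals through a vertex are congruence
  classes modulo \<open>gcd m n\<close>.
\<close>

lemma queen_move_iff:
  "queen_move m n (x, y) (x', y') \<longleftrightarrow> x = x' \<or> y = y' \<or>
     int (gcd m n) dvd (x - y) - (x' - y') \<or> int (gcd m n) dvd (x + y) - (x' + y')"
proof -
  have e1: "[b = a + k] (mod M) \<longleftrightarrow> [k = b - a] (mod M)" for a b k M :: int
    using dvd_minus_iff[of M "b - (a + k)"] by (simp add: cong_iff_dvd_diff algebra_simps)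
  have e2: "[b = a - k] (mod M) \<longleftrightarrow> [k = a - b] (mod M)" for a b k M :: int
    by (simp add: cong_iff_dvd_diff algebra_simps)
  have "(\<exists>k. [x' = x + k] (mod int m) \<and> [y' = y + k] (mod int n)) \<longleftrightarrow> int (gcd m n) dvd (x' - x) - (y' - y)"
    unfolding e1 using crt_gcd[of "x' - x" "int m" "y' - y" "int n"] by simp
  moreover have "int (gcd m n) dvd (x' - x) - (y' - y) \<longleftrightarrow> int (gcd m n) dvd (x - y) - (x' - y')"
    using dvd_minus_iff[of _ "(x' - x) - (y' - y)"] by (simp add: algebra_simps)
  moreover have "(\<exists>k. [x' = x + k] (mod int m) \<and> [y' = y - k] (mod int n)) \<longleftrightarrow> int (gcd m n) dvd (x' - x) - (y - y')"
    unfolding e1 e2 using crt_gcd[of "x' - x" "int m" "y - y'" "int n"] by simp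
  moreover have "int (gcd m n) dvd (x' - x) - (y - y') \<longleftrightarrow> int (gcd m n) dvd (x + y) - (x' + y')"
    using dvd_minus_iff[of _ "(x' - x) - (y - y')"] by (simp add: algebra_simps)
  ultimately show ?thesis unfolding queen_move_def by (simp add: conj_disj_distribL ex_disj_distrib)
qed

lemma card_residue:
  fixes h b :: nat
  assumes "h > 0"
  shows "card {y \<in> {0..<int (h * b)}. int h dvd y - c} = b"
proof -
  have "bij_betw (\<lambda>t. c mod int h + int h * int t) {..<b} {y \<in> {0..<int (h * b)}. int h dvd y - c}"
  proof (rule bij_betw_byWitness[where f' = "\<lambda>y. nat (y div int h)"])
    show "\<forall>t\<in>{..<b}. nat ((c mod int h + int h * int t) div int h) = t" using assms by simp
    show "\<forall>y\<in>{y \<in> {0..<int (h * b)}. int h dvd y - c}. c mod int h + int h * int (nat (y div int h)) = y"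
    proof clarify
      fix y assume y: "y \<in> {0..<int (h * b)}" "int h dvd y - c"
      then have "y mod int h = c mod int h" by (simp add: mod_eq_dvd_iff)
      moreover have "0 \<le> y div int h" using y assms by (simp add: pos_imp_zdiv_nonneg_iff)
      ultimately show "c mod int h + int h * int (nat (y div int h)) = y" by (metis int_nat_eq mod_mult_div_eq)
    qed
    show "(\<lambda>y. nat (y div int h)) ` {y \<in> {0..<int (h * b)}. int h dvd y - c} \<subseteq> {..<b}"
    proof clarify
      fix y assume y: "y \<in> {0..<int (h * b)}"
      have "y div int h * int h \<le> y"
      proof -
        have "0 \<le> y mod int h" using assms by simp
        then show ?thesis using minus_mod_eq_div_mult[of y "int h"] by linarith
      qed
      also have "\<dots> < int b * int h" using y by (simp add: mult.commute)
      finally have "y div int h < int b" by (simp add: mult_less_cancel_right)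
      then show "nat (y div int h) < b" using y assms by (simp add: pos_imp_zdiv_nonneg_iff nat_less_iff)
    qed
    show "(\<lambda>t. c mod int h + int h * int t) ` {..<b} \<subseteq> {y \<in> {0..<int (h * b)}. int h dvd y - c}"
    proof clarify
      fix t assume t: "t < b"
      have "c mod int h < int h" "0 \<le> c mod int h" using assms by simp_all
      moreover have "int h * int t \<le> int h * (int b - 1)" using t by (intro mult_left_mono) auto
      moreover have "int h dvd c mod int h + int h * int t - c"
      proof -
        have "c mod int h + int h * int t - c = int h * (int t - c div int h)"
          using mult_div_mod_eq[of "int h" c] unfolding right_diff_distrib by linarith
        then show ?thesis by simp
      qed
      moreover have "c mod int h + int h * int t < int (h * b)"
        using calculation by (simp add: right_diff_distrib)
      ultimately show "c mod int h + int h * int t \<in> {0..<int (h * b)} \<and> int h dvd c mod int h + int h * int t - c"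
        by simp
    qed
  qed
  from bij_betw_same_card[OF this] show ?thesis by simp
qed

text \<open>The numerical conditions of \<open>boundary_regular\<close>. The small boards satisfy
  \<open>m * n \<le> 2 * (d - K)\<close>; for \<open>g = 1\<close> the graph is complete. In the two
  general cases the substitutions \<open>a = Suc a'\<close>, \<open>b = Suc b'\<close>,
  \<open>h = k + 2\<close> remove all subtractions, so that the inequalities can be compared
  coefficient by coefficient.\<close>

lemma degree_bound_arith:
  fixes m n g a b d e K :: nat
  assumes pos: "g > 0" "a > 0" "b > 0" and m: "m = g * a" and n: "n = g * b" and m2: "m \<ge> 2" and n2: "n \<ge> 2"
    and e_def: "e = (if even g then 2 else 1)"
    and K_def: "K = (if g < 4 \<or> g = 4 \<and> a + b < 3 then 1 else g div 2)"
    and d_eq: "d + (e * a * b + a + b + 1) = 2 * g * a * b + g * a + g * b"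
  shows "K < d \<and> m * n \<le> (K + 1) * (d - K) \<and> (m * n \<le> 2 * (d - K) \<or> 2 \<le> K \<and> 5 * K \<le> d + 5)"
proof -
  obtain a' b' where ab': "a = Suc a'" "b = Suc b'" using pos by (metis gr0_implies_Suc)
  consider "g = 1" | "g = 2" | "g = 3" | "g = 4" "a + b < 3" | h where "g = 2 * h" "h \<ge> 2" "\<not> (g = 4 \<and> a + b < 3)"
    | h where "g = 2 * h + 1" "h \<ge> 2"
  proof (cases "g < 4 \<or> g = 4 \<and> a + b < 3")
    case True
    then show ?thesis using that pos by linarith
  next
    case False
    then show ?thesis using that(5)[of "g div 2"] that(6)[of "g div 2"] by (cases "even g") auto
  qed
  then show ?thesis
  proof cases
    case 1
    have "4 \<le> a * b" using mult_le_mono[OF m2 n2] m n 1 by simp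
    then obtain c where "a * b = c + 4" by (metis add.commute le_Suc_ex)
    moreover from this have "d = c + 3" using 1 d_eq by (simp add: e_def mult.assoc)
    ultimately show ?thesis using 1 m n by (simp add: K_def)
  next
    case 2
    then show ?thesis using d_eq m n ab' by (simp add: K_def e_def algebra_simps)
  next
    case 3
    then show ?thesis using d_eq m n ab' by (simp add: K_def e_def algebra_simps)
  next
    case 4
    then have "a = 1" "b = 1" using pos by linarith+
    then show ?thesis using d_eq m n 4 by (simp add: K_def e_def)
  next
    case (5 h)
    obtain k where k: "h = k + 2" using 5 by (metis add.commute le_Suc_ex)
    have Kh: "K = h" using 5 by (auto simp: K_def)
    define Y where "Y = (4 * k + 6) * a * b + (2 * k + 3) * (a' + b') + 3 * k + 3"
    have d: "d = h + Y" using d_eq 5(1) unfolding Y_def k ab' by (simp add: e_def algebra_simps)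
    have "m * n \<le> (h + 1) * Y" unfolding Y_def m n 5(1) k ab' by (simp add: algebra_simps)
    moreover have "4 * k + 6 \<le> Y" unfolding Y_def ab' by (simp add: algebra_simps)
    ultimately show ?thesis unfolding Kh d using k by simp
  next
    case (6 h)
    obtain k where k: "h = k + 2" using 6 by (metis add.commute le_Suc_ex)
    have Kh: "K = h" using 6 by (auto simp: K_def)
    define Y where "Y = (4 * k + 9) * a * b + (2 * k + 4) * (a' + b') + 3 * k + 5"
    have d: "d = h + Y" using d_eq 6(1) unfolding Y_def k ab' by (simp add: e_def algebra_simps)
    have "m * n \<le> (h + 1) * Y" unfolding Y_def m n 6(1) k ab' by (simp add: algebra_simps)
    moreover have "4 * k + 9 \<le> Y" unfolding Y_def ab' by (simp add: algebra_simps)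
    ultimately show ?thesis unfolding Kh d using k by simp
  qed
qed

text \<open>
  Dimensions are written as \<open>m = g * a\<close> and \<open>n = g * b\<close>. A row meets a diagonal in \<open>a\<close> vertices,
  a column in \<open>b\<close>.
\<close>

locale toroidal_queens =
  fixes m n g a b :: nat
  assumes m: "m = g * a" and n: "n = g * b" and g: "g = gcd m n" and m2: "m \<ge> 2" and n2: "n \<ge> 2"
begin

abbreviation V where "V \<equiv> TQ_verts m n"
abbreviation E where "E \<equiv> TQ_edges m n"

definition adj :: "int \<times> int \<Rightarrow> int \<times> int \<Rightarrow> bool" where
  "adj = (\<lambda>(x, y) (x', y'). x = x' \<or> y = y' \<or>
     int g dvd (x - y) - (x' - y') \<or> int g dvd (x + y) - (x' + y'))"

lemma pos: "g > 0" "a > 0" "b > 0"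
  using m n m2 n2 by (auto intro!: Nat.gr0I)

lemma verts_iff [simp]: "(x, y) \<in> V \<longleftrightarrow> 0 \<le> x \<and> x < int m \<and> 0 \<le> y \<and> y < int n"
  by (auto simp: TQ_verts_def)

lemma finite_V: "finite V" and card_V: "card V = m * n"
  by (auto simp: TQ_verts_def card_cartesian_product)

lemma adj_sym: "adj p q \<longleftrightarrow> adj q p"
  using dvd_minus_iff[of "int g" "(fst p - snd p) - (fst q - snd q)"]
    dvd_minus_iff[of "int g" "(fst p + snd p) - (fst q + snd q)"]
  by (auto simp: adj_def split: prod.splits)

lemma adj_iff_queen_move: "adj p q \<longleftrightarrow> queen_move m n p q"
  by (cases p; cases q) (simp add: adj_def queen_move_iff flip: g)

lemma edge_iff: "{p, q} \<in> E \<longleftrightarrow> p \<in> V \<and> q \<in> V \<and> p \<noteq> q \<and> adj p q"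
proof -
  have "{p, q} \<in> E \<longleftrightarrow> (\<exists>p' q'. {p, q} = {p', q'} \<and> p' \<in> V \<and> q' \<in> V \<and> p' \<noteq> q' \<and> adj p' q')"
    unfolding TQ_edges_def adj_iff_queen_move by blast
  then show ?thesis unfolding doubleton_eq_iff using adj_sym by blast
qed

lemma neighbors_eq: "p \<in> V \<Longrightarrow> neighbors V E p = {q \<in> V. q \<noteq> p \<and> adj p q}"
  by (auto simp: neighbors_def edge_iff)

lemma indep_iff:
  assumes "S \<subseteq> V"
  shows "indep S E \<longleftrightarrow> inj_on fst S \<and> inj_on snd S \<and>
    inj_on (\<lambda>p. (fst p - snd p) mod int g) S \<and> inj_on (\<lambda>p. (fst p + snd p) mod int g) S"
proof -
  have "indep S E \<longleftrightarrow> (\<forall>p\<in>S. \<forall>q\<in>S. adj p q \<longrightarrow> p = q)"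
    using assms unfolding indep_def edge_iff by blast
  moreover have "adj p q \<longleftrightarrow> fst p = fst q \<or> snd p = snd q \<or>
      (fst p - snd p) mod int g = (fst q - snd q) mod int g \<or>
      (fst p + snd p) mod int g = (fst q + snd q) mod int g" for p q
    by (auto simp: adj_def mod_eq_dvd_iff split: prod.splits)
  ultimately show ?thesis unfolding inj_on_def by blast
qed

text \<open>The number of residues of \<open>x - x0\<close> modulo \<open>g\<close> for which the
  two diagonals through a vertex of column \<open>x0\<close> meet column \<open>x\<close> in the
  same vertices.\<close>

definition e :: nat where "e = (if even g then 2 else 1)"

lemma card_double_residue: "card {x \<in> {0..<int m}. int g dvd 2 * (x - x0)} = e * a"
proof (cases "even g")
  case True
  then obtain h where h: "g = 2 * h" by blast
  then have "int g dvd 2 * (x - x0) \<longleftrightarrow> int h dvd x - x0" for x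
    using dvd_mult_cancel_left[of 2 "int h" "x - x0"] by simp
  moreover have "m = h * (2 * a)" using m h by simp
  moreover have "h > 0" using h pos by simp
  ultimately show ?thesis using card_residue[of h "2 * a" x0] True by (simp add: e_def)
next
  case False
  then have "coprime (int g) 2" by simp
  then have *: "int g dvd 2 * (x - x0) \<longleftrightarrow> int g dvd x - x0" for x
    by (rule coprime_dvd_mult_right_iff)
  show ?thesis unfolding * using card_residue[of g a x0] False pos m by (simp add: e_def)
qed

text \<open>Inclusion and exclusion: each diagonal contributes \<open>b\<close> vertices and the row
  of \<open>y0\<close> one. The diagonals coincide on this column if \<open>g\<close> divides
  \<open>2 * (x - x0)\<close> and are disjoint there otherwise; \<open>y0\<close> is already on them
  exactly if \<open>g\<close> divides \<open>x - x0\<close>. The additive form avoids subtraction of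
  natural numbers.\<close>

lemma card_column:
  assumes "(x0, y0) \<in> V" "x \<noteq> x0"
  shows "card {y \<in> {0..<int n}. adj (x0, y0) (x, y)} + b * of_bool (int g dvd 2 * (x - x0)) + of_bool (int g dvd x - x0)
    = 2 * b + 1"
proof -
  define A where "A = {y \<in> {0..<int n}. int g dvd y - (y0 + (x - x0))}"
  define B where "B = {y \<in> {0..<int n}. int g dvd y - (y0 - (x - x0))}"
  have cA: "card A = b" and cB: "card B = b"
    unfolding A_def B_def n using card_residue pos by blast+
  have "A \<subseteq> {0..<int n}" "B \<subseteq> {0..<int n}" unfolding A_def B_def by auto
  then have fin: "finite A" "finite B" using finite_subset by blast+
  have y0A: "y0 \<in> A \<longleftrightarrow> int g dvd x - x0" and y0B: "y0 \<in> B \<longleftrightarrow> int g dvd x - x0"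
    using assms(1) dvd_minus_iff[of "int g" "x - x0"] by (auto simp: A_def B_def)
  have "(int g dvd (x0 - y0) - (x - y)) = (int g dvd y - (y0 + (x - x0)))" for y
    by (simp add: algebra_simps)
  moreover have "(int g dvd (x0 + y0) - (x + y)) = (int g dvd y - (y0 - (x - x0)))" for y
    using dvd_minus_iff[of "int g" "(x0 + y0) - (x + y)"] by (simp add: algebra_simps)
  ultimately have S: "{y \<in> {0..<int n}. adj (x0, y0) (x, y)} = insert y0 (A \<union> B)"
    using assms by (auto simp: adj_def A_def B_def)
  have AB: "card (A \<union> B) + b * of_bool (int g dvd 2 * (x - x0)) = 2 * b"
  proof (cases "int g dvd 2 * (x - x0)")
    case True
    have "int g dvd y - (y0 + (x - x0)) \<longleftrightarrow> int g dvd y - (y0 - (x - x0))" for y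
      using dvd_add_left_iff[OF True, of "y - (y0 + (x - x0))"] by (simp add: algebra_simps)
    then have "A = B" unfolding A_def B_def by simp
    then show ?thesis using True cA by simp
  next
    case False
    have "A \<inter> B = {}"
    proof (rule ccontr)
      assume "\<not> ?thesis"
      then obtain y where "int g dvd y - (y0 + (x - x0))" "int g dvd y - (y0 - (x - x0))"
        unfolding A_def B_def by auto
      then have "int g dvd (y - (y0 - (x - x0))) - (y - (y0 + (x - x0)))" by (rule dvd_diff[rotated])
      then show False using False by (simp add: algebra_simps)
    qed
    then show ?thesis using False cA cB fin by (simp add: card_Un_disjoint)
  qed
  show ?thesis using S AB y0A y0B fin by (auto simp: card_insert_if)
qed

lemma card_closed_neighborhood:
  assumes "(x0, y0) \<in> V"
  shows "card {q \<in> V. adj (x0, y0) q} + e * a * b + a + b = 2 * g * a * b + g * a + g * b"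
proof -
  define F where "F x = {y \<in> {0..<int n}. adj (x0, y0) (x, y)}" for x
  let ?X = "{0..<int m}"
  have x0: "x0 \<in> ?X" using assms by simp
  have S: "{q \<in> V. adj (x0, y0) q} = Sigma ?X F" by (auto simp: F_def)
  have finF: "finite (F x)" for x by (rule finite_subset[of _ "{0..<int n}"]) (auto simp: F_def)
  have cnt: "(\<Sum>x\<in>?X. of_bool (P x)) = card {x \<in> ?X. P x}" for P :: "int \<Rightarrow> bool"
    by (simp add: of_bool_def sum.If_cases Int_def)
  have "F x0 = {0..<int n}" by (auto simp: F_def adj_def)
  then have F0: "card (F x0) = n" by simp
  \<comment> \<open>The vertex's own column is full and has \<open>n\<close> instead of
    \<open>b\<close> further vertices; the last summand corrects for that.\<close>
  have F1: "card (F x) + b * of_bool (int g dvd 2 * (x - x0)) + of_bool (int g dvd x - x0)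
      = 2 * b + 1 + (n - b) * of_bool (x = x0)" for x
    using card_column[OF assms, of x] F0 pos n by (cases "x = x0") (auto simp: F_def)
  have "(\<Sum>x\<in>?X. card (F x)) + b * (\<Sum>x\<in>?X. of_bool (int g dvd 2 * (x - x0))) + (\<Sum>x\<in>?X. of_bool (int g dvd x - x0))
      = (\<Sum>x\<in>?X. 2 * b + 1 + (n - b) * of_bool (x = x0))"
    unfolding sum_distrib_left sum.distrib[symmetric] F1 ..
  also have "\<dots> = m * (2 * b + 1) + (n - b)"
  proof -
    have "(\<Sum>x\<in>?X. of_bool (x = x0) :: nat) = 1" using x0 by (simp add: of_bool_def)
    then show ?thesis unfolding sum.distrib sum_distrib_left[symmetric] by simp
  qed
  also have "(\<Sum>x\<in>?X. card (F x)) = card (Sigma ?X F)" using finF by (simp add: card_SigmaI)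
  finally have "card (Sigma ?X F) + b * card {x \<in> ?X. int g dvd 2 * (x - x0)} + card {x \<in> ?X. int g dvd x - x0}
      = m * (2 * b + 1) + (n - b)"
    unfolding cnt .
  moreover have "card {x \<in> ?X. int g dvd x - x0} = a" using card_residue[of g a x0] pos m by simp
  moreover have "b \<le> n" using n pos by simp
  ultimately have "card (Sigma ?X F) + b * (e * a) + a + b = m * (2 * b + 1) + n"
    unfolding card_double_residue by linarith
  then show ?thesis unfolding S using m n by (simp add: algebra_simps)
qed

definition d :: nat where "d = 2 * g * a * b + g * a + g * b - (e * a * b + a + b + 1)"

lemma card_neighbors: "p \<in> V \<Longrightarrow> card (neighbors V E p) = d"
proof -
  assume p: "p \<in> V"
  obtain x y where xy: "p = (x, y)" by (cases p)
  have "adj p p" by (simp add: adj_def xy)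
  then have "{q \<in> V. adj p q} = insert p (neighbors V E p)" using p neighbors_eq[OF p] by auto
  moreover have "finite (neighbors V E p)" "p \<notin> neighbors V E p" using finite_V by (auto simp: neighbors_def)
  ultimately have "card {q \<in> V. adj p q} = Suc (card (neighbors V E p))" by simp
  then show ?thesis using card_closed_neighborhood[of x y] p unfolding xy d_def by simp
qed

text \<open>Every neighbour lies on one of the four lines through \<open>p\<close>, and each line is
  a clique.\<close>

lemma claw_free:
  assumes p: "p \<in> V" and I: "I \<subseteq> neighbors V E p" "indep I E"
  shows "card I \<le> 4"
proof -
  have IV: "I \<subseteq> V" using I by (auto simp: neighbors_def)
  note inj = I(2)[unfolded indep_iff[OF IV]]
  have one: "finite {q \<in> I. f q = c} \<and> card {q \<in> I. f q = c} \<le> 1" if "inj_on f I" for f :: "int \<times> int \<Rightarrow> int" and c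
  proof -
    have "finite {q \<in> I. f q = c}" using finite_subset[OF IV finite_V] by simp
    then show ?thesis using that by (auto simp only: One_nat_def card_le_Suc0_iff_eq inj_on_def)
  qed
  let ?A = "{q \<in> I. fst q = fst p}" and ?B = "{q \<in> I. snd q = snd p}"
  let ?C = "{q \<in> I. (fst q - snd q) mod int g = (fst p - snd p) mod int g}"
  let ?D = "{q \<in> I. (fst q + snd q) mod int g = (fst p + snd p) mod int g}"
  have "I \<subseteq> (?A \<union> ?B) \<union> (?C \<union> ?D)"
  proof
    fix q assume q: "q \<in> I"
    then have "adj p q" using I neighbors_eq[OF p] by auto
    then have "adj q p" using adj_sym by simp
    then show "q \<in> (?A \<union> ?B) \<union> (?C \<union> ?D)" using q by (cases p; cases q) (simp add: adj_def mod_eq_dvd_iff)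
  qed
  moreover have "finite ((?A \<union> ?B) \<union> (?C \<union> ?D))" using one inj by simp
  ultimately have "card I \<le> card ((?A \<union> ?B) \<union> (?C \<union> ?D))" by (rule card_mono[rotated])
  also have "\<dots> \<le> (card ?A + card ?B) + (card ?C + card ?D)"
    by (meson add_mono card_Un_le order_trans)
  also have "\<dots> \<le> (1 + 1) + (1 + 1)"
    using one inj by (intro add_mono) blast+
  finally show ?thesis by simp
qed

section \<open>Common neighbours\<close>

lemma common_nb_eq:
  "\<lbrakk>p \<in> V; q \<in> V\<rbrakk> \<Longrightarrow> neighbors V E p \<inter> neighbors V E q = {z \<in> V. z \<noteq> p \<and> z \<noteq> q \<and> adj p z \<and> adj q z}"
  by (auto simp: neighbors_eq)

lemma finite_common_nb: "finite (neighbors V E p \<inter> neighbors V E q)"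
  using finite_V by (auto simp: neighbors_def)

definition row_diag :: "int \<Rightarrow> int \<Rightarrow> (int \<times> int) set" where
  "row_diag y c = (\<lambda>u. (u, y)) ` {u \<in> {0..<int m}. int g dvd u - (y + c)}"

definition col_diag :: "int \<Rightarrow> int \<Rightarrow> (int \<times> int) set" where
  "col_diag x c = (\<lambda>w. (x, w)) ` {w \<in> {0..<int n}. int g dvd w - (x - c)}"

lemma card_row_diag: "card (row_diag y c) = a" and card_col_diag: "card (col_diag x c) = b"
proof -
  have "card {u \<in> {0..<int m}. int g dvd u - (y + c)} = a" unfolding m using card_residue pos by blast
  moreover have "card {w \<in> {0..<int n}. int g dvd w - (x - c)} = b" unfolding n using card_residue pos by blast
  ultimately show "card (row_diag y c) = a" "card (col_diag x c) = b"
    unfolding row_diag_def col_diag_def by (simp_all add: card_image inj_on_def)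
qed

lemma finite_row_diag [simp]: "finite (row_diag y c)" and finite_col_diag [simp]: "finite (col_diag x c)"
  using card_row_diag[of y c] card_col_diag[of x c] pos by (auto intro: card_ge_0_finite)

lemma row_diag_iff: "(u, w) \<in> row_diag y c \<longleftrightarrow> 0 \<le> u \<and> u < int m \<and> w = y \<and> int g dvd (u - w) - c"
  by (auto simp: row_diag_def algebra_simps)

lemma col_diag_iff: "(u, w) \<in> col_diag x c \<longleftrightarrow> 0 \<le> w \<and> w < int n \<and> u = x \<and> int g dvd (u - w) - c"
  using dvd_minus_iff[of "int g" "w - (x - c)"] by (auto simp: col_diag_def algebra_simps)

lemma dvd_comm: "int g dvd u - v \<longleftrightarrow> int g dvd v - u"
  by (rule dvd_diff_commute)

lemma small_dvd: "\<lbrakk>int g dvd u - v; 0 \<le> u; 0 \<le> v; u < int g; v < int g\<rbrakk> \<Longrightarrow> u = v"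
  by (metis mod_eq_dvd_iff mod_pos_pos_trivial)

text \<open>The row and column of each vertex meet the difference diagonal of the other, in
  \<open>2 * a + 2 * b\<close> vertices altogether. For \<open>a = b = 1\<close> these are only
  four, and the corners \<open>(x', y)\<close> and \<open>(x, y')\<close> are added.\<close>

lemma common_nb_nonadjacent:
  assumes p: "p \<in> V" and q: "q \<in> V" and na: "\<not> adj p q"
  shows "5 \<le> card (neighbors V E p \<inter> neighbors V E q)"
proof -
  obtain x y x' y' where xy: "p = (x, y)" "q = (x', y')" by (cases p; cases q)
  have V: "0 \<le> x" "x < int m" "0 \<le> y" "y < int n" "0 \<le> x'" "x' < int m" "0 \<le> y'" "y' < int n"
    using p q unfolding xy by auto
  have ne: "x \<noteq> x'" "y \<noteq> y'" and nd: "\<not> int g dvd (x - y) - (x' - y')" "\<not> int g dvd (x' - y') - (x - y)"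
    using na dvd_comm by (auto simp: adj_def xy)
  let ?P1 = "row_diag y (x' - y')" and ?P2 = "col_diag x (x' - y')"
    and ?P3 = "row_diag y' (x - y)" and ?P4 = "col_diag x' (x - y)"
  let ?P = "?P1 \<union> ?P2 \<union> (?P3 \<union> ?P4)"
  have tr: False if "int g dvd u - (x - y)" "int g dvd u - (x' - y')" for u
  proof -
    have "int g dvd (u - (x' - y')) - (u - (x - y))" using that by (rule dvd_diff[rotated])
    moreover have "(u - (x' - y')) - (u - (x - y)) = (x - y) - (x' - y')" by simp
    ultimately show False using nd by metis
  qed
  have sub: "?P \<subseteq> neighbors V E p \<inter> neighbors V E q"
    unfolding common_nb_eq[OF p q] using V ne nd dvd_comm by (auto simp: row_diag_iff col_diag_iff adj_def xy)
  have "?P1 \<inter> ?P2 = {}" "?P3 \<inter> ?P4 = {}" using nd by (auto simp: row_diag_iff col_diag_iff algebra_simps)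
  moreover have "(?P1 \<union> ?P2) \<inter> (?P3 \<union> ?P4) = {}"
  proof -
    have "int g dvd (fst z - snd z) - (x' - y')" if "z \<in> ?P1 \<union> ?P2" for z
      using that by (cases z) (auto simp only: Un_iff row_diag_iff col_diag_iff fst_conv snd_conv)
    moreover have "int g dvd (fst z - snd z) - (x - y)" if "z \<in> ?P3 \<union> ?P4" for z
      using that by (cases z) (auto simp only: Un_iff row_diag_iff col_diag_iff fst_conv snd_conv)
    ultimately show ?thesis using tr by blast
  qed
  ultimately have cP: "card ?P = 2 * a + 2 * b"
    using card_row_diag card_col_diag by (simp add: card_Un_disjoint)
  show ?thesis
  proof (cases "a + b \<ge> 3")
    case True
    then show ?thesis using card_mono[OF finite_common_nb sub] cP by simp
  next
    case False
    then have ab: "a = 1" "b = 1" using pos by linarith+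
    then have gg: "m = g" "n = g" using m n by auto
    let ?Q = "{(x', y), (x, y')}"
    have "?Q \<subseteq> neighbors V E p \<inter> neighbors V E q"
      unfolding common_nb_eq[OF p q] using V ne by (auto simp: adj_def xy)
    moreover have "\<not> int g dvd x - x'" "\<not> int g dvd x' - x" "\<not> int g dvd y - y'" "\<not> int g dvd y' - y"
      using V[unfolded gg] small_dvd[of x x'] small_dvd[of x' x] small_dvd[of y y'] small_dvd[of y' y] ne by blast+
    then have "?P \<inter> ?Q = {}" by (auto simp: row_diag_iff col_diag_iff algebra_simps)
    then have "card (?P \<union> ?Q) = card ?P + 2" using ne by (subst card_Un_disjoint) auto
    ultimately show ?thesis using card_mono[OF finite_common_nb, of "?P \<union> ?Q" p q] sub cP ab by auto
  qed
qed

text \<open>The rest of the column is shared. It has at least \<open>2 * g - 2\<close> vertices if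
  \<open>b \<ge> 2\<close>; if \<open>b = 1\<close> it has \<open>g - 2\<close>, and each of the two
  rows meets the difference diagonal of the other vertex in \<open>a\<close> more, which gives the
  second term of the minimum.\<close>

lemma common_nb_column:
  assumes p: "(x, y) \<in> V" and q: "(x, y') \<in> V" and ne: "y \<noteq> y'"
  shows "min (2 * g - 2) (g + 2 * (a + b) - 4) \<le> card (neighbors V E (x, y) \<inter> neighbors V E (x, y'))"
proof -
  let ?N = "neighbors V E (x, y) \<inter> neighbors V E (x, y')"
  let ?C = "Pair x ` ({0..<int n} - {y, y'})"
  have sub: "?C \<subseteq> ?N" unfolding common_nb_eq[OF p q] using p by (auto simp: adj_def)
  have "card ({0..<int n} - {y, y'}) = n - 2" using p q ne by (subst card_Diff_subset) auto
  then have cC: "card ?C = n - 2" by (simp add: card_image inj_on_def)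
  show ?thesis
  proof (cases "b \<ge> 2")
    case True
    then have "2 * g \<le> n" using n by simp
    then show ?thesis using card_mono[OF finite_common_nb sub] cC by simp
  next
    case False
    then have b1: "b = 1" using pos by simp
    then have gn: "n = g" using n by simp
    let ?P = "row_diag y (x - y') \<union> row_diag y' (x - y)"
    have yy: "\<not> int g dvd y - y'" "\<not> int g dvd y' - y"
    proof -
      have "0 \<le> y \<and> y < int n" "0 \<le> y' \<and> y' < int n" using p q by simp_all
      then show "\<not> int g dvd y - y'" "\<not> int g dvd y' - y"
        unfolding gn using small_dvd[of y y'] small_dvd[of y' y] ne by blast+
    qed
    have "?P \<subseteq> ?N" unfolding common_nb_eq[OF p q]
      using p q ne yy dvd_comm by (auto simp: row_diag_iff adj_def)
    moreover have "?P \<inter> ?C = {}" using yy by (auto simp: row_diag_iff)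
    moreover have "card ?P = 2 * a" using card_row_diag ne by (subst card_Un_disjoint) (auto simp: row_diag_iff)
    ultimately have "g - 2 + 2 * a \<le> card ?N"
      using card_mono[OF finite_common_nb, of "?P \<union> ?C" "(x, y)" "(x, y')"] sub cC gn
      by (simp add: card_Un_disjoint)
    then show ?thesis using b1 by simp
  qed
qed

lemma common_nb_row:
  assumes p: "(x, y) \<in> V" and q: "(x', y) \<in> V" and ne: "x \<noteq> x'"
  shows "min (2 * g - 2) (g + 2 * (a + b) - 4) \<le> card (neighbors V E (x, y) \<inter> neighbors V E (x', y))"
proof -
  let ?N = "neighbors V E (x, y) \<inter> neighbors V E (x', y)"
  let ?C = "(\<lambda>u. (u, y)) ` ({0..<int m} - {x, x'})"
  have sub: "?C \<subseteq> ?N" unfolding common_nb_eq[OF p q] using p by (auto simp: adj_def)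
  have "card ({0..<int m} - {x, x'}) = m - 2" using p q ne by (subst card_Diff_subset) auto
  then have cC: "card ?C = m - 2" by (simp add: card_image inj_on_def)
  show ?thesis
  proof (cases "a \<ge> 2")
    case True
    then have "2 * g \<le> m" using m by simp
    then show ?thesis using card_mono[OF finite_common_nb sub] cC by simp
  next
    case False
    then have a1: "a = 1" using pos by simp
    then have gm: "m = g" using m by simp
    let ?P = "col_diag x (x' - y) \<union> col_diag x' (x - y)"
    have xx: "\<not> int g dvd x - x'" "\<not> int g dvd x' - x"
    proof -
      have "0 \<le> x \<and> x < int m" "0 \<le> x' \<and> x' < int m" using p q by simp_all
      then show "\<not> int g dvd x - x'" "\<not> int g dvd x' - x"
        unfolding gm using small_dvd[of x x'] small_dvd[of x' x] ne by blast+
    qed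
    have "?P \<subseteq> ?N" unfolding common_nb_eq[OF p q]
      using p q ne xx dvd_comm by (auto simp: col_diag_iff adj_def)
    moreover have "?P \<inter> ?C = {}" using xx by (auto simp: col_diag_iff)
    moreover have "card ?P = 2 * b" using card_col_diag ne by (subst card_Un_disjoint) (auto simp: col_diag_iff)
    ultimately have "g - 2 + 2 * b \<le> card ?N"
      using card_mono[OF finite_common_nb, of "?P \<union> ?C" "(x, y)" "(x', y)"] sub cC gm
      by (simp add: card_Un_disjoint)
    then show ?thesis using a1 by simp
  qed
qed

text \<open>The shared diagonal has \<open>m * b = g * a * b\<close> vertices, at least
  \<open>2 * g\<close> unless \<open>a = b = 1\<close>; in that case the two corners make up for the
  two vertices themselves. The sign \<open>s\<close> covers both diagonal directions.\<close>

lemma common_nb_diagonal: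
  assumes p: "(x, y) \<in> V" and q: "(x', y') \<in> V" and ne: "x \<noteq> x'" "y \<noteq> y'" and s: "s = 1 \<or> s = -1"
    and diag: "int g dvd (x + s * y) - (x' + s * y')"
  shows "min (2 * g - 2) (g + 2 * (a + b) - 4) \<le> card (neighbors V E (x, y) \<inter> neighbors V E (x', y'))"
proof -
  let ?N = "neighbors V E (x, y) \<inter> neighbors V E (x', y')"
  define D where "D = {(u, w). (u, w) \<in> V \<and> int g dvd (u + s * w) - (x + s * y)}"
  have D: "D = Sigma {0..<int m} (\<lambda>u. {w \<in> {0..<int n}. int g dvd w - s * (x + s * y - u)})"
  proof -
    have "int g dvd (u + s * w) - (x + s * y) \<longleftrightarrow> int g dvd w - s * (x + s * y - u)" for u w
      using s dvd_minus_iff[of "int g" "(u - w) - (x - y)"] by (elim disjE) (simp_all add: algebra_simps)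
    then show ?thesis by (auto simp: D_def)
  qed
  have fin: "finite {w \<in> {0..<int n}. int g dvd w - c}" for c
    by (rule finite_subset[of _ "{0..<int n}"]) auto
  moreover have "card {w \<in> {0..<int n}. int g dvd w - c} = b" for c
    unfolding n using card_residue pos by blast
  ultimately have "card D = (\<Sum>u\<in>{0..<int m}. b)" unfolding D by (subst card_SigmaI) simp_all
  then have cD: "card D = m * b" by simp
  have finD: "finite D" unfolding D using fin by (intro finite_SigmaI) simp_all
  have tr: "int g dvd (u + s * w) - (x' + s * y')" if "int g dvd (u + s * w) - (x + s * y)" for u w
  proof -
    have "((u + s * w) - (x + s * y)) + ((x + s * y) - (x' + s * y')) = (u + s * w) - (x' + s * y')" by simp
    then show ?thesis using dvd_add[OF that diag] by metis
  qed
  have pq: "(x, y) \<in> D" "(x', y') \<in> D" using p q diag dvd_comm by (auto simp: D_def)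
  have sub: "D - {(x, y), (x', y')} \<subseteq> ?N"
    unfolding common_nb_eq[OF p q] using s tr dvd_comm by (auto simp: D_def adj_def)
  have cD2: "card (D - {(x, y), (x', y')}) = m * b - 2"
    using finD pq ne cD by (subst card_Diff_subset) auto
  show ?thesis
  proof (cases "a = 1 \<and> b = 1")
    case True
    then have gg: "m = g" "n = g" using m n by auto
    let ?Q = "{(x', y), (x, y')}"
    have Q: "?Q \<subseteq> ?N" unfolding common_nb_eq[OF p q] using p q ne by (auto simp: adj_def)
    have "\<not> int g dvd x' - x" "\<not> int g dvd y' - y"
    proof -
      have "0 \<le> x \<and> x < int m \<and> 0 \<le> y \<and> y < int n" "0 \<le> x' \<and> x' < int m \<and> 0 \<le> y' \<and> y' < int n"
        using p q by simp_all
      then show "\<not> int g dvd x' - x" "\<not> int g dvd y' - y"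
        unfolding gg using small_dvd[of x' x] small_dvd[of y' y] ne by blast+
    qed
    then have "D \<inter> ?Q = {}" using s dvd_minus_iff[of "int g" "y' - y"] by (auto simp: D_def)
    then have "card (D - {(x, y), (x', y')} \<union> ?Q) = g - 2 + 2"
      using cD2 True gg finD ne by (subst card_Un_disjoint) auto
    then show ?thesis using card_mono[OF finite_common_nb, of "D - {(x, y), (x', y')} \<union> ?Q" "(x, y)" "(x', y')"] sub Q True
      by simp
  next
    case False
    have "2 \<le> a * b"
    proof (rule ccontr)
      assume "\<not> 2 \<le> a * b"
      then have "a * b = 1" using pos by (metis One_nat_def Suc_1 less_2_cases nat_0_less_mult_iff not_le neq0_conv)
      then show False using False by simp
    qed
    then have "2 * g \<le> m * b" unfolding m using mult_le_mono2[of 2 "a * b" g] by (simp add: mult.assoc mult.commute)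
    then show ?thesis using card_mono[OF finite_common_nb sub] cD2 by simp
  qed
qed

lemma common_nb_adjacent:
  assumes p: "p \<in> V" and q: "q \<in> neighbors V E p" and g4: "g \<ge> 4" "g \<ge> 5 \<or> a + b \<ge> 3"
  shows "g div 2 + 3 \<le> card (neighbors V E p \<inter> neighbors V E q)"
proof -
  obtain x y x' y' where xy: "p = (x, y)" "q = (x', y')" by (cases p; cases q)
  have V: "(x, y) \<in> V" "(x', y') \<in> V" and ne: "x \<noteq> x' \<or> y \<noteq> y'" and adj: "adj (x, y) (x', y')"
    using p q neighbors_eq[OF p] by (auto simp: xy)
  have "min (2 * g - 2) (g + 2 * (a + b) - 4) \<le> card (neighbors V E (x, y) \<inter> neighbors V E (x', y'))"
    using common_nb_column[of x y y'] common_nb_row[of x y x'] V ne adj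
      common_nb_diagonal[OF V, of 1] common_nb_diagonal[OF V, of "-1"]
    by (cases "x = x'"; cases "y = y'") (auto simp: adj_def)
  moreover have "g div 2 + 3 \<le> min (2 * g - 2) (g + 2 * (a + b) - 4)" using g4 pos by (simp add: min_def) linarith
  ultimately show ?thesis unfolding xy by linarith
qed

text \<open>On the 4 by 4 board only four common neighbours of adjacent vertices are guaranteed,
  while \<open>K = 2\<close> would ask for five. With \<open>K = 1\<close> the condition on common
  neighbours is void.\<close>

definition K :: nat where "K = (if g < 4 \<or> g = 4 \<and> a + b < 3 then 1 else g div 2)"

lemma d_eq: "d + (e * a * b + a + b + 1) = 2 * g * a * b + g * a + g * b"
proof -
  have "adj (0, 0) (0, 0)" "(0, 0) \<in> V" using m2 n2 by (auto simp: adj_def)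
  then have "{q \<in> V. adj (0, 0) q} \<noteq> {}" by blast
  then have "card {q \<in> V. adj (0, 0) q} \<ge> 1" using finite_V by (simp add: Suc_le_eq card_gt_0_iff)
  then show ?thesis using card_closed_neighborhood[of 0 0] m2 n2 unfolding d_def by simp
qed

lemma degree_bound:
  "K < d \<and> m * n \<le> (K + 1) * (d - K) \<and> (m * n \<le> 2 * (d - K) \<or> 2 \<le> K \<and> 5 * K \<le> d + 5)"
  by (rule degree_bound_arith[OF pos m n m2 n2 e_def K_def d_eq])

sublocale expanding_graph V E K
proof
  show "finite V" by (rule finite_V)
  show "V \<noteq> {}" using card_V m2 n2 by auto
  then interpret fin_graph V E using finite_V by unfold_locales
  have small: "3 * K < m * n"
  proof (cases "K = 1")
    case True
    then show ?thesis using mult_le_mono[OF m2 n2] by simp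
  next
    case False
    then have K: "2 * K \<le> g" "g \<ge> 4" by (auto simp: K_def split: if_splits)
    have "4 * g \<le> g * g" using K(2) by simp
    also have "\<dots> \<le> m * n" unfolding m n using pos by (intro mult_le_mono) auto
    finally show ?thesis using K by linarith
  qed
  show "3 * K < card V" using small card_V by simp
  show "K \<ge> 1" using pos by (auto simp: K_def)
  have *: "K \<ge> 2 \<Longrightarrow> K = g div 2 \<and> g \<ge> 4 \<and> (g \<ge> 5 \<or> a + b \<ge> 3)"
    by (auto simp: K_def split: if_splits)
  show common: "K + 3 \<le> card (neighbors V E v \<inter> neighbors V E w)"
    if "K \<ge> 2" "v \<in> V" "w \<in> neighbors V E v" for v w
    using common_nb_adjacent[OF that(2,3)] *[OF that(1)] by simp
  show "K < card (neighbors V E v)" if "v \<in> V" for v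
    using degree_bound card_neighbors[OF that] by simp
  show "card I \<le> 4" if "v \<in> V" "I \<subseteq> neighbors V E v" "indep I E" for v I
    using claw_free that by blast
  have five: "5 \<le> card (neighbors V E u \<inter> neighbors V E w)" if "K \<ge> 2" "u \<in> V" "w \<in> V" "u \<noteq> w" for u w
  proof (cases "adj u w")
    case True
    then show ?thesis using common[of u w] that neighbors_eq[of u] by auto
  qed (use common_nb_nonadjacent that in auto)
  show "card V \<le> (\<Sum>u\<in>U. card (neighbors V E u - U))"
    if "U \<subseteq> V" "K < card U" "card U + K < card V" for U
  proof (rule boundary_regular[OF card_neighbors _ _ _ that])
    show "K \<le> d" "card V \<le> (K + 1) * (d - K)" using degree_bound card_V by auto
    show "card V \<le> 2 * (d - K) \<or> 5 * K \<le> d + 5 \<and>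
      (\<forall>u\<in>V. \<forall>w\<in>V. u \<noteq> w \<longrightarrow> 5 \<le> card (nb u \<inter> nb w))"
      using degree_bound five card_V by auto
  qed
qed

end

subsection \<open>Configurations of queens\<close>

text \<open>
  A block \<open>(s, e, x\<^sub>0, y\<^sub>0)\<close> stands for the arithmetic progression of the points
  \<open>(r * u + x\<^sub>0, a * u + y\<^sub>0)\<close> with \<open>s \<le> u < e\<close>. A linear form takes the values \<open>\<alpha> * u + c\<close> on it,
  and two values on blocks with constants \<open>c\<close> and \<open>c'\<close> agree modulo \<open>n\<close> only if the parameters differ by
  some \<open>t\<close> with \<open>\<alpha> * t = z * n + c - c'\<close>.
\<close>

type_synonym block = "int \<times> int \<times> int \<times> int"

definition points :: "int \<Rightarrow> int \<Rightarrow> block \<Rightarrow> (int \<times> int) set" where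
  "points r a = (\<lambda>(s, e, x0, y0). (\<lambda>u. (r * u + x0, a * u + y0)) ` {s..<e})"

text \<open>Two values in one window of length \<open>5 * n\<close> that agree modulo
  \<open>n\<close> differ by one of these multiples of \<open>n\<close>. For a fixed multiple every
  separation condition is linear in the parameters.\<close>

definition shifts :: "int set" where
  "shifts = {-4, -3, -2, -1, 0, 1, 2, 3, 4}"

text \<open>The first interval, moved by \<open>t\<close>, must miss the second. The last two
  alternatives admit empty blocks, which occur for small parameters. Quantifying over
  \<open>t\<close> avoids a division by \<open>\<alpha>\<close>.\<close>

definition apart :: "int \<Rightarrow> int \<Rightarrow> int \<times> int \<times> int \<Rightarrow> int \<times> int \<times> int \<Rightarrow> bool" where
  "apart \<alpha> n = (\<lambda>(s, e, c) (s', e', c'). \<forall>z\<in>shifts. \<forall>t. \<alpha> * t = z * n + c - c' \<longrightarrow>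
     e + t \<le> s' \<or> e' \<le> s + t \<or> e \<le> s \<or> e' \<le> s')"

definition self_apart :: "int \<Rightarrow> int \<Rightarrow> int \<times> int \<times> int \<Rightarrow> bool" where
  "self_apart \<alpha> n = (\<lambda>(s, e, c). \<forall>z\<in>shifts. \<forall>t. \<alpha> * t = z * n \<longrightarrow> t = 0 \<or> e + t \<le> s \<or> e \<le> s + t)"

definition in_window :: "int \<Rightarrow> int \<Rightarrow> int \<Rightarrow> int \<times> int \<times> int \<Rightarrow> bool" where
  "in_window \<alpha> n L = (\<lambda>(s, e, c). L \<le> \<alpha> * s + c \<and> \<alpha> * (e - 1) + c < L + 5 * n)"

fun separated :: "int \<Rightarrow> int \<Rightarrow> int \<Rightarrow> (int \<times> int \<times> int) list \<Rightarrow> bool" where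
  "separated \<alpha> n L [] \<longleftrightarrow> True"
| "separated \<alpha> n L (b # bs) \<longleftrightarrow> in_window \<alpha> n L b \<and> self_apart \<alpha> n b \<and> list_all (apart \<alpha> n b) bs \<and> separated \<alpha> n L bs"

lemma separated_in_window: "separated \<alpha> n L bs \<Longrightarrow> b \<in> set bs \<Longrightarrow> in_window \<alpha> n L b"
  by (induction bs) auto

lemma in_window_mono:
  assumes "in_window \<alpha> n L (s, e, c)" "\<alpha> \<ge> 0" "s \<le> u" "u < e"
  shows "L \<le> \<alpha> * u + c" "\<alpha> * u + c < L + 5 * n"
  using assms mult_left_mono[of s u \<alpha>] mult_left_mono[of u "e - 1" \<alpha>] by (auto simp: in_window_def)

lemma cong_shift:
  fixes A B n L :: int
  assumes "A mod n = B mod n" "L \<le> A" "A < L + 5 * n" "L \<le> B" "B < L + 5 * n" "n > 0"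
  obtains z where "z \<in> shifts" "B - A = z * n"
proof -
  have "n dvd B - A" using assms(1) by (metis mod_eq_dvd_iff)
  then obtain z where z: "B - A = z * n" by (metis dvdE mult.commute)
  have "z * n < 5 * n" "(-5) * n < z * n" using assms z by linarith+
  then have "z < 5" "-5 < z" using assms(6) by (simp_all only: mult_less_cancel_right)
  then have "z \<in> shifts" by (auto simp: shifts_def)
  then show ?thesis using that z by blast
qed

lemma separated_inj:
  fixes G :: "int \<times> int \<Rightarrow> int"
  assumes G: "\<And>u x0 y0. G (r * u + x0, a * u + y0) = \<alpha> * u + \<gamma> x0 y0" and n: "n > 0" and \<alpha>: "\<alpha> \<ge> 0"
    and sep: "separated \<alpha> n L (map (\<lambda>(s, e, x0, y0). (s, e, \<gamma> x0 y0)) bs)"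
  shows "inj_on (\<lambda>p. G p mod n) (\<Union>b\<in>set bs. points r a b)"
  using sep
proof (induction bs)
  case (Cons b bs)
  obtain s e x0 y0 where b: "b = (s, e, x0, y0)" by (cases b)
  let ?f = "\<lambda>p. G p mod n"
  have w: "in_window \<alpha> n L (s, e, \<gamma> x0 y0)" using Cons.prems by (simp add: b)
  have "inj_on ?f (points r a b)"
  proof (rule inj_onI)
    fix p q assume p: "p \<in> points r a b" and q: "q \<in> points r a b" and eq: "?f p = ?f q"
    obtain u where u: "s \<le> u" "u < e" "p = (r * u + x0, a * u + y0)" using p by (auto simp: points_def b)
    obtain v where v: "s \<le> v" "v < e" "q = (r * v + x0, a * v + y0)" using q by (auto simp: points_def b)
    have "(\<alpha> * u + \<gamma> x0 y0) mod n = (\<alpha> * v + \<gamma> x0 y0) mod n" using eq u v G by simp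
    then obtain z where z: "z \<in> shifts" "(\<alpha> * v + \<gamma> x0 y0) - (\<alpha> * u + \<gamma> x0 y0) = z * n"
      using cong_shift in_window_mono[OF w \<alpha>] u v n by metis
    then have "\<alpha> * (v - u) = z * n" by (simp add: algebra_simps)
    moreover have "self_apart \<alpha> n (s, e, \<gamma> x0 y0)" using Cons.prems by (simp add: b)
    ultimately have "v - u = 0 \<or> e + (v - u) \<le> s \<or> e \<le> s + (v - u)"
      using z(1) unfolding self_apart_def by blast
    then have "u = v" using u v by linarith
    then show "p = q" using u v by simp
  qed
  moreover have "inj_on ?f (\<Union>b\<in>set bs. points r a b)" using Cons by simp
  moreover have "?f p \<noteq> ?f q" if p: "p \<in> points r a b" and q: "q \<in> (\<Union>b\<in>set bs. points r a b)" for p q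
  proof
    assume eq: "?f p = ?f q"
    obtain b' where b'bs: "b' \<in> set bs" "q \<in> points r a b'" using q by auto
    obtain s' e' x0' y0' where b': "b' = (s', e', x0', y0')" by (cases b')
    obtain u where u: "s \<le> u" "u < e" "p = (r * u + x0, a * u + y0)" using p by (auto simp: points_def b)
    obtain v where v: "s' \<le> v" "v < e'" "q = (r * v + x0', a * v + y0')" using b'bs(2) by (auto simp: points_def b')
    have mem: "(s', e', \<gamma> x0' y0') \<in> set (map (\<lambda>(s, e, x0, y0). (s, e, \<gamma> x0 y0)) bs)"
      using b'bs(1) unfolding b' by force
    have w': "in_window \<alpha> n L (s', e', \<gamma> x0' y0')"
      using Cons.prems separated_in_window[OF _ mem] by simp
    have "(\<alpha> * u + \<gamma> x0 y0) mod n = (\<alpha> * v + \<gamma> x0' y0') mod n" using eq u v G by simp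
    then obtain z where z: "z \<in> shifts" "(\<alpha> * v + \<gamma> x0' y0') - (\<alpha> * u + \<gamma> x0 y0) = z * n"
      using cong_shift in_window_mono[OF w \<alpha>] in_window_mono[OF w' \<alpha>] u v n by metis
    then have "\<alpha> * (v - u) = z * n + \<gamma> x0 y0 - \<gamma> x0' y0'" by (simp add: algebra_simps)
    moreover have "apart \<alpha> n (s, e, \<gamma> x0 y0) (s', e', \<gamma> x0' y0')"
      using Cons.prems mem unfolding b list.map separated.simps prod.case list_all_iff by blast
    ultimately have "e + (v - u) \<le> s' \<or> e' \<le> s + (v - u) \<or> e \<le> s \<or> e' \<le> s'"
      using z(1) unfolding apart_def by blast
    then show False using u v by linarith
  qed
  ultimately show ?case by (auto simp: inj_on_Un) (metis)+
qed simp

lemma card_union_points: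
  assumes r: "r > 0" and n: "n > 0" and sep: "separated r n L (map (\<lambda>(s, e, x0, y0). (s, e, x0)) bs)"
    and pos: "\<And>s e x0 y0. (s, e, x0, y0) \<in> set bs \<Longrightarrow> s \<le> e"
  shows "int (card (\<Union>b\<in>set bs. points r a b)) = (\<Sum>(s, e, x0, y0)\<leftarrow>bs. e - s)"
  using sep pos
proof (induction bs)
  case (Cons b bs)
  obtain s e x0 y0 where b: "b = (s, e, x0, y0)" by (cases b)
  have inj: "inj_on (\<lambda>p. fst p mod n) (\<Union>b\<in>set (b # bs). points r a b)"
    by (rule separated_inj[where \<alpha> = r and \<gamma> = "\<lambda>x0 y0. x0" and L = L]) (use r n Cons.prems(1) in auto)
  have "points r a b \<inter> (\<Union>b\<in>set bs. points r a b) = {}"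
  proof (rule ccontr)
    assume "\<not> ?thesis"
    then obtain u s' e' x0' y0' v where "(s', e', x0', y0') \<in> set bs" "s \<le> u" "u < e" "s' \<le> v" "v < e'"
      "r * u + x0 = r * v + x0'"
      by (auto simp: points_def b)
    moreover have "apart r n (s, e, x0) (s', e', x0')"
      using Cons.prems(1) calculation(1) by (force simp: b list_all_iff)
    \<comment> \<open>The shift \<open>z = 0\<close> suffices, since a common point has equal and
      not merely congruent first coordinates.\<close>
    then have "r * (v - u) = 0 * n + x0 - x0' \<longrightarrow> e + (v - u) \<le> s' \<or> e' \<le> s + (v - u) \<or> e \<le> s \<or> e' \<le> s'"
      unfolding apart_def by (auto simp: shifts_def)
    ultimately show False by (auto simp: algebra_simps)
  qed
  moreover have "finite (points r a b')" for b' by (cases b') (simp add: points_def)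
  moreover have "card (points r a b) = nat (e - s)"
    using r by (simp add: b points_def card_image inj_on_def)
  moreover have "s \<le> e" using Cons.prems(2)[of s e x0 y0] by (simp add: b)
  moreover have "int (card (\<Union>b\<in>set bs. points r a b)) = (\<Sum>(s, e, x0, y0)\<leftarrow>bs. e - s)"
  proof (rule Cons.IH)
    show "separated r n L (map (\<lambda>(s, e, x0, y0). (s, e, x0)) bs)" using Cons.prems(1) by simp
    show "s \<le> e" if "(s, e, x0, y0) \<in> set bs" for s e x0 y0 using Cons.prems(2)[of s e x0 y0] that by simp
  qed
  ultimately show ?case by (simp add: card_Un_disjoint b case_prod_unfold)
qed simp

section \<open>Placements on square boards\<close>

definition queens :: "int \<Rightarrow> (int \<times> int) set \<Rightarrow> bool" where
  "queens n Q \<longleftrightarrow> inj_on (\<lambda>p. fst p mod n) Q \<and> inj_on (\<lambda>p. snd p mod n) Q \<and>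
     inj_on (\<lambda>p. (fst p - snd p) mod n) Q \<and> inj_on (\<lambda>p. (fst p + snd p) mod n) Q"

lemma inj_on_mod_uminus: "inj_on (\<lambda>p. f p mod (n::int)) Q \<Longrightarrow> inj_on (\<lambda>p. (- f p) mod n) Q"
  unfolding inj_on_def by (metis mod_minus_cong minus_minus)

text \<open>Differences are taken as y - x, so that their coefficient \<open>a - r\<close> is
  nonnegative and values increase along a block; negation restores x - y.\<close>

lemma queensI:
  assumes n: "n > 0" and r: "0 < r" "r \<le> a"
    and X: "separated r n Lx (map (\<lambda>(s, e, x0, y0). (s, e, x0)) bs)"
    and Y: "separated a n Ly (map (\<lambda>(s, e, x0, y0). (s, e, y0)) bs)"
    and S: "separated (r + a) n Ls (map (\<lambda>(s, e, x0, y0). (s, e, x0 + y0)) bs)"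
    and D: "separated (a - r) n Ld (map (\<lambda>(s, e, x0, y0). (s, e, y0 - x0)) bs)"
    and pos: "\<And>s e x0 y0. (s, e, x0, y0) \<in> set bs \<Longrightarrow> s \<le> e"
    and sz: "(\<Sum>(s, e, x0, y0)\<leftarrow>bs. e - s) = N"
  shows "\<exists>Q. queens n Q \<and> int (card Q) = N"
proof -
  let ?Q = "\<Union>b\<in>set bs. points r a b"
  have "inj_on (\<lambda>p. fst p mod n) ?Q"
    by (rule separated_inj[where \<alpha> = r and \<gamma> = "\<lambda>x0 y0. x0" and L = Lx]) (use n r X in auto)
  moreover have "inj_on (\<lambda>p. snd p mod n) ?Q"
    by (rule separated_inj[where \<alpha> = a and \<gamma> = "\<lambda>x0 y0. y0" and L = Ly]) (use n r Y in auto)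
  moreover have "inj_on (\<lambda>p. (fst p + snd p) mod n) ?Q"
    by (rule separated_inj[where \<alpha> = "r + a" and \<gamma> = "\<lambda>x0 y0. x0 + y0" and L = Ls]) (use n r S in \<open>auto simp: algebra_simps\<close>)
  moreover have "inj_on (\<lambda>p. (snd p - fst p) mod n) ?Q"
    by (rule separated_inj[where \<alpha> = "a - r" and \<gamma> = "\<lambda>x0 y0. y0 - x0" and L = Ld]) (use n r D in \<open>auto simp: algebra_simps\<close>)
  from inj_on_mod_uminus[OF this] have "inj_on (\<lambda>p. (fst p - snd p) mod n) ?Q" by simp
  moreover have "int (card ?Q) = N" using card_union_points[OF r(1) n X pos] sz by simp
  ultimately show ?thesis unfolding queens_def by blast
qed

lemmas separated_unfold = separated.simps list.map in_window_def self_apart_def apart_def shifts_def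
  prod.case ball_simps list.pred_inject

text \<open>
  The block lists below were found by computer search. For \<open>6 dvd n\<close> the last three blocks are single
  queens; long progressions alone do not reach \<open>n - 2\<close>.
\<close>

lemma queens_mod_6_3:
  fixes p :: int
  assumes "p \<ge> 1"
  shows "\<exists>Q. queens (6 * p + 3) Q \<and> int (card Q) = 6 * p + 1"
proof (rule queensI[where r = 1 and a = 2 and Lx = 0 and Ly = "0" and Ls = "0" and Ld = "0" and
    bs = "[(0, 2*p+1, 0, 0),
      (2*p+1, 3*p+1, 0, 1),
      (3*p+1, 5*p+2, 0, 2),
      (5*p+3, 6*p+2, 0, 1)]"])
qed (use assms in \<open>(simp add: separated_unfold; (intro conjI allI impI)?; presburger)+\<close>)

text \<open>On the line y = 2x the four forms are the multiples 1, 2, 3 and -1 of the parameter, all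
  invertible modulo a number prime to 6.\<close>

lemma queens_mod_6_1:
  fixes q :: int
  assumes "q \<ge> 0"
  shows "\<exists>Q. queens (6 * q + 1) Q \<and> int (card Q) = 6 * q + 1"
proof (rule queensI[where r = 1 and a = 2 and Lx = 0 and Ly = "0" and Ls = "0" and Ld = "0" and
    bs = "[(0, 6*q+1, 0, 0)]"])
qed (use assms in \<open>(simp add: separated_unfold; (intro conjI allI impI)?; presburger)+\<close>)

lemma queens_mod_6_5:
  fixes q :: int
  assumes "q \<ge> 0"
  shows "\<exists>Q. queens (6 * q + 5) Q \<and> int (card Q) = 6 * q + 5"
proof (rule queensI[where r = 1 and a = 2 and Lx = 0 and Ly = "0" and Ls = "0" and Ld = "0" and
    bs = "[(0, 6*q+5, 0, 0)]"])
qed (use assms in \<open>(simp add: separated_unfold; (intro conjI allI impI)?; presburger)+\<close>)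

lemma queens_6:
  shows "\<exists>Q. queens 6 Q \<and> int (card Q) = 4"
proof (rule queensI[where r = 1 and a = 2 and Lx = 0 and Ly = "0" and Ls = "0" and Ld = "0" and
    bs = "[(0, 2, 0, 0),
      (3, 5, 0, 1)]"])
qed ((simp add: separated_unfold; (intro conjI allI impI)?; presburger)+)

text \<open>Slope 3, because \<open>n\<close> is prime to 3 and rows do not repeat along y = 3x. The
  sums 4u and differences 2u repeat with periods n/4 and n/2, which the gaps and shifts between the
  blocks have to compensate.\<close>

lemma queens_mod_12_4:
  fixes j :: int
  assumes "j \<ge> 0"
  shows "\<exists>Q. queens (12 * j + 4) Q \<and> int (card Q) = 12 * j + 2"
proof (rule queensI[where r = 1 and a = 3 and Lx = 0 and Ly = "- 2" and Ls = "- 2" and Ld = "- 2" and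
    bs = "[(0, 3*j+1, 0, 0),
      (3*j+1, 4*j+1, 0, 1),
      (4*j+2, 7*j+3, 0, - 1),
      (7*j+3, 9*j+3, 0, 1),
      (9*j+4, 12*j+4, 0, - 2)]"])
qed (use assms in \<open>(simp add: separated_unfold; (intro conjI allI impI)?; presburger)+\<close>)

lemma queens_mod_12_8:
  fixes j :: int
  assumes "j \<ge> 0"
  shows "\<exists>Q. queens (12 * j + 8) Q \<and> int (card Q) = 12 * j + 6"
proof (rule queensI[where r = 1 and a = 3 and Lx = 0 and Ly = "- 2" and Ls = "- 2" and Ld = "- 2" and
    bs = "[(0, 3*j+2, 0, 0),
      (3*j+3, 6*j+5, 0, - 2),
      (6*j+5, 8*j+5, 0, 1),
      (8*j+6, 11*j+8, 0, - 1),
      (11*j+8, 12*j+8, 0, 1)]"])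
qed (use assms in \<open>(simp add: separated_unfold; (intro conjI allI impI)?; presburger)+\<close>)

lemma queens_mod_12_0:
  fixes k :: int
  assumes "k \<ge> 1"
  shows "\<exists>Q. queens (12 * k) Q \<and> int (card Q) = 12 * k - 2"
proof (rule queensI[where r = 1 and a = 2 and Lx = 0 and Ly = "- 12*k" and Ls = "- 12*k" and Ld = "- 12*k" and
    bs = "[(0, 3*k-1, 0, 0),
      (3*k, 4*k-1, 0, 0),
      (4*k-1, 6*k-2, 0, 1),
      (6*k, 9*k-1, 0, - 1),
      (9*k, 10*k-1, 0, - 1),
      (10*k, 12*k, 0, - 2),
      (3*k-1, 3*k, 0, 6*k-1),
      (6*k-1, 6*k, 0, - 6*k),
      (9*k-1, 9*k, 0, - 6*k)]"])
qed (use assms in \<open>(simp add: separated_unfold; (intro conjI allI impI)?; presburger)+\<close>)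

lemma queens_mod_12_6:
  fixes k :: int
  assumes "k \<ge> 1"
  shows "\<exists>Q. queens (12 * k + 6) Q \<and> int (card Q) = 12 * k + 4"
proof (rule queensI[where r = 1 and a = 2 and Lx = 0 and Ly = "- 12*k-6" and Ls = "- 12*k-6" and Ld = "- 12*k-6" and
    bs = "[(0, 3*k+1, 0, 0),
      (3*k+2, 4*k+1, 0, 0),
      (4*k+1, 6*k+2, 0, 1),
      (6*k+4, 9*k+4, 0, - 1),
      (9*k+5, 10*k+4, 0, - 1),
      (10*k+5, 12*k+6, 0, - 2),
      (3*k+1, 3*k+2, 0, 6*k+2),
      (6*k+2, 6*k+3, 0, - 6*k - 3),
      (9*k+4, 9*k+5, 0, - 6*k - 3)]"])
qed (use assms in \<open>(simp add: separated_unfold; (intro conjI allI impI)?; presburger)+\<close>)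

text \<open>
  For \<open>n = 2 * p\<close> with \<open>p\<close> odd, view coordinates as pairs of a parity and a residue modulo \<open>p\<close>. In each of
  the four parity classes the queens lie on \<open>y = 2 * x\<close> or \<open>y = 2 * x + 1\<close> modulo \<open>p\<close>, and \<open>x\<close> runs through
  the first or the second half of the residues.
\<close>

lemma queens_mod_24_2:
  fixes l :: int
  assumes "l \<ge> 0"
  shows "\<exists>Q. queens (24 * l + 2) Q \<and> int (card Q) = 24 * l + 1"
proof (rule queensI[where r = 2 and a = 4 and Lx = 0 and Ly = "0" and Ls = "0" and Ld = "0" and
    bs = "[(0, 3*l, 0, 0),
      (3*l, 6*l, 0, 1),
      (6*l+1, 9*l+1, 0, 0),
      (9*l+1, 12*l+1, 0, 1),
      (0, 3*l, 1, 12*l+4),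
      (3*l, 6*l, 1, 12*l+3),
      (6*l, 9*l, 1, 12*l+4),
      (9*l, 12*l+1, 1, 12*l+3)]"])
qed (use assms in \<open>(simp add: separated_unfold; (intro conjI allI impI)?; presburger)+\<close>)

lemma queens_mod_24_10:
  fixes l :: int
  assumes "l \<ge> 0"
  shows "\<exists>Q. queens (24 * l + 10) Q \<and> int (card Q) = 24 * l + 9"
proof (rule queensI[where r = 2 and a = 4 and Lx = 0 and Ly = "0" and Ls = "0" and Ld = "0" and
    bs = "[(0, 3*l+1, 0, 0),
      (3*l+1, 6*l+2, 0, 1),
      (6*l+3, 9*l+4, 0, 0),
      (9*l+4, 12*l+5, 0, 1),
      (0, 3*l+1, 1, 12*l+8),
      (3*l+1, 6*l+2, 1, 12*l+7),
      (6*l+2, 9*l+3, 1, 12*l+8),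
      (9*l+3, 12*l+5, 1, 12*l+7)]"])
qed (use assms in \<open>(simp add: separated_unfold; (intro conjI allI impI)?; presburger)+\<close>)

lemma queens_mod_24_14:
  fixes l :: int
  assumes "l \<ge> 0"
  shows "\<exists>Q. queens (24 * l + 14) Q \<and> int (card Q) = 24 * l + 13"
proof (rule queensI[where r = 2 and a = 4 and Lx = 0 and Ly = "0" and Ls = "0" and Ld = "0" and
    bs = "[(0, 3*l+2, 0, 0),
      (3*l+2, 6*l+3, 0, 1),
      (6*l+4, 9*l+5, 0, 0),
      (9*l+5, 12*l+7, 0, 1),
      (0, 3*l+1, 1, 12*l+10),
      (3*l+1, 6*l+3, 1, 12*l+9),
      (6*l+3, 9*l+5, 1, 12*l+10),
      (9*l+5, 12*l+7, 1, 12*l+9)]"])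
qed (use assms in \<open>(simp add: separated_unfold; (intro conjI allI impI)?; presburger)+\<close>)

lemma queens_mod_24_22:
  fixes l :: int
  assumes "l \<ge> 0"
  shows "\<exists>Q. queens (24 * l + 22) Q \<and> int (card Q) = 24 * l + 21"
proof (rule queensI[where r = 2 and a = 4 and Lx = 0 and Ly = "0" and Ls = "0" and Ld = "0" and
    bs = "[(0, 3*l+3, 0, 0),
      (3*l+3, 6*l+5, 0, 1),
      (6*l+6, 9*l+8, 0, 0),
      (9*l+8, 12*l+11, 0, 1),
      (0, 3*l+2, 1, 12*l+14),
      (3*l+2, 6*l+5, 1, 12*l+13),
      (6*l+5, 9*l+8, 1, 12*l+14),
      (9*l+8, 12*l+11, 1, 12*l+13)]"])
qed (use assms in \<open>(simp add: separated_unfold; (intro conjI allI impI)?; presburger)+\<close>)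

text \<open>
  Configurations for boards with \<open>m \<noteq> n\<close>: rows may be used twice modulo \<open>g\<close>, once by each of the two
  parts.
\<close>

definition semi_queens :: "int \<Rightarrow> (int \<times> int) set \<Rightarrow> (int \<times> int) set \<Rightarrow> bool" where
  "semi_queens g Q\<^sub>1 Q\<^sub>2 \<longleftrightarrow> Q\<^sub>1 \<inter> Q\<^sub>2 = {} \<and> int (card (Q\<^sub>1 \<union> Q\<^sub>2)) = g \<and>
     inj_on (\<lambda>p. fst p mod g) (Q\<^sub>1 \<union> Q\<^sub>2) \<and> inj_on (\<lambda>p. (fst p - snd p) mod g) (Q\<^sub>1 \<union> Q\<^sub>2) \<and>
     inj_on (\<lambda>p. (fst p + snd p) mod g) (Q\<^sub>1 \<union> Q\<^sub>2) \<and>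
     inj_on (\<lambda>p. snd p mod g) Q\<^sub>1 \<and> inj_on (\<lambda>p. snd p mod g) Q\<^sub>2"

lemma semi_queensI:
  assumes n: "n > 0"
    and X: "separated 1 n 0 (map (\<lambda>(s, e, x0, y0). (s, e, x0)) (bs\<^sub>1 @ bs\<^sub>2))"
    and Y1: "separated 2 n 0 (map (\<lambda>(s, e, x0, y0). (s, e, y0)) bs\<^sub>1)"
    and Y2: "separated 2 n 0 (map (\<lambda>(s, e, x0, y0). (s, e, y0)) bs\<^sub>2)"
    and S: "separated 3 n 0 (map (\<lambda>(s, e, x0, y0). (s, e, x0 + y0)) (bs\<^sub>1 @ bs\<^sub>2))"
    and D: "separated 1 n 0 (map (\<lambda>(s, e, x0, y0). (s, e, y0 - x0)) (bs\<^sub>1 @ bs\<^sub>2))"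
    and pos: "\<And>s e x0 y0. (s, e, x0, y0) \<in> set (bs\<^sub>1 @ bs\<^sub>2) \<Longrightarrow> s \<le> e"
    and sz: "(\<Sum>(s, e, x0, y0)\<leftarrow>bs\<^sub>1 @ bs\<^sub>2. e - s) = n"
  shows "\<exists>Q\<^sub>1 Q\<^sub>2. semi_queens n Q\<^sub>1 Q\<^sub>2"
proof -
  let ?U = "\<lambda>bs. \<Union>b\<in>set bs. points 1 2 b"
  \<comment> \<open>Taking the second part without the points of the first makes the parts disjoint
    by construction and keeps the union.\<close>
  have U: "?U bs\<^sub>1 \<union> (?U bs\<^sub>2 - ?U bs\<^sub>1) = ?U (bs\<^sub>1 @ bs\<^sub>2)" by auto
  have "inj_on (\<lambda>p. fst p mod n) (?U (bs\<^sub>1 @ bs\<^sub>2))"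
    by (rule separated_inj[where \<alpha> = 1 and \<gamma> = "\<lambda>x0 y0. x0" and L = 0]) (use n X in auto)
  moreover have "inj_on (\<lambda>p. (fst p + snd p) mod n) (?U (bs\<^sub>1 @ bs\<^sub>2))"
    by (rule separated_inj[where \<alpha> = 3 and \<gamma> = "\<lambda>x0 y0. x0 + y0" and L = 0]) (use n S in auto)
  moreover have "inj_on (\<lambda>p. (snd p - fst p) mod n) (?U (bs\<^sub>1 @ bs\<^sub>2))"
    by (rule separated_inj[where \<alpha> = 1 and \<gamma> = "\<lambda>x0 y0. y0 - x0" and L = 0]) (use n D in auto)
  from inj_on_mod_uminus[OF this] have "inj_on (\<lambda>p. (fst p - snd p) mod n) (?U (bs\<^sub>1 @ bs\<^sub>2))" by simp
  moreover have "inj_on (\<lambda>p. snd p mod n) (?U bs\<^sub>1)"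
    by (rule separated_inj[where \<alpha> = 2 and \<gamma> = "\<lambda>x0 y0. y0" and L = 0]) (use n Y1 in auto)
  moreover have "inj_on (\<lambda>p. snd p mod n) (?U bs\<^sub>2)"
    by (rule separated_inj[where \<alpha> = 2 and \<gamma> = "\<lambda>x0 y0. y0" and L = 0]) (use n Y2 in auto)
  then have "inj_on (\<lambda>p. snd p mod n) (?U bs\<^sub>2 - ?U bs\<^sub>1)" by (rule inj_on_subset) blast
  moreover have "int (card (?U (bs\<^sub>1 @ bs\<^sub>2))) = n" using card_union_points[OF _ n X pos] sz by simp
  ultimately have "semi_queens n (?U bs\<^sub>1) (?U bs\<^sub>2 - ?U bs\<^sub>1)" unfolding semi_queens_def U by auto
  then show ?thesis by blast
qed

lemma semi_queens_mod_6_1: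
  fixes q :: int
  assumes "q \<ge> 0"
  shows "\<exists>Q\<^sub>1 Q\<^sub>2. semi_queens (6 * q + 1) Q\<^sub>1 Q\<^sub>2"
proof (rule semi_queensI[where bs\<^sub>1 = "[(0, 6*q+1, 0, 0)]" and
      bs\<^sub>2 = "[]"])
qed (use assms in \<open>(simp add: separated_unfold; (intro conjI allI impI)?; presburger)+\<close>)

lemma semi_queens_mod_6_5:
  fixes q :: int
  assumes "q \<ge> 0"
  shows "\<exists>Q\<^sub>1 Q\<^sub>2. semi_queens (6 * q + 5) Q\<^sub>1 Q\<^sub>2"
proof (rule semi_queensI[where bs\<^sub>1 = "[(0, 6*q+5, 0, 0)]" and
      bs\<^sub>2 = "[]"])
qed (use assms in \<open>(simp add: separated_unfold; (intro conjI allI impI)?; presburger)+\<close>)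

text \<open>On y = 2x the sums 3u and the differences are still permutations of the residues. Only
  the rows 2u repeat, with period n/2, so each half of the line uses a row at most once.\<close>

lemma semi_queens_mod_6_2:
  fixes q :: int
  assumes "q \<ge> 0"
  shows "\<exists>Q\<^sub>1 Q\<^sub>2. semi_queens (6 * q + 2) Q\<^sub>1 Q\<^sub>2"
proof (rule semi_queensI[where bs\<^sub>1 = "[(0, 3*q+1, 0, 0)]" and
      bs\<^sub>2 = "[(3*q+1, 6*q+2, 0, 0)]"])
qed (use assms in \<open>(simp add: separated_unfold; (intro conjI allI impI)?; presburger)+\<close>)

lemma semi_queens_mod_6_4:
  fixes q :: int
  assumes "q \<ge> 0"
  shows "\<exists>Q\<^sub>1 Q\<^sub>2. semi_queens (6 * q + 4) Q\<^sub>1 Q\<^sub>2"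
proof (rule semi_queensI[where bs\<^sub>1 = "[(0, 3*q+2, 0, 0)]" and
      bs\<^sub>2 = "[(3*q+2, 6*q+4, 0, 0)]"])
qed (use assms in \<open>(simp add: separated_unfold; (intro conjI allI impI)?; presburger)+\<close>)

lemma semi_queens_6:
  shows "\<exists>Q\<^sub>1 Q\<^sub>2. semi_queens 6 Q\<^sub>1 Q\<^sub>2"
proof (rule semi_queensI[where bs\<^sub>1 = "[(0, 2, 0, 0), (2, 3, 0, 1)]" and
      bs\<^sub>2 = "[(3, 4, 0, 2), (4, 5, 0, 4), (5, 6, 0, 5)]"])
qed ((simp add: separated_unfold; (intro conjI allI impI)?; presburger)+)

text \<open>If 3 divides \<open>n\<close>, the sum 3u + c keeps the residue of \<open>c\<close>
  modulo 3, so each residue must be served by exactly n/3 parameters. The blocks with offset 0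
  modulo 3 have total length n/3, and so do those with offset 1 and those with offset 2. The same
  holds in the other lists with 3 dividing \<open>n\<close>.\<close>

lemma semi_queens_mod_18_0:
  fixes l :: int
  assumes "l \<ge> 1"
  shows "\<exists>Q\<^sub>1 Q\<^sub>2. semi_queens (18 * l) Q\<^sub>1 Q\<^sub>2"
proof (rule semi_queensI[where bs\<^sub>1 = "[(0, 6*l, 0, 0), (6*l, 12*l-1, 0, 6*l+1)]" and
      bs\<^sub>2 = "[(12*l-1, 18*l-1, 0, 12*l+2), (18*l-1, 18*l, 0, 6*l+1)]"])
qed (use assms in \<open>(simp add: separated_unfold; (intro conjI allI impI)?; presburger)+\<close>)

lemma semi_queens_mod_18_12:
  fixes l :: int
  assumes "l \<ge> 0"
  shows "\<exists>Q\<^sub>1 Q\<^sub>2. semi_queens (18 * l + 12) Q\<^sub>1 Q\<^sub>2"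
proof (rule semi_queensI[where bs\<^sub>1 = "[(0, 6*l+4, 0, 0), (6*l+4, 12*l+7, 0, 6*l+5)]" and
      bs\<^sub>2 = "[(12*l+7, 18*l+11, 0, 12*l+10), (18*l+11, 18*l+12, 0, 6*l+5)]"])
qed (use assms in \<open>(simp add: separated_unfold; (intro conjI allI impI)?; presburger)+\<close>)

text \<open>Here n/3 is 2 modulo 3, so the offset n/3 + 1 used for \<open>18 * l\<close> and
  \<open>18 * l + 12\<close> would be a multiple of 3 and repeat sums of the first block. The offset
  n/3 + 3 takes its place, and the last block grows to length 3.\<close>

lemma semi_queens_mod_18_6:
  fixes l :: int
  assumes "l \<ge> 1"
  shows "\<exists>Q\<^sub>1 Q\<^sub>2. semi_queens (18 * l + 6) Q\<^sub>1 Q\<^sub>2"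
proof (rule semi_queensI[where bs\<^sub>1 = "[(0, 6*l+2, 0, 0), (6*l+2, 12*l+1, 0, 6*l+5)]" and
      bs\<^sub>2 = "[(12*l+1, 18*l+3, 0, 12*l+10), (18*l+3, 18*l+6, 0, 6*l+5)]"])
qed (use assms in \<open>(simp add: separated_unfold; (intro conjI allI impI)?; presburger)+\<close>)

lemma semi_queens_mod_18_9:
  fixes l :: int
  assumes "l \<ge> 0"
  shows "\<exists>Q\<^sub>1 Q\<^sub>2. semi_queens (18 * l + 9) Q\<^sub>1 Q\<^sub>2"
proof (rule semi_queensI[where bs\<^sub>1 = "[(0, 6*l+3, 0, 0), (8*l+3, 14*l+6, 0, 2)]" and
      bs\<^sub>2 = "[(6*l+3, 8*l+3, 0, 1), (14*l+6, 14*l+7, 0, 12*l+7), (14*l+7, 18*l+8, 0, 1), (18*l+8, 18*l+9, 0, 6*l+4)]"])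
qed (use assms in \<open>(simp add: separated_unfold; (intro conjI allI impI)?; presburger)+\<close>)

lemma semi_queens_mod_18_3:
  fixes l :: int
  assumes "l \<ge> 1"
  shows "\<exists>Q\<^sub>1 Q\<^sub>2. semi_queens (18 * l + 3) Q\<^sub>1 Q\<^sub>2"
proof (rule semi_queensI[where bs\<^sub>1 = "[(0, 6*l+1, 0, 0), (8*l+1, 14*l+1, 0, 2)]" and
      bs\<^sub>2 = "[(6*l+1, 8*l+1, 0, 1), (14*l+1, 14*l+2, 0, 12*l+4), (14*l+2, 18*l+2, 0, 1), (18*l+2, 18*l+3, 0, 6*l+2)]"])
qed (use assms in \<open>(simp add: separated_unfold; (intro conjI allI impI)?; presburger)+\<close>)

lemma semi_queens_mod_18_15:
  fixes l :: int
  assumes "l \<ge> 0"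
  shows "\<exists>Q\<^sub>1 Q\<^sub>2. semi_queens (18 * l + 15) Q\<^sub>1 Q\<^sub>2"
proof (rule semi_queensI[where bs\<^sub>1 = "[(0, 6*l+5, 0, 0), (8*l+6, 14*l+9, 0, 4)]" and
      bs\<^sub>2 = "[(6*l+5, 8*l+6, 0, 2), (14*l+9, 14*l+11, 0, 12*l+14), (14*l+11, 18*l+13, 0, 2), (18*l+13, 18*l+15, 0, 6*l+7)]"])
qed (use assms in \<open>(simp add: separated_unfold; (intro conjI allI impI)?; presburger)+\<close>)

subsection \<open>Independence numbers\<close>

text \<open>For \<open>g = 3\<close> there is no such configuration: it would yield three
  independent vertices on the 3 by 6 board, whose independence number is 2.\<close>

lemma semi_queens_exist:
  fixes g :: nat
  assumes "g > 0" "g \<noteq> 3"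
  shows "\<exists>Q\<^sub>1 Q\<^sub>2. semi_queens (int g) Q\<^sub>1 Q\<^sub>2"
proof -
  define k r l t where "k = int g div 6" and "r = int g mod 6" and "l = k div 3" and "t = k mod 3"
  have g: "int g = 6 * k + r" "0 \<le> r" "r < 6" "k \<ge> 0" by (simp_all add: k_def r_def)
  have k: "k = 3 * l + t" "0 \<le> t" "t < 3" "l \<ge> 0" using g(4) by (simp_all add: l_def t_def)
  have g': "int g > 0" "int g \<noteq> 3" using assms by auto
  consider "r = 0" | "r = 1" | "r = 2" | "r = 3" | "r = 4" | "r = 5" using g by linarith
  then show ?thesis
  proof cases
    case 1
    consider "t = 0" | "t = 1" "l = 0" | "t = 1" "l \<ge> 1" | "t = 2" using k by linarith
    then show ?thesis
    proof cases
      case 1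
      then have "int g = 18 * l" "l \<ge> 1" using g(1) g' k(1,4) \<open>r = 0\<close> by linarith+
      then show ?thesis using semi_queens_mod_18_0[of l] by simp
    next
      case 2
      then have "int g = 6" using g(1) k(1) \<open>r = 0\<close> by linarith
      then show ?thesis using semi_queens_6 by simp
    next
      case 3
      then have "int g = 18 * l + 6" using g(1) k(1) \<open>r = 0\<close> by linarith
      then show ?thesis using semi_queens_mod_18_6[OF 3(2)] by simp
    next
      case 4
      then have "int g = 18 * l + 12" using g(1) k(1) \<open>r = 0\<close> by linarith
      then show ?thesis using semi_queens_mod_18_12[OF k(4)] by simp
    qed
  next
    case 4
    consider "t = 0" | "t = 1" | "t = 2" using k by linarith
    then show ?thesis
    proof cases
      case 1
      then have "int g = 18 * l + 3" "l \<ge> 1" using g(1) g' k(1,4) \<open>r = 3\<close> by linarith+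
      then show ?thesis using semi_queens_mod_18_3[of l] by simp
    next
      case 2
      then have "int g = 18 * l + 9" using g(1) k(1) \<open>r = 3\<close> by linarith
      then show ?thesis using semi_queens_mod_18_9[OF k(4)] by simp
    next
      case 3
      then have "int g = 18 * l + 15" using g(1) k(1) \<open>r = 3\<close> by linarith
      then show ?thesis using semi_queens_mod_18_15[OF k(4)] by simp
    qed
  qed (use g(1) semi_queens_mod_6_1[OF g(4)] semi_queens_mod_6_2[OF g(4)] semi_queens_mod_6_4[OF g(4)] semi_queens_mod_6_5[OF g(4)] in simp_all)
qed

lemma queens_exist_coprime_6:
  fixes n :: nat
  assumes "odd n" "\<not> 3 dvd n"
  shows "\<exists>Q. queens (int n) Q \<and> int (card Q) = int n"
proof -
  define l r where "l = n div 6" and "r = n mod 6"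
  have n: "n = 6 * l + r" by (simp add: l_def r_def)
  have "odd r" "\<not> 3 dvd r" using assms by (simp_all add: r_def dvd_mod_iff)
  moreover have "r < 6" by (simp add: r_def)
  then have "r = 0 \<or> r = 1 \<or> r = 2 \<or> r = 3 \<or> r = 4 \<or> r = 5" by (simp add: less_Suc_eq numeral_eq_Suc)
  ultimately consider "r = 1" | "r = 5" by auto
  then show ?thesis
    by cases (use n queens_mod_6_1[of "int l"] queens_mod_6_5[of "int l"] in \<open>simp_all add: add.commute\<close>)
qed

lemma queens_exist_even:
  fixes n :: nat
  assumes "even n" "\<not> 3 dvd n" "\<not> 4 dvd n"
  shows "\<exists>Q. queens (int n) Q \<and> int (card Q) = int n - 1"
proof -
  define l r where "l = n div 24" and "r = n mod 24"
  have n: "n = 24 * l + r" by (simp add: l_def r_def)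
  have "even r" "\<not> 3 dvd r" "\<not> 4 dvd r" using assms by (simp_all add: r_def dvd_mod_iff)
  moreover have "r < 24" by (simp add: r_def)
  then have "r = 0 \<or> r = 1 \<or> r = 2 \<or> r = 3 \<or> r = 4 \<or> r = 5 \<or> r = 6 \<or> r = 7 \<or> r = 8 \<or> r = 9 \<or> r = 10 \<or> r = 11 \<or>
      r = 12 \<or> r = 13 \<or> r = 14 \<or> r = 15 \<or> r = 16 \<or> r = 17 \<or> r = 18 \<or> r = 19 \<or> r = 20 \<or> r = 21 \<or> r = 22 \<or> r = 23" by (simp add: less_Suc_eq numeral_eq_Suc)
  ultimately consider "r = 2" | "r = 10" | "r = 14" | "r = 22" by auto
  then show ?thesis
  proof cases
    case 1
    then show ?thesis using queens_mod_24_2[of "int l"] n by (simp add: add.commute)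
  next
    case 2
    then show ?thesis using queens_mod_24_10[of "int l"] n by (simp add: add.commute)
  next
    case 3
    then show ?thesis using queens_mod_24_14[of "int l"] n by (simp add: add.commute)
  next
    case 4
    then show ?thesis using queens_mod_24_22[of "int l"] n by (simp add: add.commute)
  qed
qed

lemma queens_exist:
  fixes n :: nat
  assumes "3 dvd n \<or> 4 dvd n" "n > 0"
  shows "\<exists>Q. queens (int n) Q \<and> int (card Q) = int n - 2"
proof -
  define l r where "l = n div 12" and "r = n mod 12"
  have n: "n = 12 * l + r" by (simp add: l_def r_def)
  have "3 dvd r \<or> 4 dvd r" using assms(1) by (simp add: r_def dvd_mod_iff)
  moreover have "r < 12" by (simp add: r_def)
  then have "r = 0 \<or> r = 1 \<or> r = 2 \<or> r = 3 \<or> r = 4 \<or> r = 5 \<or> r = 6 \<or> r = 7 \<or> r = 8 \<or> r = 9 \<or> r = 10 \<or> r = 11" by (simp add: less_Suc_eq numeral_eq_Suc)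
  ultimately consider "r = 0" | "r = 3" "l = 0" | "r = 3" "l \<ge> 1" | "r = 4" | "r = 6" "l = 0" | "r = 6" "l \<ge> 1" | "r = 8" | "r = 9"
    by (cases "l = 0") auto
  then show ?thesis
  proof cases
    case 1
    then show ?thesis using queens_mod_12_0[of "int l"] n assms(2) by (simp add: add.commute)
  next
    case 2
    \<comment> \<open>\<open>queens_mod_6_3\<close> starts at \<open>p = 1\<close>, since its last
      block has length \<open>p - 1\<close>. For \<open>n = 3\<close> a single queen already makes n
      - 2.\<close>
    have "queens (int n) {(0, 0)}" by (simp add: queens_def)
    then show ?thesis using 2 n by (intro exI[of _ "{(0, 0)}"]) simp
  next
    case 3
    then show ?thesis using queens_mod_6_3[of "2 * int l"] n by (simp add: add.commute)
  next
    case 4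
    then show ?thesis using queens_mod_12_4[of "int l"] n by (simp add: add.commute)
  next
    case 5
    then show ?thesis using queens_6 n by simp
  next
    case 6
    then show ?thesis using queens_mod_12_6[of "int l"] n by (simp add: add.commute)
  next
    case 7
    then show ?thesis using queens_mod_12_8[of "int l"] n by (simp add: add.commute)
  next
    case 8
    then show ?thesis using queens_mod_6_3[of "2 * int l + 1"] n by (simp add: add.commute algebra_simps)
  qed
qed

section \<open>Upper bounds from sums and squares of residues\<close>

lemma sum_interval: "2 * (\<Sum>i\<in>{0..<int n}. i) = int n * (int n - 1)"
  and sum_squares_interval: "6 * (\<Sum>i\<in>{0..<int n}. i\<^sup>2) = int n * (int n - 1) * (2 * int n - 1)"
proof -
  have "(\<Sum>i\<in>{0..<int n}. f i) = (\<Sum>i<n. f (int i))" for f :: "int \<Rightarrow> int"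
    by (rule sum.reindex_bij_witness[of _ int nat]) auto
  moreover have "2 * (\<Sum>i<n. int i) = int n * (int n - 1)" by (induction n) (auto simp: algebra_simps)
  moreover have "6 * (\<Sum>i<n. (int i)\<^sup>2) = int n * (int n - 1) * (2 * int n - 1)"
    by (induction n) (auto simp: algebra_simps power2_eq_square)
  ultimately show "2 * (\<Sum>i\<in>{0..<int n}. i) = int n * (int n - 1)"
    "6 * (\<Sum>i\<in>{0..<int n}. i\<^sup>2) = int n * (int n - 1) * (2 * int n - 1)" by simp_all
qed

lemma sum_mod_all_residues:
  fixes f :: "'a \<Rightarrow> int"
  assumes "inj_on (\<lambda>p. f p mod int n) S" "card S = n" "n > 0"
  shows "(\<Sum>p\<in>S. f p mod int n) = (\<Sum>i\<in>{0..<int n}. i)"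
proof -
  let ?h = "\<lambda>p. f p mod int n"
  have "?h ` S \<subseteq> {0..<int n}" using assms(3) by auto
  then have "?h ` S = {0..<int n}" using assms by (intro card_subset_eq) (auto simp: card_image)
  then show ?thesis using sum.reindex[OF assms(1), of "\<lambda>i. i"] by simp
qed

lemma sum_mod_one_missing:
  fixes f :: "'a \<Rightarrow> int"
  assumes inj: "inj_on (\<lambda>p. f p mod int n) S" and card: "card S + 1 = n" and fin: "finite S"
  obtains r where "(\<Sum>p\<in>S. f p mod int n) = (\<Sum>i\<in>{0..<int n}. i) - r"
    and "(\<Sum>p\<in>S. (f p mod int n)\<^sup>2) = (\<Sum>i\<in>{0..<int n}. i\<^sup>2) - r\<^sup>2"
proof -
  let ?h = "\<lambda>p. f p mod int n"
  have sub: "?h ` S \<subseteq> {0..<int n}" using card by auto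
  have "card ({0..<int n} - ?h ` S) = 1"
    using card card_image[OF inj] fin by (subst card_Diff_subset[OF _ sub]) auto
  then obtain r where r: "{0..<int n} - ?h ` S = {r}" by (auto simp: card_1_singleton_iff)
  then have eq: "{0..<int n} = insert r (?h ` S)" and nr: "r \<notin> ?h ` S" using sub by auto
  have "(\<Sum>i\<in>{0..<int n}. k i) = k r + (\<Sum>p\<in>S. k (?h p))" for k :: "int \<Rightarrow> int"
    unfolding eq using fin nr sum.reindex[OF inj, of k] by simp
  from this[of "\<lambda>i. i"] this[of "\<lambda>i. i\<^sup>2"] that[of r] show ?thesis by simp
qed

text \<open>The gain of a factor 2 in the modulus is what makes the case of 4 dividing
  \<open>n\<close> work; modulo \<open>n\<close> alone the square sums give no contradiction there
  unless 3 divides \<open>n\<close>.\<close>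

lemma cong_square_double:
  fixes a b n :: int
  assumes "even n" "[a = b] (mod n)" shows "[a\<^sup>2 = b\<^sup>2] (mod 2 * n)"
proof -
  obtain k where k: "a = b + n * k" using assms(2) by (metis cong_iff_dvd_diff diff_eq_eq add.commute dvdE)
  obtain h where "n = 2 * h" using assms(1) by blast
  then have "a\<^sup>2 - b\<^sup>2 = 2 * n * (b * k + h * k\<^sup>2)" unfolding k by (simp add: algebra_simps power2_eq_square)
  then show ?thesis by (simp add: cong_iff_dvd_diff)
qed

text \<open>With \<open>n\<close> queens the forms x, y and x + y each run through all residues,
  with the same sum T. Hence T = T + T modulo \<open>n\<close>, but T = n(n - 1)/2 is not divisible
  by an even \<open>n\<close>.\<close>

lemma queens_not_all_even:
  fixes S :: "(int \<times> int) set"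
  assumes q: "queens (int n) S" and n: "even n" "n > 0" and card: "card S = n"
  shows False
proof -
  let ?T = "\<Sum>i\<in>{0..<int n}. i"
  have s: "(\<Sum>p\<in>S. f p mod int n) = ?T" if "inj_on (\<lambda>p. f p mod int n) S" for f :: "int \<times> int \<Rightarrow> int"
    using sum_mod_all_residues[OF that card n(2)] .
  have "[(\<Sum>p\<in>S. (fst p + snd p) mod int n) = (\<Sum>p\<in>S. fst p mod int n + snd p mod int n)] (mod int n)"
    by (intro cong_sum) (simp add: cong_def mod_add_eq)
  then have "[?T = ?T + ?T] (mod int n)"
    using q s[of fst] s[of snd] s[of "\<lambda>p. fst p + snd p"] by (simp add: queens_def sum.distrib)
  then have "int n dvd ?T" by (simp add: cong_iff_dvd_diff)
  then obtain k where "?T = int n * k" by blast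
  then have "int n * (2 * k) = int n * (int n - 1)" using sum_interval[of n] by simp
  then have "2 * k = int n - 1" using n(2) by simp
  then show False using n(1) by presburger
qed

text \<open>
  Comparing the sum of \<open>(x + y)\<^sup>2 + (x - y)\<^sup>2 = 2 * x\<^sup>2 + 2 * y\<^sup>2\<close> over all queens with the sum of all squares
  modulo \<open>M\<close> eliminates the four missing residues.
\<close>

lemma queens_all_but_one_squares:
  fixes S :: "(int \<times> int) set"
  assumes q: "queens (int n) S" and n: "n > 0" and card: "card S + 1 = n" and fin: "finite S"
    and M: "M dvd 2 * int n" and sq: "\<And>a b. [a = b] (mod int n) \<Longrightarrow> [a\<^sup>2 = b\<^sup>2] (mod M)"
  shows "M dvd 2 * (\<Sum>i\<in>{0..<int n}. i\<^sup>2) + 2 * (\<Sum>i\<in>{0..<int n}. i)\<^sup>2"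
proof -
  define T where "T = (\<Sum>i\<in>{0..<int n}. i)"
  define Q where "Q = (\<Sum>i\<in>{0..<int n}. i\<^sup>2)"
  let ?m = "\<lambda>a. a mod int n"
  obtain r1 where r1: "(\<Sum>p\<in>S. ?m (fst p)) = T - r1" "(\<Sum>p\<in>S. (?m (fst p))\<^sup>2) = Q - r1\<^sup>2"
    using sum_mod_one_missing[of fst n S] q card fin unfolding queens_def T_def Q_def by blast
  obtain r2 where r2: "(\<Sum>p\<in>S. ?m (snd p)) = T - r2" "(\<Sum>p\<in>S. (?m (snd p))\<^sup>2) = Q - r2\<^sup>2"
    using sum_mod_one_missing[of snd n S] q card fin unfolding queens_def T_def Q_def by blast
  obtain r3 where r3: "(\<Sum>p\<in>S. ?m (fst p + snd p)) = T - r3" "(\<Sum>p\<in>S. (?m (fst p + snd p))\<^sup>2) = Q - r3\<^sup>2"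
    using sum_mod_one_missing[of "\<lambda>p. fst p + snd p" n S] q card fin unfolding queens_def T_def Q_def by blast
  obtain r4 where r4: "(\<Sum>p\<in>S. ?m (fst p - snd p)) = T - r4" "(\<Sum>p\<in>S. (?m (fst p - snd p))\<^sup>2) = Q - r4\<^sup>2"
    using sum_mod_one_missing[of "\<lambda>p. fst p - snd p" n S] q card fin unfolding queens_def T_def Q_def by blast
  have "[(\<Sum>p\<in>S. ?m (fst p + snd p)) = (\<Sum>p\<in>S. ?m (fst p) + ?m (snd p))] (mod int n)"
    by (intro cong_sum) (simp add: cong_def mod_add_eq)
  then have "[T - r3 = (T - r1) + (T - r2)] (mod int n)" using r1 r2 r3 by (simp add: sum.distrib)
  then have "[r3 = r1 + r2 - T] (mod int n)"
    using dvd_minus_iff[of "int n" "T - r3 - ((T - r1) + (T - r2))"] by (simp add: cong_iff_dvd_diff algebra_simps)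
  then have s3: "[r3\<^sup>2 = (r1 + r2 - T)\<^sup>2] (mod M)" by (rule sq)
  have "[(\<Sum>p\<in>S. ?m (fst p - snd p)) = (\<Sum>p\<in>S. ?m (fst p) - ?m (snd p))] (mod int n)"
    by (intro cong_sum) (simp add: cong_def mod_diff_eq)
  then have "[T - r4 = (T - r1) - (T - r2)] (mod int n)" using r1 r2 r4 by (simp add: sum_subtractf)
  then have "[r4 = T + r1 - r2] (mod int n)"
    using dvd_minus_iff[of "int n" "T - r4 - ((T - r1) - (T - r2))"] by (simp add: cong_iff_dvd_diff algebra_simps)
  then have s4: "[r4\<^sup>2 = (T + r1 - r2)\<^sup>2] (mod M)" by (rule sq)
  have "[(\<Sum>p\<in>S. (?m (fst p + snd p))\<^sup>2 + (?m (fst p - snd p))\<^sup>2) =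
      (\<Sum>p\<in>S. 2 * (?m (fst p))\<^sup>2 + 2 * (?m (snd p))\<^sup>2)] (mod M)"
  proof (rule cong_sum)
    fix p
    have "[?m (fst p + snd p) = ?m (fst p) + ?m (snd p)] (mod int n)"
      "[?m (fst p - snd p) = ?m (fst p) - ?m (snd p)] (mod int n)"
      by (simp_all add: cong_def mod_add_eq mod_diff_eq)
    from sq[OF this(1)] sq[OF this(2)]
    have "[(?m (fst p + snd p))\<^sup>2 = (?m (fst p) + ?m (snd p))\<^sup>2] (mod M)"
      "[(?m (fst p - snd p))\<^sup>2 = (?m (fst p) - ?m (snd p))\<^sup>2] (mod M)" .
    then have "[(?m (fst p + snd p))\<^sup>2 + (?m (fst p - snd p))\<^sup>2 =
        (?m (fst p) + ?m (snd p))\<^sup>2 + (?m (fst p) - ?m (snd p))\<^sup>2] (mod M)" by (rule cong_add)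
    moreover have "(a + b)\<^sup>2 + (a - b)\<^sup>2 = 2 * a\<^sup>2 + 2 * b\<^sup>2" for a b :: int
      by (simp add: power2_sum power2_diff)
    ultimately show "[(?m (fst p + snd p))\<^sup>2 + (?m (fst p - snd p))\<^sup>2 = 2 * (?m (fst p))\<^sup>2 + 2 * (?m (snd p))\<^sup>2] (mod M)"
      by simp
  qed
  then have "[(Q - r3\<^sup>2) + (Q - r4\<^sup>2) = 2 * (Q - r1\<^sup>2) + 2 * (Q - r2\<^sup>2)] (mod M)"
    using r1 r2 r3 r4 by (simp add: sum.distrib flip: sum_distrib_left)
  moreover have "[(Q - r3\<^sup>2) + (Q - r4\<^sup>2) = (Q - (r1 + r2 - T)\<^sup>2) + (Q - (T + r1 - r2)\<^sup>2)] (mod M)"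
    by (rule cong_add[OF cong_diff[OF cong_refl s3] cong_diff[OF cong_refl s4]])
  ultimately have "[(Q - (r1 + r2 - T)\<^sup>2) + (Q - (T + r1 - r2)\<^sup>2) = 2 * (Q - r1\<^sup>2) + 2 * (Q - r2\<^sup>2)] (mod M)"
    using cong_trans[OF cong_sym] by blast
  then have "M dvd (2 * (Q - r1\<^sup>2) + 2 * (Q - r2\<^sup>2)) - ((Q - (r1 + r2 - T)\<^sup>2) + (Q - (T + r1 - r2)\<^sup>2))"
    using cong_sym cong_iff_dvd_diff by blast
  also have "(2 * (Q - r1\<^sup>2) + 2 * (Q - r2\<^sup>2)) - ((Q - (r1 + r2 - T)\<^sup>2) + (Q - (T + r1 - r2)\<^sup>2))
      = 2 * Q + 2 * T\<^sup>2 - 2 * (2 * T) * r2"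
    by (simp add: power2_eq_square algebra_simps)
  finally have "M dvd 2 * Q + 2 * T\<^sup>2 - 2 * (2 * T) * r2" .
  \<comment> \<open>After the missing residues of the sums and differences are expressed by
    \<open>r1\<close>, \<open>r2\<close> and \<open>T\<close>, all quadratic terms in
    \<open>r1\<close> and \<open>r2\<close> cancel. The one mixed term left vanishes modulo
    \<open>M\<close> because 2T = n(n - 1).\<close>
  moreover have "M dvd 2 * (2 * T) * r2"
  proof -
    have "2 * T = int n * (int n - 1)" unfolding T_def by (rule sum_interval)
    then have "2 * (2 * T) * r2 = 2 * int n * ((int n - 1) * r2)" by simp
    then show ?thesis using dvd_mult2[OF M, of "(int n - 1) * r2"] by (simp only:)
  qed
  ultimately have "M dvd (2 * Q + 2 * T\<^sup>2 - 2 * (2 * T) * r2) + 2 * (2 * T) * r2" by (rule dvd_add)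
  then have "M dvd 2 * Q + 2 * T\<^sup>2" by simp
  then show ?thesis unfolding T_def Q_def .
qed

text \<open>If 4 does not divide \<open>n\<close>, take the modulus \<open>n\<close>: the term 2T^2
  drops out, and 2Q = (n/3)(n - 1)(2n - 1) is no multiple of \<open>n\<close> because 3 divides
  neither n - 1 nor 2n - 1. If 4 divides \<open>n\<close>, take the modulus \<open>2 * n\<close> and
  multiply by 3 to clear the denominator; T is even, but (n - 1)(2n - 1) is odd.\<close>

lemma queens_not_all_but_one:
  fixes S :: "(int \<times> int) set"
  assumes q: "queens (int n) S" and n: "n > 0" "3 dvd n \<or> 4 dvd n" and card: "card S + 1 = n" and fin: "finite S"
  shows False
proof -
  let ?T = "\<Sum>i\<in>{0..<int n}. i" and ?Q = "\<Sum>i\<in>{0..<int n}. i\<^sup>2"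
  show False
  proof (cases "4 dvd n")
    case False
    then obtain h where h: "n = 3 * h" using n by blast
    have "int n dvd 2 * ?Q + 2 * ?T\<^sup>2"
      by (rule queens_all_but_one_squares[OF q n(1) card fin]) (auto intro: cong_pow)
    moreover have "2 * ?T\<^sup>2 = int n * ((int n - 1) * ?T)"
      using sum_interval[of n] by (simp add: power2_eq_square flip: mult.assoc)
    ultimately have "int n dvd 2 * ?Q" by (simp add: dvd_add_left_iff)
    moreover have "2 * ?Q = int h * ((int n - 1) * (2 * int n - 1))" using sum_squares_interval[of n] unfolding h by simp
    ultimately have "int h * 3 dvd int h * ((int n - 1) * (2 * int n - 1))" unfolding h by (simp add: mult.commute)
    then have "3 dvd (int n - 1) * (2 * int n - 1)" using n(1) h by simp
    then have "3 dvd int n - 1 \<or> 3 dvd 2 * int n - 1"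
      using prime_dvd_mult_iff[of "3::int"] by simp
    then show False unfolding h by presburger
  next
    case True
    then obtain j where j: "n = 4 * j" by blast
    have "2 * int n dvd 2 * ?Q + 2 * ?T\<^sup>2"
      by (rule queens_all_but_one_squares[OF q n(1) card fin]) (use True in \<open>auto intro!: cong_square_double\<close>)
    then have "2 * int n dvd 6 * ?Q + 3 * ((2 * ?T) * ?T)"
      by (auto dest: dvd_mult[of _ _ 3] simp: power2_eq_square algebra_simps)
    also have "6 * ?Q + 3 * ((2 * ?T) * ?T) = int n * ((int n - 1) * (2 * int n - 1) + 3 * (int n - 1) * ?T)"
      unfolding sum_interval sum_squares_interval by (simp add: algebra_simps)
    finally have "2 dvd (int n - 1) * (2 * int n - 1) + 3 * (int n - 1) * ?T"
      using n(1) by (simp add: mult.commute)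
    moreover have "?T = 2 * (int j * (int n - 1))" using sum_interval[of n] unfolding j by simp
    ultimately have "2 dvd (int n - 1) * (2 * int n - 1)" by simp
    then show False unfolding j by simp
  qed
qed

section \<open>From placements modulo n to independent sets\<close>

context toroidal_queens
begin

text \<open>Placements may use arbitrary integer coordinates: as \<open>g\<close> divides both side
  lengths, reduction to the board does not change the diagonals modulo \<open>g\<close>.\<close>

lemma independence_number_geI:
  fixes X Y :: "'b \<Rightarrow> int"
  assumes "finite I" "inj_on (\<lambda>i. X i mod int m) I" "inj_on (\<lambda>i. Y i mod int n) I"
    "inj_on (\<lambda>i. (X i - Y i) mod int g) I" "inj_on (\<lambda>i. (X i + Y i) mod int g) I"
  shows "card I \<le> independence_number V E"
proof -
  let ?f = "\<lambda>i. (X i mod int m, Y i mod int n)"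
  have dvd: "int g dvd int m" "int g dvd int n" unfolding m n by simp_all
  have "(X i mod int m - Y i mod int n) mod int g = (X i - Y i) mod int g"
    "(X i mod int m + Y i mod int n) mod int g = (X i + Y i) mod int g" for i
    using mod_mod_cancel[OF dvd(1), of "X i"] mod_mod_cancel[OF dvd(2), of "Y i"]
    by (metis mod_diff_eq, metis mod_add_eq)
  then have "indep (?f ` I) E"
    using assms m2 n2 by (subst indep_iff) (auto simp: inj_on_def)
  moreover have "?f ` I \<subseteq> V" using m2 n2 by auto
  moreover have "card (?f ` I) = card I" using assms(2) by (intro card_image) (auto simp: inj_on_def)
  ultimately show ?thesis using indep_card_le by metis
qed

lemma independence_number_le: "independence_number V E \<le> g"
proof -
  obtain S where S: "S \<subseteq> V" "indep S E" "card S = independence_number V E"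
    using independence_number_attained by blast
  let ?h = "\<lambda>p. (fst p - snd p) mod int g"
  have "card S = card (?h ` S)" using S(2) indep_iff[OF S(1)] by (simp add: card_image)
  also have "\<dots> \<le> card {0..<int g}" using pos by (intro card_mono) auto
  finally show ?thesis using S(3) by simp
qed

lemma indep_imp_queens:
  assumes "S \<subseteq> V" "indep S E" "m = n"
  shows "queens (int n) S"
proof -
  have gn: "g = n" using assms(3) g by simp
  have "fst p mod int n = fst p" "snd p mod int n = snd p" if "p \<in> S" for p
    using that assms(1,3) by (auto simp: TQ_verts_def)
  then have "inj_on (\<lambda>p. fst p mod int n) S = inj_on fst S" "inj_on (\<lambda>p. snd p mod int n) S = inj_on snd S"
    by (auto intro!: inj_on_cong)
  then show ?thesis using assms(2) indep_iff[OF assms(1)] by (simp add: queens_def gn)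
qed

lemma queens_imp_independence_number_ge:
  assumes "queens (int n) Q" "m = n" "int (card Q) = k" "k > 0"
  shows "k \<le> int (independence_number V E)"
proof -
  have "g = n" using assms(2) g by simp
  moreover have "finite Q" using assms(3,4) by (intro card_ge_0_finite) simp
  ultimately show ?thesis
    using independence_number_geI[of Q fst snd] assms by (simp add: queens_def)
qed

lemma independence_number_square:
  assumes mn: "m = n"
  shows "int (independence_number V E) =
    (if gcd 6 n = 1 then int n else if \<not> 3 dvd n \<and> \<not> 4 dvd n then int n - 1 else int n - 2)"
proof -
  let ?\<alpha> = "independence_number V E"
  obtain S where S: "S \<subseteq> V" "indep S E" "card S = ?\<alpha>"
    using independence_number_attained by blast
  have q: "queens (int n) S" by (rule indep_imp_queens[OF S(1,2) mn])
  have fin: "finite S" using S(1) finite_V finite_subset by blast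
  have le: "?\<alpha> \<le> n" using independence_number_le mn g by simp
  have gcd6: "gcd 6 n = 1 \<longleftrightarrow> odd n \<and> \<not> 3 dvd n"
  proof -
    have "coprime (2 * 3) n \<longleftrightarrow> coprime 2 n \<and> coprime 3 n" by (rule coprime_mult_left_iff)
    moreover have "coprime 3 n \<longleftrightarrow> \<not> 3 dvd n"
      using prime_imp_coprime_nat[of 3 n] by (auto simp: coprime_absorb_left)
    ultimately have "coprime (2 * 3) n \<longleftrightarrow> odd n \<and> \<not> 3 dvd n" by (simp only: coprime_left_2_iff_odd)
    then show ?thesis by (simp add: coprime_iff_gcd_eq_1)
  qed
  show ?thesis
  proof (cases "odd n \<and> \<not> 3 dvd n")
    case True
    then obtain Q where Q: "queens (int n) Q" "int (card Q) = int n" using queens_exist_coprime_6 by blast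
    then have "int n \<le> int ?\<alpha>" using queens_imp_independence_number_ge[OF Q(1) mn Q(2)] n2 by simp
    then show ?thesis using True gcd6 le by simp
  next
    case notc: False
    show ?thesis
    proof (cases "\<not> 3 dvd n \<and> \<not> 4 dvd n")
      case True
      then have ev: "even n" using notc by simp
      then obtain Q where Q: "queens (int n) Q" "int (card Q) = int n - 1" using queens_exist_even True by blast
      then have "int n - 1 \<le> int ?\<alpha>" using queens_imp_independence_number_ge[OF Q(1) mn Q(2)] n2 by simp
      moreover have "?\<alpha> \<noteq> n" using queens_not_all_even[OF q ev] S(3) n2 by auto
      ultimately show ?thesis using notc True gcd6 le by auto
    next
      case False
      then have d: "3 dvd n \<or> 4 dvd n" by blast
      then have n3: "n \<ge> 3" using n2 by (auto dest: dvd_imp_le)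
      obtain Q where Q: "queens (int n) Q" "int (card Q) = int n - 2" using queens_exist[OF d] n2 by auto
      then have "int n - 2 \<le> int ?\<alpha>" using queens_imp_independence_number_ge[OF Q(1) mn Q(2)] n3 by simp
      moreover have "?\<alpha> + 1 \<noteq> n" using queens_not_all_but_one[OF q _ d _ fin] S(3) n2 by auto
      \<comment> \<open>\<open>queens_not_all_even\<close> does not reach odd multiples of 3.
        Deleting one queen leads back to the case of n - 1 queens.\<close>
      moreover have "?\<alpha> \<noteq> n"
      proof
        assume "?\<alpha> = n"
        then have "S \<noteq> {}" using S(3) n2 by auto
        then obtain p where p: "p \<in> S" by blast
        have "queens (int n) (S - {p})" using q unfolding queens_def by (auto intro: inj_on_subset)
        moreover have "card (S - {p}) + 1 = n" using p fin S(3) \<open>?\<alpha> = n\<close> n2 by simp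
        ultimately show False using queens_not_all_but_one[OF _ _ d _ _, of "S - {p}"] fin n2 by auto
      qed
      ultimately show ?thesis using notc False gcd6 le by auto
    qed
  qed
qed

text \<open>The longer side contains at least two copies of the residues modulo \<open>g\<close>.
  The second part is lifted into the second copy, so rows used by both parts become different
  without changing modulo \<open>g\<close>.\<close>

lemma semi_queens_place:
  assumes sq: "semi_queens (int g) Q\<^sub>1 Q\<^sub>2" and c: "c \<ge> 2"
  shows "inj_on (\<lambda>p. (snd p mod int g + of_bool (p \<in> Q\<^sub>2) * int g) mod int (g * c)) (Q\<^sub>1 \<union> Q\<^sub>2)"
proof (rule inj_onI)
  fix p q
  let ?y = "\<lambda>p. snd p mod int g + of_bool (p \<in> Q\<^sub>2) * int g"
  assume p: "p \<in> Q\<^sub>1 \<union> Q\<^sub>2" and q: "q \<in> Q\<^sub>1 \<union> Q\<^sub>2" and eq: "?y p mod int (g * c) = ?y q mod int (g * c)"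
  have b: "0 \<le> snd r mod int g" "snd r mod int g < int g" for r :: "int \<times> int" using pos by simp_all
  have "int g * 2 \<le> int g * int c" using c by (intro mult_left_mono) auto
  then have "?y r < int (g * c)" for r
  proof -
    have "?y r \<le> snd r mod int g + int g" by (simp add: of_bool_def)
    then show ?thesis using b[of r] \<open>int g * 2 \<le> _\<close> unfolding of_nat_mult by linarith
  qed
  moreover have "0 \<le> ?y r" for r using b[of r] by (simp add: of_bool_def)
  ultimately have y: "?y p = ?y q" using eq by (metis mod_pos_pos_trivial)
  then have "p \<in> Q\<^sub>2 \<longleftrightarrow> q \<in> Q\<^sub>2" using b[of p] b[of q] unfolding of_bool_def
    by (cases "p \<in> Q\<^sub>2"; cases "q \<in> Q\<^sub>2"; simp only: if_True if_False simp_thms; linarith)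
  moreover from this have "snd p mod int g = snd q mod int g" using y by simp
  ultimately show "p = q" using sq p q unfolding semi_queens_def inj_on_def by blast
qed

lemma inj_on_mod_dvd: "\<lbrakk>inj_on (\<lambda>p. f p mod k) Q; k dvd l\<rbrakk> \<Longrightarrow> inj_on (\<lambda>p. f p mod (l::int)) Q"
  unfolding inj_on_def by (metis mod_mod_cancel)

lemma independence_number_rectangle:
  assumes mn: "m \<noteq> n" "{m, n} \<noteq> {3, 6}"
  shows "independence_number V E = g"
proof (rule antisym[OF independence_number_le])
  have dvd: "int g dvd int m" "int g dvd int n" unfolding m n by simp_all
  have ab: "a \<noteq> b" using mn m n by auto
  show "g \<le> independence_number V E"
  proof (cases "g = 3")
    case True
    \<comment> \<open>Excluding {3, 6} leaves three copies of the residues modulo 3 on one side. All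
      three queens can then share one residue class there, as on the points (i, 3i), whose sums and
      differences are both congruent to i modulo 3.\<close>
    have "a \<ge> 3 \<or> b \<ge> 3"
    proof (rule ccontr)
      assume "\<not> ?thesis"
      then have "a = 1 \<and> b = 2 \<or> a = 2 \<and> b = 1" using ab pos by auto
      then show False using mn m n True by auto
    qed
    then show ?thesis
    proof
      assume "b \<ge> 3"
      then have "int n \<ge> 9" unfolding n True by simp
      moreover have "int m \<ge> 3" unfolding m True using pos by simp
      ultimately show ?thesis
        using independence_number_geI[of "{0, 1, 2}" "\<lambda>i::int. i" "\<lambda>i. 3 * i"] True by (simp add: inj_on_def)
    next
      assume "a \<ge> 3"
      then have "int m \<ge> 9" unfolding m True by simp
      moreover have "int n \<ge> 3" unfolding n True using pos by simp
      ultimately show ?thesis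
        using independence_number_geI[of "{0, 1, 2}" "\<lambda>i::int. 3 * i" "\<lambda>i. i"] True by (simp add: inj_on_def)
    qed
  next
    case False
    obtain Q1 Q2 where sq: "semi_queens (int g) Q1 Q2" using semi_queens_exist False pos by blast
    let ?Q = "Q1 \<union> Q2" and ?y = "\<lambda>p. snd p mod int g + of_bool (p \<in> Q2) * int g"
    have card: "card ?Q = g" using sq by (simp add: semi_queens_def)
    have fin: "finite ?Q" using card pos by (intro card_ge_0_finite) simp
    have X: "inj_on (\<lambda>p. fst p mod int g) ?Q" and D: "inj_on (\<lambda>p. (fst p - snd p) mod int g) ?Q"
      and S: "inj_on (\<lambda>p. (fst p + snd p) mod int g) ?Q" using sq by (simp_all add: semi_queens_def)
    have ym: "?y p mod int g = snd p mod int g" for p by simp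
    have yd: "(fst p - ?y p) mod int g = (fst p - snd p) mod int g"
      and ys: "(fst p + ?y p) mod int g = (fst p + snd p) mod int g" for p
      by (rule mod_diff_cong[OF refl ym], rule mod_add_cong[OF refl ym])
    have D': "inj_on (\<lambda>p. (fst p - ?y p) mod int g) ?Q" unfolding yd by (rule D)
    have S': "inj_on (\<lambda>p. (fst p + ?y p) mod int g) ?Q" unfolding ys by (rule S)
    have "a \<ge> 2 \<or> b \<ge> 2" using ab pos by linarith
    then show ?thesis
    proof
      assume "b \<ge> 2"
      from semi_queens_place[OF sq this] have "inj_on (\<lambda>p. ?y p mod int n) ?Q" unfolding n .
      then show ?thesis
        using independence_number_geI[OF fin inj_on_mod_dvd[OF X dvd(1)] _ D' S'] card by simp
    next
      assume "a \<ge> 2"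
      from semi_queens_place[OF sq this] have Y: "inj_on (\<lambda>p. ?y p mod int m) ?Q" unfolding m .
      have "inj_on (\<lambda>p. (?y p - fst p) mod int g) ?Q" using inj_on_mod_uminus[OF D'] by simp
      moreover have "inj_on (\<lambda>p. (?y p + fst p) mod int g) ?Q" using S' by (simp add: add.commute)
      ultimately show ?thesis
        using independence_number_geI[OF fin Y inj_on_mod_dvd[OF X dvd(2)]] card by simp
    qed
  qed
qed

end

theorem theorem1p2:
  fixes m n :: nat
  assumes "m \<ge> 2" and "n \<ge> 2"
  shows "gonality (TQ_verts m n) (TQ_edges m n)
           = int (m * n) - int (independence_number (TQ_verts m n) (TQ_edges m n))
       \<and> (m = n \<longrightarrow>
            gonality (TQ_verts n n) (TQ_edges n n) =
              (if gcd 6 n = 1 then int n * (int n - 1)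
               else if \<not> 3 dvd n \<and> \<not> 4 dvd n then int n * (int n - 1) + 1
               else int n * (int n - 1) + 2))
       \<and> (m \<noteq> n \<and> {m, n} \<noteq> {3, 6} \<longrightarrow>
            gonality (TQ_verts m n) (TQ_edges m n) = int (m * n) - int (gcd m n))
       \<and> (\<exists>f. bij_betw f (rank1_gonality_classes (TQ_verts m n) (TQ_edges m n))
                          (max_indep_sets (TQ_verts m n) (TQ_edges m n)))"
proof -
  interpret toroidal_queens m n "gcd m n" "m div gcd m n" "n div gcd m n"
    using assms by unfold_locales auto
  have gon: "gonality (TQ_verts m n) (TQ_edges m n)
      = int (m * n) - int (independence_number (TQ_verts m n) (TQ_edges m n))"
    using gonality_eq card_V by simp
  show ?thesis
  proof (intro conjI impI)
    show "gonality (TQ_verts n n) (TQ_edges n n) =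
              (if gcd 6 n = 1 then int n * (int n - 1)
               else if \<not> 3 dvd n \<and> \<not> 4 dvd n then int n * (int n - 1) + 1
               else int n * (int n - 1) + 2)" if "m = n"
      unfolding gon[unfolded that] independence_number_square[OF that, unfolded that]
      by (simp add: algebra_simps)
    show "gonality (TQ_verts m n) (TQ_edges m n) = int (m * n) - int (gcd m n)"
      if "m \<noteq> n \<and> {m, n} \<noteq> {3, 6}"
      using gon independence_number_rectangle that by simp
  qed (rule gon, rule rank1_classes_bij)
qed

end
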